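(* Let $X$ be a complex Banach space, $\alpha\in(0,1)$, $T>0$, and let $A:D(A)\subset X\to X$ be an unbounded closed linear operator with $\overline{D(A)}=X$ such that $-A$ is sectorial with sectorial angle $\varphi_0\in(0,\pi/2)$. Let $s(\alpha)=\alpha$ if $\alpha\in(0,1/2)$ and $s(\alpha)=1-\alpha-\varepsilon$ if $\alpha\in[1/2,1)$, where $\varepsilon\in(0,1-\alpha)$ is an arbitrary fixed number. For $f\in D(A)$ let $u$ be the solution of the Cauchy problem $$\partial^\alpha u(t)=Au(t),\quad t\in(0,T];\qquad u(0)=f,$$ and for each integer $N\ge 1$, with $\Delta t=T/N$, $t_n=n\Delta t$, let $u_n=u_n^N\in X$, $0\le n\le N$, be defined by the finite difference scheme $$\sum_{j=0}^n \frac{a_{jn}u_j}{(\Delta t)^\alpha}-Au_n=0,\quad 1\le n\le N;\qquad u_0=f.$$ Then: (i) (stability) there is a constant $C$, independent of $N$, $n$ and $f$, such that $\|u_n^N\|\le C\|f\|$ for all $f\in D(A)$, $N\ge1$, $0\le n\le N$; (ii) (pointwise convergence) for every $f\in D(A)$ and every $t\in[0,T]$, $u^N_{[t/\Delta t]}\to u(t)$ in $X$ as $N\to\infty$; (iii) (rate of convergence) for every $t\in[0,T]$ there is a constant $C(t)>0$, independent of $N$ and $f$, such that for all $f\in D(A)$ and $N\ge1$ $$\|u^N_{[t/\Delta t]}-u([t/\Delta t]\Delta t)\|\le C(t)\,\|f\|\,(\Delta t)^{s(\alpha)}.$$ In particular, $u_N=u_N^N$ converges to $u(T)$ as $N\to\infty$,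 and $$\|u_N-u(T)\|\le C(T)\,\|f\|\,(\Delta t)^{s(\alpha)}.$$
   Context: $[x]$ denotes the integer part of $x\in\mathbb{R}$, and $E$ the identity operator on $X$. The Riemann--Liouville fractional integral is $(I_{0+}^{\alpha}u)(t)=\frac{1}{\Gamma(\alpha)}\int_0^t\frac{u(s)}{(t-s)^{1-\alpha}}ds$, $t>0$, and the Caputo derivative of order $\alpha\in(0,1)$ is $\partial^\alpha u=I_{0+}^{1-\alpha}u'$. A solution of the Cauchy problem is a function $u\in C([0,T];X)$ taking values in $D(A)$, satisfying both equations, and such that $\partial^\alpha u(t)$ is continuous for $t>0$. Under the stated assumptions on $A$ the problem is known to be well-posed; in particular, a unique solution exists for each $f\in D(A)$. Sectoriality: put $K(\varphi)=\{\zeta\in\mathbb{C}\setminus\{0\}:|\arg\zeta|<\varphi\}$. A linear operator $S:D(S)\subset X\to X$ is sectorial with sectorial angle $\varphi_0\in(0,\pi)$ if its spectrum satisfies $\sigma(S)\subset K(\varphi_0)$ and there is a constant $C_0$ independent of $\zeta$ with $\|(\zeta E-S)^{-1}\|\le \frac{C_0}{1+|\zeta|}$ for all $\zeta\in\mathbb{C}\setminus K(\varphi_0)$. Coefficients: for $1\le j\le n$, $$b_{jn}=\int_{j-1}^{j}\frac{dx}{x^{1-\alpha}(n-x)^{\alpha}},$$ and for $n\ge1$ $$a_{0n}=-\frac{\alpha}{\Gamma(1-\alpha)}b_{1n},\qquad a_{nn}=\frac{\alpha}{\Gamma(1-\alpha)}\frac{b_{nn}}{n^\alpha-(n-1)^\alpha},$$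 $$a_{jn}=\frac{\alpha}{\Gamma(1-\alpha)}\Bigl(\frac{b_{jn}}{j^\alpha-(j-1)^\alpha}-\frac{b_{j+1,n}}{(j+1)^\alpha-j^\alpha}\Bigr),\quad 1\le j\le n-1.$$ Since $u_0=f$ is given, the scheme determines $u_n$ recursively by $u_n=-(a_{nn}E-(\Delta t)^\alpha A)^{-1}\sum_{j=0}^{n-1}a_{jn}u_j$. Constants may depend on $\alpha$, $\varepsilon$, $T$ and $A$. *)

theory Defs
  imports "HOL-Analysis.Analysis"
begin

section \<open>Complex Banach spaces\<close>

text \<open>
  The real structure of a complex normed space is the restriction of the complex one, so that
  derivatives and integrals of functions of a real variable are those of the library.
\<close>

class complex_normed_vector = real_normed_vector +
  fixes scaleC :: "complex \<Rightarrow> 'a \<Rightarrow> 'a"  (infixr \<open>*\<^sub>C\<close> 75)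
  assumes scaleC_add_right: "a *\<^sub>C (x + y) = a *\<^sub>C x + a *\<^sub>C y"
    and scaleC_add_left: "(a + b) *\<^sub>C x = a *\<^sub>C x + b *\<^sub>C x"
    and scaleC_scaleC: "a *\<^sub>C b *\<^sub>C x = (a * b) *\<^sub>C x"
    and scaleR_scaleC: "r *\<^sub>R x = complex_of_real r *\<^sub>C x"
    and norm_scaleC: "norm (a *\<^sub>C x) = cmod a * norm x"

class complex_banach = complex_normed_vector + banach

instantiation complex :: complex_banach
begin

definition scaleC_complex :: "complex \<Rightarrow> complex \<Rightarrow> complex"
  where "scaleC_complex a x = a * x"

instance
  by standard (simp_all add: scaleC_complex_def algebra_simps norm_mult scaleR_conv_of_real)

end


section \<open>Unbounded operators\<close>

text \<open>
  A partially defined operator is represented by its domain \<open>D\<close> and a total function \<open>S\<close>,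
  whose values outside \<open>D\<close> are irrelevant.
\<close>

definition linear_operator_on :: "'x::complex_normed_vector set \<Rightarrow> ('x \<Rightarrow> 'x) \<Rightarrow> bool"
  where "linear_operator_on D S \<longleftrightarrow>
    0 \<in> D \<and>
    (\<forall>x\<in>D. \<forall>y\<in>D. x + y \<in> D \<and> S (x + y) = S x + S y) \<and>
    (\<forall>c. \<forall>x\<in>D. c *\<^sub>C x \<in> D \<and> S (c *\<^sub>C x) = c *\<^sub>C S x)"

definition closed_operator_on :: "'x::complex_normed_vector set \<Rightarrow> ('x \<Rightarrow> 'x) \<Rightarrow> bool"
  where "closed_operator_on D S \<longleftrightarrow> closed ((\<lambda>x. (x, S x)) ` D)"

definition unbounded_operator_on :: "'x::complex_normed_vector set \<Rightarrow> ('x \<Rightarrow> 'x) \<Rightarrow> bool"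
  where "unbounded_operator_on D S \<longleftrightarrow> \<not> (\<exists>C. \<forall>x\<in>D. norm (S x) \<le> C * norm x)"

definition resolvent ::
    "'x::complex_normed_vector set \<Rightarrow> ('x \<Rightarrow> 'x) \<Rightarrow> complex \<Rightarrow> 'x \<Rightarrow> 'x"
  where "resolvent D S \<zeta> = inv_into D (\<lambda>x. \<zeta> *\<^sub>C x - S x)"

definition spectrum_of :: "'x::complex_normed_vector set \<Rightarrow> ('x \<Rightarrow> 'x) \<Rightarrow> complex set"
  where "spectrum_of D S =
    {\<zeta>. \<not> (bij_betw (\<lambda>x. \<zeta> *\<^sub>C x - S x) D UNIV \<and> bounded_linear (resolvent D S \<zeta>))}"

definition sector :: "real \<Rightarrow> complex set"
  where "sector \<phi> = {\<zeta>. \<zeta> \<noteq> 0 \<and> \<bar>Arg \<zeta>\<bar> < \<phi>}"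

definition sectorial ::
    "'x::complex_normed_vector set \<Rightarrow> ('x \<Rightarrow> 'x) \<Rightarrow> real \<Rightarrow> bool"
  where "sectorial D S \<phi> \<longleftrightarrow>
    linear_operator_on D S \<and> 0 < \<phi> \<and> \<phi> < pi \<and>
    spectrum_of D S \<subseteq> sector \<phi> \<and>
    (\<exists>C. \<forall>\<zeta>. \<zeta> \<notin> sector \<phi> \<longrightarrow> onorm (resolvent D S \<zeta>) \<le> C / (1 + cmod \<zeta>))"


section \<open>Fractional integral and Caputo derivative\<close>

text \<open>
  The Bochner integral of the library requires a second countable space, which would be an
  extra assumption on the Banach space.  We use the Henstock-Kurzweil integral instead, together
  with integrability of the norm; for strongly measurable integrands (in particular for those
  built from the derivative of a continuous function) this is Bochner integrability, with the
  same value.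
\<close>

definition rl_kernel :: "real \<Rightarrow> (real \<Rightarrow> 'x::real_normed_vector) \<Rightarrow> real \<Rightarrow> real \<Rightarrow> 'x"
  where "rl_kernel \<beta> w t s = (1 / (t - s) powr (1 - \<beta>)) *\<^sub>R w s"

definition rl_integrable :: "real \<Rightarrow> (real \<Rightarrow> 'x::real_normed_vector) \<Rightarrow> real \<Rightarrow> bool"
  where "rl_integrable \<beta> w t \<longleftrightarrow>
    rl_kernel \<beta> w t integrable_on {0..t} \<and>
    (\<lambda>s. norm (rl_kernel \<beta> w t s)) integrable_on {0..t}"

definition rl_integral :: "real \<Rightarrow> (real \<Rightarrow> 'x::real_normed_vector) \<Rightarrow> real \<Rightarrow> 'x"
  where "rl_integral \<beta> w t = (1 / Gamma \<beta>) *\<^sub>R integral {0..t} (rl_kernel \<beta> w t)"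

definition deriv_vec :: "(real \<Rightarrow> 'x::real_normed_vector) \<Rightarrow> real \<Rightarrow> 'x"
  where "deriv_vec u s = vector_derivative u (at s)"

definition caputo :: "real \<Rightarrow> (real \<Rightarrow> 'x::real_normed_vector) \<Rightarrow> real \<Rightarrow> 'x"
  where "caputo \<alpha> u = rl_integral (1 - \<alpha>) (deriv_vec u)"

text \<open>
  Library derivatives and integrals are total functions, so the existence of the Caputo derivative
  on \<open>(0, T]\<close> has to be required explicitly.  Differentiability is asked for everywhere on
  \<open>(0, T)\<close>: with differentiability merely almost everywhere, \<open>u\<close> would not be determined by its
  derivative and its initial value.
\<close>

definition caputo_exists :: "real \<Rightarrow> real \<Rightarrow> (real \<Rightarrow> 'x::real_normed_vector) \<Rightarrow> bool"
  where "caputo_exists \<alpha> T u \<longleftrightarrow>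
    (\<forall>s\<in>{0<..<T}. u differentiable (at s)) \<and>
    (\<forall>t\<in>{0<..T}. rl_integrable (1 - \<alpha>) (deriv_vec u) t)"

definition cauchy_solution ::
    "'x::complex_normed_vector set \<Rightarrow> ('x \<Rightarrow> 'x) \<Rightarrow> real \<Rightarrow> real \<Rightarrow> 'x \<Rightarrow> (real \<Rightarrow> 'x) \<Rightarrow> bool"
  where "cauchy_solution D A \<alpha> T f u \<longleftrightarrow>
    continuous_on {0..T} u \<and> (\<forall>t\<in>{0..T}. u t \<in> D) \<and>
    caputo_exists \<alpha> T u \<and> continuous_on {0<..T} (caputo \<alpha> u) \<and>
    (\<forall>t\<in>{0<..T}. caputo \<alpha> u t = A (u t)) \<and> u 0 = f"


section \<open>The finite difference scheme\<close>

definition coeff_b :: "real \<Rightarrow> nat \<Rightarrow> nat \<Rightarrow> real"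
  where "coeff_b \<alpha> j n =
    integral {real j - 1..real j} (\<lambda>x. 1 / (x powr (1 - \<alpha>) * (real n - x) powr \<alpha>))"

definition coeff_ratio :: "real \<Rightarrow> nat \<Rightarrow> nat \<Rightarrow> real"
  where "coeff_ratio \<alpha> j n = coeff_b \<alpha> j n / (real j powr \<alpha> - (real j - 1) powr \<alpha>)"

text \<open>Only the values for \<open>0 \<le> j \<le> n\<close> and \<open>n \<ge> 1\<close> are meaningful.\<close>

definition coeff_a :: "real \<Rightarrow> nat \<Rightarrow> nat \<Rightarrow> real"
  where "coeff_a \<alpha> j n = \<alpha> / Gamma (1 - \<alpha>) *
    (if j = 0 then - coeff_b \<alpha> 1 n
     else if j = n then coeff_ratio \<alpha> n n
     else coeff_ratio \<alpha> j n - coeff_ratio \<alpha> (j + 1) n)"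

definition step_size :: "real \<Rightarrow> nat \<Rightarrow> real"
  where "step_size T N = T / real N"

definition fd_scheme ::
    "'x::complex_normed_vector set \<Rightarrow> ('x \<Rightarrow> 'x) \<Rightarrow> real \<Rightarrow> real \<Rightarrow> nat \<Rightarrow> 'x \<Rightarrow> (nat \<Rightarrow> 'x) \<Rightarrow> bool"
  where "fd_scheme D A \<alpha> T N f v \<longleftrightarrow>
    v 0 = f \<and>
    (\<forall>n\<in>{1..N}. v n \<in> D \<and>
      (\<Sum>j=0..n. (coeff_a \<alpha> j n / step_size T N powr \<alpha>) *\<^sub>R v j) - A (v n) = 0)"

definition grid_index :: "real \<Rightarrow> nat \<Rightarrow> real \<Rightarrow> nat"
  where "grid_index T N t = nat \<lfloor>t / step_size T N\<rfloor>"

definition rate_exponent :: "real \<Rightarrow> real \<Rightarrow> real"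
  where "rate_exponent \<epsilon> \<alpha> = (if \<alpha> < 1 / 2 then \<alpha> else 1 - \<alpha> - \<epsilon>)"

end

theory Submission imports Defs begin

text \<open>
  Write \<open>J h = (1 - h A)\<inverse>\<close> for the Euler step of size \<open>h > 0\<close>.  The proof rests on two bounds for
  products of Euler steps with arbitrary step sizes: such products are bounded by one constant
  (\<open>norm_Jprod\<close>), and multiplying all step sizes by a factor \<open>c\<close> between one half and one moves a
  product by at most a constant times \<open>1 - c\<close> (\<open>norm_Jprod_scale\<close>).  Both hold because a product of
  Euler steps is the contour integral of its symbol, a rational function, against the resolvent,
  over the boundary of a wedge that contains the spectrum (\<open>wedge_integral_Jprod\<close>); as the wedge has
  a half angle below a right angle, the symbols are bounded there, and the difference of two symbols
  decays at both ends of the boundary.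

  The supremum of \<open>norm (Jprod hs x)\<close> over all lists \<open>hs\<close> is therefore an equivalent norm in which
  all Euler steps are contractions.  In such a norm both the equation and the scheme obey a maximum
  principle, since both express the present as an Euler step applied to an average of the past.  For
  the scheme this is immediate: the weights decrease backwards in time (\<open>step_weight_mono\<close>), so the
  new value is an Euler step of a convex combination of the old ones.  This is the stability.  For
  the equation, integration by parts turns the Caputo derivative into an average of the history, up
  to a small error (\<open>cauchy_solution_average\<close>), and \<open>fractional_maximum_principle\<close> follows.

  The dilated function \<open>u (r t)\<close> solves the equation with the operator \<open>r powr \<alpha>\<close> times \<open>A\<close>.  The
  maximum principle for the difference of the two, measured by differences of products with step
  sizes \<open>h\<close> and \<open>r powr \<alpha> * h\<close>, therefore compares \<open>u t\<close> with \<open>u (r t)\<close> and gives a bound by a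
  multiple of \<open>(1 - r) * norm f\<close>: solutions are Lipschitz in the logarithm of time, so that the
  norm of the derivative at \<open>t\<close> is at most a constant times \<open>norm f / t\<close>.  These a priori estimates
  (\<open>cauchy_solution_estimates\<close>) are all the regularity that the error analysis uses.

  They imply a truncation error of size \<open>norm f / n\<close> in the \<open>n\<close>-th step (\<open>truncation_error\<close>).  The
  sequence \<open>n powr (- s)\<close>, started at zero, is a supersolution for errors of this size as long as
  \<open>s < 1 - \<alpha>\<close> (\<open>barrier_supersolution\<close>), and the discrete maximum principle yields an error of size
  \<open>norm f * n powr (- s)\<close>.  The rate exponent of the theorem satisfies \<open>0 < s < 1 - \<alpha>\<close> in both of its
  cases, and at a fixed time the step number is proportional to the inverse of the step size.
\<close>

section \<open>Complex scaling\<close>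

lemma scaleC_zero_left [simp]: "0 *\<^sub>C (x::'x::complex_normed_vector) = 0"
  using norm_scaleC[of 0 x] by simp

lemma scaleC_one [simp]: "1 *\<^sub>C (x::'x::complex_normed_vector) = x"
  using scaleR_scaleC[of 1 x] by simp

lemma bounded_bilinear_scaleC:
  "bounded_bilinear ((*\<^sub>C) :: complex \<Rightarrow> 'x \<Rightarrow> 'x::complex_normed_vector)"
proof
  show "\<exists>K. \<forall>a b. norm (a *\<^sub>C (b::'x)) \<le> norm a * norm b * K"
    by (intro exI[of _ 1]) (simp add: norm_scaleC)
qed (simp_all add: scaleC_add_left scaleC_add_right scaleR_scaleC[where 'a='x] scaleR_conv_of_real scaleC_scaleC mult.commute)

interpretation scaleC: bounded_bilinear "(*\<^sub>C) :: complex \<Rightarrow> 'x \<Rightarrow> 'x::complex_normed_vector"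
  by (rule bounded_bilinear_scaleC)

lemma scaleC_eq_divide: "c \<noteq> 0 \<Longrightarrow> c *\<^sub>C (x::'x::complex_normed_vector) = y \<Longrightarrow> x = (1/c) *\<^sub>C y"
  using scaleC_scaleC[of "1/c" c x] by simp

lemma continuous_on_dominated:
  fixes p :: "'a::metric_space \<Rightarrow> 'x::real_normed_vector" and y :: "'a \<Rightarrow> 'y::real_normed_vector"
  assumes y: "continuous_on S y" and M: "\<And>s t. s \<in> S \<Longrightarrow> t \<in> S \<Longrightarrow> norm (p s - p t) \<le> M * norm (y s - y t)"
  shows "continuous_on S p"
  unfolding continuous_on_def
proof
  fix t assume t: "t \<in> S"
  have "((\<lambda>s. M * norm (y s - y t)) \<longlongrightarrow> M * norm (y t - y t)) (at t within S)"
    using y t by (intro tendsto_intros) (auto simp: continuous_on_def)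
  then have lim: "((\<lambda>s. M * norm (y s - y t)) \<longlongrightarrow> 0) (at t within S)" by simp
  have "\<forall>\<^sub>F s in at t within S. norm (p s - p t) \<le> M * norm (y s - y t)"
    using M[OF _ t] by (auto simp: eventually_at intro!: exI[of _ 1])
  from Lim_null_comparison[OF this lim]
  have "((\<lambda>s. p s - p t) \<longlongrightarrow> 0) (at t within S)" .
  then show "(p \<longlongrightarrow> p t) (at t within S)" by (simp add: Lim_null[of p])
qed

section \<open>Resolvents and Euler steps\<close>

abbreviation all_pos :: "real list \<Rightarrow> bool"
  where "all_pos hs \<equiv> \<forall>h\<in>set hs. 0 < h"

text \<open>
  The constants of a sectorial operator are fixed once, so that later bounds can refer to them.
  The boundary of the sector belongs to the resolvent set, and so does the origin.
\<close>

locale sectorial_resolvent =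
  fixes D :: "'x::complex_banach set" and A :: "'x \<Rightarrow> 'x" and \<phi> C :: real
  assumes lin: "linear_operator_on D A"
    and phi: "0 < \<phi>" "\<phi> < pi / 2"
    and spec: "spectrum_of D (\<lambda>x. - A x) \<subseteq> sector \<phi>"
    and onorm_R: "\<And>\<zeta>. \<zeta> \<notin> sector \<phi> \<Longrightarrow> onorm (resolvent D (\<lambda>x. - A x) \<zeta>) \<le> C / (1 + cmod \<zeta>)"
begin

definition R :: "complex \<Rightarrow> 'x \<Rightarrow> 'x"
  where "R \<zeta> = resolvent D (\<lambda>x. - A x) \<zeta>"

lemma A_add: "x \<in> D \<Longrightarrow> y \<in> D \<Longrightarrow> A (x + y) = A x + A y"
  and A_scaleC: "x \<in> D \<Longrightarrow> A (c *\<^sub>C x) = c *\<^sub>C A x"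
  and D_add: "x \<in> D \<Longrightarrow> y \<in> D \<Longrightarrow> x + y \<in> D"
  and D_scaleC: "x \<in> D \<Longrightarrow> c *\<^sub>C x \<in> D"
  using lin by (auto simp: linear_operator_on_def)

lemma A_scaleR: "x \<in> D \<Longrightarrow> A (r *\<^sub>R x) = r *\<^sub>R A x"
  and D_scaleR: "x \<in> D \<Longrightarrow> r *\<^sub>R x \<in> D"
  by (simp_all add: scaleR_scaleC A_scaleC D_scaleC)

lemma A_diff: "x \<in> D \<Longrightarrow> y \<in> D \<Longrightarrow> A (x - y) = A x - A y"
  and D_diff: "x \<in> D \<Longrightarrow> y \<in> D \<Longrightarrow> x - y \<in> D"
  using A_add[of x "(-1) *\<^sub>R y"] D_add[of x "(-1) *\<^sub>R y"] A_scaleR[of y "-1"] D_scaleR[of y "-1"]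
  by simp_all

lemma bij_shift: "\<zeta> \<notin> sector \<phi> \<Longrightarrow> bij_betw (\<lambda>x. \<zeta> *\<^sub>C x + A x) D UNIV"
  and bounded_linear_R: "\<zeta> \<notin> sector \<phi> \<Longrightarrow> bounded_linear (R \<zeta>)"
  using spec by (auto simp: spectrum_of_def R_def)

lemma R_in_D: "\<zeta> \<notin> sector \<phi> \<Longrightarrow> R \<zeta> y \<in> D"
  using bij_shift[of \<zeta>] inv_into_into[of y "\<lambda>x. \<zeta> *\<^sub>C x + A x" D]
  by (simp add: R_def resolvent_def bij_betw_def)

lemma shift_R: "\<zeta> \<notin> sector \<phi> \<Longrightarrow> \<zeta> *\<^sub>C R \<zeta> y + A (R \<zeta> y) = y"
  using bij_shift[of \<zeta>] f_inv_into_f[of y "\<lambda>x. \<zeta> *\<^sub>C x + A x" D]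
  by (simp add: R_def resolvent_def bij_betw_def)

lemma R_shift: "\<zeta> \<notin> sector \<phi> \<Longrightarrow> x \<in> D \<Longrightarrow> R \<zeta> (\<zeta> *\<^sub>C x + A x) = x"
  using bij_shift[of \<zeta>] inv_into_f_f[of "\<lambda>x. \<zeta> *\<^sub>C x + A x" D x]
  by (simp add: R_def resolvent_def bij_betw_def)

lemma R_eqI: "\<zeta> \<notin> sector \<phi> \<Longrightarrow> x \<in> D \<Longrightarrow> \<zeta> *\<^sub>C x + A x = y \<Longrightarrow> R \<zeta> y = x"
  using R_shift by blast

lemma R_scaleC: "\<zeta> \<notin> sector \<phi> \<Longrightarrow> R \<zeta> (c *\<^sub>C y) = c *\<^sub>C R \<zeta> y"
proof (rule R_eqI)
  assume z: "\<zeta> \<notin> sector \<phi>"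
  show "\<zeta> *\<^sub>C c *\<^sub>C R \<zeta> y + A (c *\<^sub>C R \<zeta> y) = c *\<^sub>C y"
    using arg_cong[OF shift_R[OF z, of y], of "\<lambda>x. c *\<^sub>C x"] R_in_D[OF z, of y]
    by (simp add: A_scaleC scaleC_add_right scaleC_scaleC mult.commute)
qed (auto intro: D_scaleC R_in_D)

lemma norm_R: "\<zeta> \<notin> sector \<phi> \<Longrightarrow> norm (R \<zeta> y) \<le> C / (1 + cmod \<zeta>) * norm y"
proof -
  assume z: "\<zeta> \<notin> sector \<phi>"
  have "norm (R \<zeta> y) \<le> onorm (R \<zeta>) * norm y"
    by (rule onorm[OF bounded_linear_R[OF z]])
  also have "\<dots> \<le> C / (1 + cmod \<zeta>) * norm y"
    using onorm_R[OF z] by (intro mult_right_mono) (simp_all add: R_def)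
  finally show ?thesis .
qed

lemma zero_notin_sector: "0 \<notin> sector \<phi>"
  by (simp add: sector_def)

lemma C_nonneg: "0 \<le> C"
  using onorm_R[OF zero_notin_sector] onorm_pos_le[OF bounded_linear_R[OF zero_notin_sector]]
  by (simp add: R_def)

lemma norm_R_le: "\<zeta> \<notin> sector \<phi> \<Longrightarrow> norm (R \<zeta> y) \<le> C * norm y"
proof -
  assume z: "\<zeta> \<notin> sector \<phi>"
  have "C * 1 \<le> C * (1 + cmod \<zeta>)" using C_nonneg by (intro mult_left_mono) simp_all
  then have "C / (1 + cmod \<zeta>) \<le> C" by (simp add: pos_divide_le_eq add_pos_nonneg)
  then show ?thesis using norm_R[OF z, of y] mult_right_mono[of "C / (1 + cmod \<zeta>)" C "norm y"] by simp
qed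

text \<open>
  Resolvents at two points differ by the distance of the points times a bounded operator.  This gives
  continuity and the complex derivative of the resolvent on the complement of the sector, up to the
  boundary.
\<close>

lemma resolvent_identity:
  assumes z: "\<zeta> \<notin> sector \<phi>" and w: "\<omega> \<notin> sector \<phi>"
  shows "R \<zeta> y - R \<omega> y = (\<omega> - \<zeta>) *\<^sub>C R \<zeta> (R \<omega> y)"
proof -
  interpret r: bounded_linear "R \<zeta>" by (rule bounded_linear_R[OF z])
  have "(\<omega> - \<zeta>) *\<^sub>C R \<omega> y = y - (\<zeta> *\<^sub>C R \<omega> y + A (R \<omega> y))"
    using shift_R[OF w, of y] by (simp add: scaleC.diff_left algebra_simps)
  then have "R \<zeta> ((\<omega> - \<zeta>) *\<^sub>C R \<omega> y) = R \<zeta> y - R \<omega> y"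
    using R_shift[OF z R_in_D[OF w, of y]] by (simp add: r.diff)
  then show ?thesis by (simp add: R_scaleC[OF z])
qed

text \<open>
  The resolvent of \<open>-A\<close> at the negative number \<open>-1/h\<close>, normalised so that it inverts \<open>1 - h A\<close>.
\<close>

definition J :: "real \<Rightarrow> 'x \<Rightarrow> 'x"
  where "J h y = (- (1/h)) *\<^sub>R R (complex_of_real (- (1/h))) y"

lemma neg_real_notin_sector: "r \<le> 0 \<Longrightarrow> complex_of_real r \<notin> sector \<phi>"
proof -
  assume r: "r \<le> 0"
  show ?thesis
  proof (cases "r = 0")
    case False
    then have "Arg (complex_of_real r) = pi" using r Arg_of_real[of r] by simp
    then show ?thesis using phi by (simp add: sector_def)
  qed (simp add: sector_def)
qed

lemma J_in_D: "0 < h \<Longrightarrow> J h y \<in> D"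
  unfolding J_def by (intro D_scaleR R_in_D neg_real_notin_sector) simp

lemma J_inverse: "0 < h \<Longrightarrow> J h y - h *\<^sub>R A (J h y) = y"
proof -
  assume z: "0 < h"
  let ?w = "complex_of_real (- (1/h))"
  have w: "?w \<notin> sector \<phi>" by (rule neg_real_notin_sector) (use z in simp)
  have "A (J h y) = (- (1/h)) *\<^sub>R A (R ?w y)"
    unfolding J_def by (rule A_scaleR[OF R_in_D[OF w]])
  then have "J h y - h *\<^sub>R A (J h y) = ?w *\<^sub>C R ?w y + A (R ?w y)"
    using z by (simp add: J_def scaleR_scaleC[symmetric] del: of_real_minus of_real_divide of_real_1)
  then show ?thesis using shift_R[OF w] by simp
qed

lemma bounded_linear_J: "0 < h \<Longrightarrow> bounded_linear (J h)"
  unfolding J_def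
  by (intro bounded_linear_const_scaleR bounded_linear_R neg_real_notin_sector) simp

lemma J_eqI: "0 < h \<Longrightarrow> x \<in> D \<Longrightarrow> x - h *\<^sub>R A x = y \<Longrightarrow> J h y = x"
proof -
  assume z: "0 < h" and x: "x \<in> D" and y: "x - h *\<^sub>R A x = y"
  let ?w = "complex_of_real (- (1/h))"
  have w: "?w \<notin> sector \<phi>" by (rule neg_real_notin_sector) (use z in simp)
  have "R ?w ((-(1/h)) *\<^sub>R y) = x"
    by (rule R_eqI[OF w x]) (use z in \<open>simp add: y[symmetric] scaleR_scaleC scaleC.diff_right scaleC_scaleC scaleC.minus_left\<close>)
  moreover interpret r: bounded_linear "R ?w" by (rule bounded_linear_R[OF w])
  have "R ?w ((-(1/h)) *\<^sub>R y) = (-(1/h)) *\<^sub>R R ?w y" by (rule r.scaleR)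
  ultimately show ?thesis unfolding J_def by simp
qed

text \<open>
  The induction step for contour integrals: against the resolvent an Euler step is a scalar factor,
  up to a term that no longer contains the resolvent and that will integrate to zero.
\<close>

lemma R_J:
  assumes l: "\<omega> \<notin> sector \<phi>" and z: "0 < h" and nz: "1 + complex_of_real h * \<omega> \<noteq> 0"
  shows "R \<omega> (J h f) = (1 / (1 + h * \<omega>)) *\<^sub>C (R \<omega> f + complex_of_real h *\<^sub>C J h f)"
proof -
  interpret r: bounded_linear "R \<omega>" by (rule bounded_linear_R[OF l])
  let ?x = "J h f"
  have "h *\<^sub>R (\<omega> *\<^sub>C ?x + A ?x) = (1 + h * \<omega>) *\<^sub>C ?x - f"
    using J_inverse[OF z, of f]
    by (simp add: scaleR_scaleC scaleC_add_right scaleC_add_left scaleC_scaleC algebra_simps)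
  then have "h *\<^sub>R ?x = (1 + h * \<omega>) *\<^sub>C R \<omega> ?x - R \<omega> f"
    using R_shift[OF l J_in_D[OF z, of f]] by (metis R_scaleC l r.diff r.scaleR)
  then have "(1 + h * \<omega>) *\<^sub>C R \<omega> ?x = R \<omega> f + complex_of_real h *\<^sub>C ?x"
    by (simp add: scaleR_scaleC)
  then show ?thesis using nz by (rule scaleC_eq_divide[rotated])
qed

fun Jprod :: "real list \<Rightarrow> 'x \<Rightarrow> 'x" where
  "Jprod [] x = x"
| "Jprod (h # hs) x = Jprod hs (J h x)"

lemma bounded_linear_Jprod: "all_pos hs \<Longrightarrow> bounded_linear (Jprod hs)"
proof (induction hs)
  case Nil
  have "Jprod [] = (\<lambda>x. x)" by auto
  then show ?case by (simp add: bounded_linear_ident)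
next
  case (Cons h hs)
  have "Jprod (h # hs) = (\<lambda>x. Jprod hs (J h x))" by auto
  then show ?case using Cons by (simp add: bounded_linear_compose[OF _ bounded_linear_J])
qed

end

section \<open>Contour integrals along rays\<close>

definition ray_point :: "real \<Rightarrow> real \<Rightarrow> complex"
  where "ray_point \<psi> x = exp (complex_of_real x + \<i> * complex_of_real \<psi>)"

text \<open>
  The integral of \<open>G\<close> over the ray of angle \<open>\<psi>\<close> through the origin, in the logarithmic parameter and cut
  off at the moduli \<open>exp (- X)\<close> and \<open>exp X\<close>.  In this parameter both ends of the ray are at infinity
  and multiplication of the step sizes becomes a translation.
\<close>

definition ray_integral :: "real \<Rightarrow> real \<Rightarrow> (complex \<Rightarrow> 'x) \<Rightarrow> 'x::complex_banach"
  where "ray_integral X \<psi> G = integral {-X..X} (\<lambda>x. ray_point \<psi> x *\<^sub>C G (ray_point \<psi> x))"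

lemma norm_ray_point [simp]: "cmod (ray_point \<psi> x) = exp x"
  by (simp add: ray_point_def)

lemma ray_point_polar: "ray_point \<psi> x = exp x *\<^sub>R cis \<psi>"
  by (simp add: ray_point_def exp_add cis_conv_exp exp_of_real scaleR_conv_of_real)

lemma continuous_on_ray_point [continuous_intros]:
  "continuous_on S f \<Longrightarrow> continuous_on S g \<Longrightarrow> continuous_on S (\<lambda>z. ray_point (f z) (g z))"
  unfolding ray_point_def by (intro continuous_intros)

lemma ray_point_has_derivative:
  "(ray_point \<psi> has_derivative (\<lambda>h. complex_of_real h * (1 * ray_point \<psi> x))) (at x within S)"
  "((\<lambda>\<psi>. ray_point \<psi> x) has_derivative (\<lambda>h. complex_of_real h * (\<i> * ray_point \<psi> x))) (at \<psi> within S)"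
proof -
  have *: "((\<lambda>x. exp (p x)) has_derivative (\<lambda>h. exp (p x) * p' h)) (at x within S)"
    if "(p has_derivative p') (at x within S)" for p :: "real \<Rightarrow> complex" and p' x
    using has_derivative_compose[OF that DERIV_exp[unfolded has_field_derivative_def]] .
  show "(ray_point \<psi> has_derivative (\<lambda>h. complex_of_real h * (1 * ray_point \<psi> x))) (at x within S)"
    unfolding ray_point_def
    by (rule has_derivative_eq_rhs[OF *[where p' = complex_of_real]])
       (auto intro!: derivative_eq_intros simp: mult_ac)
  show "((\<lambda>\<psi>. ray_point \<psi> x) has_derivative (\<lambda>h. complex_of_real h * (\<i> * ray_point \<psi> x))) (at \<psi> within S)"
    unfolding ray_point_def
    by (rule has_derivative_eq_rhs[OF *[where p' = "\<lambda>h. \<i> * complex_of_real h"]])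
       (auto intro!: derivative_eq_intros simp: mult_ac)
qed

lemma complex_derivative_along_path:
  fixes G :: "complex \<Rightarrow> 'x::complex_banach"
  assumes DG: "\<And>l. l \<in> \<Omega> \<Longrightarrow> (G has_derivative (\<lambda>z. z *\<^sub>C G' l)) (at l within \<Omega>)"
    and e: "e ` S \<subseteq> \<Omega>" and x: "x \<in> S"
    and De: "(e has_derivative (\<lambda>h. complex_of_real h * (c * e x))) (at x within S)"
  shows "((\<lambda>x. e x *\<^sub>C G (e x)) has_vector_derivative
           (c * e x) *\<^sub>C (G (e x) + e x *\<^sub>C G' (e x))) (at x within S)"
proof -
  have "((\<lambda>x. G (e x)) has_derivative (\<lambda>h. (complex_of_real h * (c * e x)) *\<^sub>C G' (e x))) (at x within S)"
    by (rule has_derivative_in_compose2[OF DG e x De]) 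
  from scaleC.FDERIV[OF De this]
  show ?thesis unfolding has_vector_derivative_def
    by (rule has_derivative_eq_rhs)
       (auto simp: fun_eq_iff scaleR_scaleC scaleC_add_right scaleC_scaleC mult_ac add.commute)
qed

text \<open>
  A form of Cauchy's theorem that needs only calculus in a Banach space.  The derivative of
  \<open>ray_integral\<close> in the angle is the imaginary unit times the integral of the derivative in the radial
  parameter, because \<open>G\<close> is complex differentiable; so it consists of the two boundary terms, which are
  small under quadratic decay.  The derivative is taken within \<open>\<Omega>\<close> since the extreme rays may lie on
  the boundary of the region of holomorphy.
\<close>

lemma ray_integral_rotate:
  fixes G :: "complex \<Rightarrow> 'x::complex_banach"
  assumes DG: "\<And>l. l \<in> \<Omega> \<Longrightarrow> (G has_derivative (\<lambda>z. z *\<^sub>C G' l)) (at l within \<Omega>)"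
    and G': "continuous_on \<Omega> G'"
    and \<Omega>: "\<And>x \<psi>. \<psi> \<in> {\<psi>1..\<psi>2} \<Longrightarrow> ray_point \<psi> x \<in> \<Omega>"
    and bound: "\<And>l. l \<in> \<Omega> \<Longrightarrow> norm (G l) \<le> K / (1 + cmod l)\<^sup>2"
    and X: "0 \<le> X" and ps: "\<psi>1 \<le> \<psi>2"
  shows "norm (ray_integral X \<psi>2 G - ray_integral X \<psi>1 G) \<le> 2 * K * exp (- X) * (\<psi>2 - \<psi>1)"
proof -
  let ?f = "\<lambda>\<psi> x. ray_point \<psi> x *\<^sub>C G (ray_point \<psi> x)"
  let ?h = "\<lambda>\<psi> x. G (ray_point \<psi> x) + ray_point \<psi> x *\<^sub>C G' (ray_point \<psi> x)"
  let ?U = "{\<psi>1..\<psi>2}"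
  have K: "0 \<le> K"
  proof -
    have "0 \<le> K / (1 + cmod (ray_point \<psi>1 0))\<^sup>2"
      using bound[OF \<Omega>[of \<psi>1 0]] ps by (meson atLeastAtMost_iff norm_ge_zero order_trans order_refl)
    then show ?thesis by (simp add: zero_le_divide_iff)
  qed
  have contG: "continuous_on \<Omega> G"
    using DG has_derivative_continuous continuous_on_eq_continuous_within by blast
  have cont: "continuous_on S (\<lambda>z. g (ray_point (p z) (q z)))"
    if "continuous_on \<Omega> g" "continuous_on S p" "continuous_on S q" "p ` S \<subseteq> ?U" 
    for g :: "complex \<Rightarrow> 'x" and S :: "'s::topological_space set" and p q
    by (rule continuous_on_compose2[OF that(1)]) (use that \<Omega> in \<open>auto intro!: continuous_intros\<close>)
  have small: "norm (?f \<psi> x) \<le> K * exp (- \<bar>x\<bar>)" if "\<psi> \<in> ?U" for \<psi> x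
  proof -
    have "norm (?f \<psi> x) \<le> exp x * (K / (1 + exp x)\<^sup>2)"
      using mult_left_mono[OF bound[OF \<Omega>[OF that, of x]], of "exp x"] by (simp add: norm_scaleC)
    also have "exp x * (K / (1 + exp x)\<^sup>2) = K * (exp x / (1 + exp x)\<^sup>2)" by simp
    also have "\<dots> \<le> K * exp (- \<bar>x\<bar>)"
    proof (rule mult_left_mono[OF _ K])
      have e: "exp (- \<bar>x\<bar>) = min (exp x) (1 / exp x)"
        by (auto simp: min_def abs_if exp_minus field_simps simp flip: exp_add)
      have "exp x * 1 \<le> exp x * (1 + exp x)\<^sup>2" by (intro mult_left_mono) (auto simp: power2_eq_square algebra_simps add_pos_pos less_imp_le)
      moreover have "exp x * exp x \<le> (1 + exp x)\<^sup>2" by (simp add: power2_eq_square algebra_simps)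
      ultimately show "exp x / (1 + exp x)\<^sup>2 \<le> exp (- \<bar>x\<bar>)"
        unfolding e by (simp add: divide_le_eq le_divide_eq zero_less_power2 add_pos_pos[THEN less_imp_neq, symmetric])
    qed
    finally show ?thesis .
  qed
  have der: "((\<lambda>\<psi>. ray_integral X \<psi> G) has_vector_derivative
      integral (cbox (-X) X) (\<lambda>x. (\<i> * ray_point \<psi> x) *\<^sub>C ?h \<psi> x)) (at \<psi> within ?U)" if "\<psi> \<in> ?U" for \<psi>
    unfolding ray_integral_def interval_cbox[of "-X" X]
  proof (rule leibniz_rule_vector_derivative)
    fix p x assume "p \<in> ?U" 
    then show "((\<lambda>\<psi>. ?f \<psi> x) has_vector_derivative (\<i> * ray_point p x) *\<^sub>C ?h p x) (at p within ?U)"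
      by (intro complex_derivative_along_path[OF DG]) (auto intro: \<Omega> ray_point_has_derivative)
  next
    fix p assume "p \<in> ?U"
    then show "?f p integrable_on cbox (-X) X"
      by (intro integrable_continuous continuous_intros scaleC.continuous_on cont[OF contG]) auto
  next
    show "continuous_on (?U \<times> cbox (-X) X) (\<lambda>(p, x). (\<i> * ray_point p x) *\<^sub>C ?h p x)"
      unfolding split_beta
      by (intro continuous_intros scaleC.continuous_on cont[OF contG] cont[OF G']) auto
  qed (use that in auto)
  have der_eq: "integral (cbox (-X) X) (\<lambda>x. (\<i> * ray_point \<psi> x) *\<^sub>C ?h \<psi> x) = \<i> *\<^sub>C (?f \<psi> X - ?f \<psi> (-X))"
    if "\<psi> \<in> ?U" for \<psi>
  proof -
    have "((\<lambda>x. \<i> *\<^sub>C ?f \<psi> x) has_vector_derivative (\<i> *\<^sub>C ((1 * ray_point \<psi> x) *\<^sub>C ?h \<psi> x))) (at x within {-X..X})"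
      if "x \<in> {-X..X}" for x
      by (intro bounded_linear.has_vector_derivative[OF scaleC.bounded_linear_right]
           complex_derivative_along_path[OF DG _ _ ray_point_has_derivative(1)])
         (use \<open>\<psi> \<in> ?U\<close> that in \<open>auto intro: \<Omega>\<close>)
    from fundamental_theorem_of_calculus[OF _ this] X
    have "((\<lambda>x. \<i> *\<^sub>C ((1 * ray_point \<psi> x) *\<^sub>C ?h \<psi> x)) has_integral \<i> *\<^sub>C ?f \<psi> X - \<i> *\<^sub>C ?f \<psi> (-X)) {-X..X}"
      by simp
    then show ?thesis
      by (simp add: integral_unique scaleC_scaleC scaleC.diff_right)
  qed
  have "norm (ray_integral X \<psi>2 G - ray_integral X \<psi>1 G) \<le> (2 * K * exp (- X)) * norm (\<psi>2 - \<psi>1)"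
  proof (rule differentiable_bound[where S="?U"])
    fix p assume p: "p \<in> ?U"
    show "((\<lambda>\<psi>. ray_integral X \<psi> G) has_derivative (\<lambda>h. h *\<^sub>R (\<i> *\<^sub>C (?f p X - ?f p (-X))))) (at p within ?U)"
      using der[OF p] unfolding der_eq[OF p] has_vector_derivative_def .
    have "norm (\<i> *\<^sub>C (?f p X - ?f p (-X))) \<le> norm (?f p X) + norm (?f p (-X))"
      using norm_triangle_ineq4[of "?f p X" "?f p (-X)"] by (simp add: norm_scaleC)
    also have "\<dots> \<le> 2 * K * exp (- X)"
      using small[OF p, of X] small[OF p, of "-X"] X by simp
    finally show "onorm (\<lambda>h::real. h *\<^sub>R (\<i> *\<^sub>C (?f p X - ?f p (-X)))) \<le> 2 * K * exp (- X)"
      by (intro onorm_le) (simp add: mult.commute mult_left_mono)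
  qed (use ps in auto)
  then show ?thesis using ps by simp
qed

lemma tendsto_ray_integral_rotate:
  fixes G :: "complex \<Rightarrow> 'x::complex_banach"
  assumes "\<And>l. l \<in> \<Omega> \<Longrightarrow> (G has_derivative (\<lambda>z. z *\<^sub>C G' l)) (at l within \<Omega>)"
    and "continuous_on \<Omega> G'"
    and "\<And>x \<psi>. \<psi> \<in> {\<psi>1..\<psi>2} \<Longrightarrow> ray_point \<psi> x \<in> \<Omega>"
    and "\<And>l. l \<in> \<Omega> \<Longrightarrow> norm (G l) \<le> K / (1 + cmod l)\<^sup>2"
    and "\<psi>1 \<le> \<psi>2"
  shows "((\<lambda>X. ray_integral X \<psi>2 G - ray_integral X \<psi>1 G) \<longlongrightarrow> 0) at_top"
proof (rule Lim_null_comparison)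
  show "\<forall>\<^sub>F X in at_top. norm (ray_integral X \<psi>2 G - ray_integral X \<psi>1 G) \<le> 2 * K * exp (- X) * (\<psi>2 - \<psi>1)"
    using eventually_ge_at_top[of 0] by eventually_elim (rule ray_integral_rotate[OF assms(1-4) _ assms(5)])
  have "((\<lambda>X::real. exp (- X)) \<longlongrightarrow> 0) at_top"
    by (rule filterlim_compose[OF exp_at_bot filterlim_uminus_at_bot_at_top])
  then have "((\<lambda>X. 2 * K * exp (- X) * (\<psi>2 - \<psi>1)) \<longlongrightarrow> 2 * K * 0 * (\<psi>2 - \<psi>1)) at_top"
    by (intro tendsto_intros)
  then show "((\<lambda>X. 2 * K * exp (- X) * (\<psi>2 - \<psi>1)) \<longlongrightarrow> 0) at_top" by simp
qed

lemma ray_integral_add: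
  fixes G H :: "complex \<Rightarrow> 'x::complex_banach"
  assumes "continuous_on UNIV (\<lambda>x. G (ray_point \<psi> x))" "continuous_on UNIV (\<lambda>x. H (ray_point \<psi> x))"
  shows "ray_integral X \<psi> (\<lambda>l. G l + H l) = ray_integral X \<psi> G + ray_integral X \<psi> H"
  unfolding ray_integral_def scaleC_add_right
  by (intro integral_add integrable_continuous_interval scaleC.continuous_on continuous_intros
       continuous_on_subset[OF assms(1)] continuous_on_subset[OF assms(2)]) auto

lemma ray_integral_scaleC:
  fixes F :: "complex \<Rightarrow> complex" and g :: "'x::complex_banach"
  assumes "continuous_on UNIV (\<lambda>x. F (ray_point \<psi> x))"
  shows "ray_integral X \<psi> (\<lambda>l. F l *\<^sub>C g) = ray_integral X \<psi> F *\<^sub>C g"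
proof -
  have "(\<lambda>x. ray_point \<psi> x *\<^sub>C F (ray_point \<psi> x)) integrable_on {-X..X}"
    by (intro integrable_continuous_interval scaleC.continuous_on continuous_intros
         continuous_on_subset[OF assms]) auto
  from integral_linear[OF this scaleC.bounded_linear_left[of g]]
  show ?thesis by (simp add: ray_integral_def o_def scaleC_scaleC scaleC_complex_def)
qed

section \<open>Symbols of products of Euler steps\<close>

text \<open>
  For a point outside a cone around the positive axis there is no cancellation in \<open>1 - w\<close>.
\<close>

lemma one_minus_bound:
  assumes "Re w \<le> cmod w * c" "0 \<le> c" "c < 1"
  shows "sqrt ((1 - c) / 2) * (1 + cmod w) \<le> cmod (1 - w)"
proof -
  have "(cmod (1 - w))\<^sup>2 = 1 - 2 * Re w + (cmod w)\<^sup>2"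
    by (simp only: cmod_power2) (simp add: power2_eq_square algebra_simps)
  also have "\<dots> \<ge> 1 - 2 * (cmod w * c) + (cmod w)\<^sup>2" using assms(1) by simp
  finally have 1: "(cmod (1 - w))\<^sup>2 \<ge> 1 - 2 * (cmod w * c) + (cmod w)\<^sup>2" .
  have "0 \<le> (1 + c) / 2 * (1 - cmod w)\<^sup>2" using assms by simp
  then have "(1 - c) / 2 * (1 + cmod w)\<^sup>2 \<le> (cmod (1 - w))\<^sup>2"
    using 1 by (simp add: power2_eq_square field_simps)
  then have "sqrt ((1 - c) / 2 * (1 + cmod w)\<^sup>2) \<le> cmod (1 - w)"
    by (intro real_le_lsqrt) auto
  then show ?thesis by (simp only: real_sqrt_mult real_sqrt_abs) simp
qed

text \<open>
  The rational function of which a product of Euler steps is the value at \<open>-A\<close>.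
\<close>

definition symbol :: "real list \<Rightarrow> complex \<Rightarrow> complex"
  where "symbol hs l = prod_list (map (\<lambda>h. 1 / (1 + complex_of_real h * l)) hs)"

lemma symbol_simps [simp]:
  "symbol [] l = 1"
  "symbol (h # hs) l = 1 / (1 + complex_of_real h * l) * symbol hs l"
  by (simp_all add: symbol_def)

lemma one_plus_nonzero: "0 \<le> h \<Longrightarrow> 0 \<le> Re l \<Longrightarrow> 1 + complex_of_real h * l \<noteq> 0"
proof
  assume "0 \<le> h" "0 \<le> Re l" "1 + complex_of_real h * l = 0"
  then have "Re (1 + complex_of_real h * l) = 0" by simp
  then show False using mult_nonneg_nonneg[OF \<open>0 \<le> h\<close> \<open>0 \<le> Re l\<close>] by simp
qed

lemma norm_one_plus_ge: 
  assumes "0 \<le> h" "0 \<le> Re l"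
  shows "1 \<le> cmod (1 + complex_of_real h * l)" "(1 + h * cmod l) / 2 \<le> cmod (1 + complex_of_real h * l)"
proof -
  show "1 \<le> cmod (1 + complex_of_real h * l)"
    using complex_Re_le_cmod[of "1 + complex_of_real h * l"] mult_nonneg_nonneg[OF assms] by simp
  have "sqrt ((1 - 0) / 2) * (1 + cmod (- (h * l))) \<le> cmod (1 - (- (h * l)))"
    by (rule one_minus_bound) (use mult_nonneg_nonneg[OF assms] in auto)
  moreover have "1 / 2 * (1 + h * cmod l) \<le> sqrt (1/2) * (1 + h * cmod l)"
    using assms by (intro mult_right_mono real_le_rsqrt) (auto simp: power2_eq_square)
  ultimately show "(1 + h * cmod l) / 2 \<le> cmod (1 + complex_of_real h * l)"
    using assms by (simp add: norm_mult)
qed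

lemma norm_symbol_le_1:
  "\<forall>h\<in>set hs. 0 \<le> h \<Longrightarrow> 0 \<le> Re l \<Longrightarrow> cmod (symbol hs l) \<le> 1"
proof (induction hs)
  case (Cons h hs)
  have "cmod (1 / (1 + complex_of_real h * l)) \<le> 1"
    using norm_one_plus_ge(1)[of h l] Cons.prems by (simp add: norm_divide divide_le_eq)
  then show ?case using Cons by (simp only: symbol_simps norm_mult) (intro mult_le_one; simp)
qed simp

lemma symbol_derivative:
  assumes "\<forall>h\<in>set hs. 0 \<le> h"
  shows "\<exists>F'. (\<forall>l. 0 \<le> Re l \<longrightarrow> (symbol hs has_field_derivative F' l) (at l)) \<and>
           continuous_on {l. 0 \<le> Re l} F'"
  using assms
proof (induction hs)
  case Nil
  have "symbol [] = (\<lambda>_. 1)" by (auto simp: fun_eq_iff)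
  then show ?case by (auto intro!: exI[of _ "\<lambda>_. 0"])
next
  case (Cons h hs)
  then obtain F' where F': "\<And>l. 0 \<le> Re l \<Longrightarrow> (symbol hs has_field_derivative F' l) (at l)"
    "continuous_on {l. 0 \<le> Re l} F'" by auto
  have cF: "continuous_on {l. 0 \<le> Re l} (symbol hs)"
    using F'(1) by (metis (mono_tags) DERIV_isCont continuous_at_imp_continuous_on mem_Collect_eq)
  have nz: "0 \<le> Re l \<Longrightarrow> 1 + complex_of_real h * l \<noteq> 0" for l
    using one_plus_nonzero[of h] Cons.prems by auto
  have e: "symbol (h # hs) = (\<lambda>l. 1 / (1 + complex_of_real h * l) * symbol hs l)" by (auto simp: fun_eq_iff)
  let ?F = "\<lambda>l. - complex_of_real h / (1 + complex_of_real h * l)\<^sup>2 * symbol hs l + F' l * (1 / (1 + complex_of_real h * l))"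
  show ?case unfolding e
  proof (intro exI[of _ ?F] conjI allI impI)
    fix l :: complex assume l: "0 \<le> Re l"
    have "((\<lambda>l. 1 / (1 + complex_of_real h * l)) has_field_derivative - complex_of_real h / (1 + complex_of_real h * l)\<^sup>2) (at l)"
      using nz[OF l] by (auto intro!: derivative_eq_intros simp: power2_eq_square)
    from DERIV_mult[OF this F'(1)[OF l]]
    show "((\<lambda>l. 1 / (1 + complex_of_real h * l) * symbol hs l) has_field_derivative ?F l) (at l)" .
  next
    show "continuous_on {l. 0 \<le> Re l} ?F"
      by (intro continuous_intros cF F'(2)) (auto simp: nz)
  qed
qed

section \<open>The resolvent on the complement of the sector\<close>

context sectorial_resolvent begin

lemma Re_le_of_notin_sector:
  assumes "l \<notin> sector \<phi>"
  shows "Re l \<le> cmod l * cos \<phi>"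
proof (cases "l = 0")
  case False
  then have "\<phi> \<le> \<bar>Arg l\<bar>" using assms by (auto simp: sector_def)
  moreover have "\<bar>Arg l\<bar> \<le> pi" using Arg_bounded[of l] by auto
  ultimately have "cos \<bar>Arg l\<bar> \<le> cos \<phi>" using phi by (intro cos_monotone_0_pi_le) auto
  then have "cos (Arg l) \<le> cos \<phi>" by (simp add: abs_if split: if_splits)
  moreover have "Re l = cmod l * cos (Arg l)" by (metis False Re_rcis rcis_cmod_Arg)
  ultimately show ?thesis by (simp add: mult_left_mono)
qed simp

lemma cos_phi: "0 < cos \<phi>" "cos \<phi> < 1"
  using phi by (auto intro!: cos_gt_zero simp: cos_monotone_0_pi[of 0, simplified])

lemma ray_point_notin_sector:
  assumes "\<phi> \<le> \<bar>\<psi>\<bar>" "\<bar>\<psi>\<bar> \<le> pi"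
  shows "ray_point \<psi> x \<notin> sector \<phi>"
proof
  assume "ray_point \<psi> x \<in> sector \<phi>"
  then have a: "\<bar>Arg (ray_point \<psi> x)\<bar> < \<phi>" by (simp add: sector_def)
  let ?a = "Arg (ray_point \<psi> x)"
  have "Re (ray_point \<psi> x) = exp x * cos ?a"
    by (metis Re_rcis norm_ray_point rcis_cmod_Arg)
  moreover have "Re (ray_point \<psi> x) = exp x * cos \<psi>"
    by (simp add: ray_point_polar)
  ultimately have "cos \<bar>?a\<bar> = cos \<bar>\<psi>\<bar>" by (simp add: abs_if)
  moreover have "cos \<bar>\<psi>\<bar> < cos \<bar>?a\<bar>" using a assms by (intro cos_monotone_0_pi) auto
  ultimately show False by simp
qed

lemma ray_point_upper: "\<phi> \<le> \<psi> \<Longrightarrow> \<psi> \<le> pi \<Longrightarrow> ray_point \<psi> x \<notin> sector \<phi>"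
  by (rule ray_point_notin_sector) (use phi in auto)

lemma ray_point_lower: "- pi \<le> \<psi> \<Longrightarrow> \<psi> \<le> - \<phi> \<Longrightarrow> ray_point \<psi> x \<notin> sector \<phi>"
  by (rule ray_point_notin_sector) (use phi in auto)

lemma Re_ray_point_nonneg: "\<bar>\<psi>\<bar> \<le> pi / 2 \<Longrightarrow> 0 \<le> Re (ray_point \<psi> x)"
  by (auto simp: ray_point_polar abs_le_iff intro!: mult_nonneg_nonneg cos_ge_zero)

lemma R_difference_bound:
  assumes "l \<notin> sector \<phi>" "m \<notin> sector \<phi>"
  shows "norm (R l f - R m f) \<le> C\<^sup>2 * norm f * cmod (l - m)"
proof -
  have "norm (R l f - R m f) = cmod (l - m) * norm (R l (R m f))"
    by (simp add: resolvent_identity[OF assms] norm_scaleC norm_minus_commute)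
  also have "\<dots> \<le> cmod (l - m) * (C * (C * norm f))"
    using norm_R_le[OF assms(1), of "R m f"] norm_R_le[OF assms(2), of f] C_nonneg
    by (intro mult_left_mono) (auto intro: order_trans mult_left_mono)
  finally show ?thesis by (simp add: power2_eq_square mult_ac)
qed

lemma continuous_on_R: "continuous_on (- sector \<phi>) (\<lambda>l. R l f)"
  by (rule continuous_on_dominated[OF continuous_on_id, of _ _ "C\<^sup>2 * norm f"]) (use R_difference_bound in auto)

lemma continuous_on_R2: "continuous_on (- sector \<phi>) (\<lambda>l. R l (R l f))"
proof (rule continuous_on_dominated[OF continuous_on_id, of _ _ "2 * C^3 * norm f"])
  fix m l assume ml: "m \<in> - sector \<phi>" "l \<in> - sector \<phi>"
  then have eq: "R m (R m f) - R l (R l f) = R m (R m f - R l f) + (R m (R l f) - R l (R l f))"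
    using bounded_linear_R[of m] by (simp add: linear_diff[OF bounded_linear.linear])
  have 1: "norm (R m (R m f - R l f)) \<le> C * (C\<^sup>2 * norm f * cmod (m - l))"
    using norm_R_le[of m "R m f - R l f"] R_difference_bound[of m l f] ml C_nonneg
    by (meson ComplD mult_left_mono order_trans)
  have "norm (R m (R l f) - R l (R l f)) \<le> C\<^sup>2 * norm (R l f) * cmod (m - l)"
    using R_difference_bound[of m l "R l f"] ml by auto
  also have "\<dots> \<le> C\<^sup>2 * (C * norm f) * cmod (m - l)"
    using norm_R_le[of l f] ml by (intro mult_right_mono mult_left_mono) auto
  finally have 2: "norm (R m (R l f) - R l (R l f)) \<le> C\<^sup>2 * (C * norm f) * cmod (m - l)" .
  have "norm (R m (R m f) - R l (R l f)) \<le> C * (C\<^sup>2 * norm f * cmod (m - l)) + C\<^sup>2 * (C * norm f) * cmod (m - l)"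
    unfolding eq using 1 2 by (intro order_trans[OF norm_triangle_ineq] add_mono)
  then show "norm (R m (R m f) - R l (R l f)) \<le> 2 * C^3 * norm f * norm (m - l)"
    by (simp add: power2_eq_square power3_eq_cube)
qed

lemma R_has_derivative:
  assumes l: "l \<in> - sector \<phi>"
  shows "((\<lambda>l. R l f) has_derivative (\<lambda>z. z *\<^sub>C (- R l (R l f)))) (at l within - sector \<phi>)"
  unfolding has_derivative_within
proof
  show "bounded_linear (\<lambda>z. z *\<^sub>C (- R l (R l f)))" by (rule scaleC.bounded_linear_left)
  show "((\<lambda>y. (1 / norm (y - l)) *\<^sub>R (R y f - (R l f + (y - l) *\<^sub>C (- R l (R l f))))) \<longlongrightarrow> 0)
     (at l within - sector \<phi>)"
  proof (rule Lim_null_comparison)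
    have "norm ((1 / norm (y - l)) *\<^sub>R (R y f - (R l f + (y - l) *\<^sub>C (- R l (R l f))))) \<le>
        C\<^sup>2 * norm (R l f) * cmod (y - l)" if y: "y \<in> - sector \<phi>" for y
    proof (cases "y = l")
      case False
      have "R y f - (R l f + (y - l) *\<^sub>C (- R l (R l f))) = (l - y) *\<^sub>C (R y (R l f) - R l (R l f))"
        using resolvent_identity[of y l f] l y
        by (simp add: scaleC.diff_right scaleC.diff_left scaleC.minus_right algebra_simps)
      then have "norm ((1 / norm (y - l)) *\<^sub>R (R y f - (R l f + (y - l) *\<^sub>C (- R l (R l f)))))
        = norm (R y (R l f) - R l (R l f))"
        using False by (simp add: norm_scaleC norm_minus_commute)
      then show ?thesis using R_difference_bound[of y l "R l f"] l y by simp
    qed simp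
    then show "\<forall>\<^sub>F y in at l within - sector \<phi>. norm ((1 / norm (y - l)) *\<^sub>R (R y f - (R l f + (y - l) *\<^sub>C (- R l (R l f))))) \<le>
        C\<^sup>2 * norm (R l f) * cmod (y - l)"
      by (auto simp: eventually_at intro!: exI[of _ 1])
    have "((\<lambda>y. C\<^sup>2 * norm (R l f) * cmod (y - l)) \<longlongrightarrow> C\<^sup>2 * norm (R l f) * cmod (l - l)) (at l within - sector \<phi>)"
      by (intro tendsto_intros)
    then show "((\<lambda>y. C\<^sup>2 * norm (R l f) * cmod (y - l)) \<longlongrightarrow> 0) (at l within - sector \<phi>)" by simp
  qed
qed

end

section \<open>Products of Euler steps as contour integrals\<close>

lemma inverse_one_plus_mult_le:
  assumes "0 < (h::real)" "0 \<le> r"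
  shows "1 / (1 + h * r) \<le> (1 + 1 / h) / (1 + r)"
proof -
  have "1 + r \<le> (1 + 1 / h) * (1 + h * r)"
    using assms by (simp add: algebra_simps)
  then show ?thesis using assms by (simp add: divide_le_eq le_divide_eq add_pos_nonneg mult.commute)
qed

lemma norm_inverse_one_plus:
  assumes c: "0 < c" and l: "0 \<le> Re l"
  shows "cmod (1 / (1 + complex_of_real c * l)) \<le> 2 * ((1 + 1/c) / (1 + cmod l))"
proof -
  have p: "0 < 1 + c * cmod l" using c by (simp add: add_pos_nonneg)
  have g: "(1 + c * cmod l) / 2 \<le> cmod (1 + complex_of_real c * l)"
    using norm_one_plus_ge(2)[of c l] c l by simp
  have "cmod (1 / (1 + complex_of_real c * l)) \<le> 1 / ((1 + c * cmod l) / 2)"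
    unfolding norm_divide norm_one using g p by (intro frac_le) auto
  also have "\<dots> = 2 * (1 / (1 + c * cmod l))" by simp
  also have "\<dots> \<le> 2 * ((1 + 1/c) / (1 + cmod l))"
    using inverse_one_plus_mult_le[OF c, of "cmod l"] by (intro mult_left_mono) auto
  finally show ?thesis .
qed

context sectorial_resolvent begin

text \<open>
  The integral over the boundary of the sector, traversed outwards on the upper ray and inwards on
  the lower one.
\<close>

definition wedge_integral :: "real \<Rightarrow> (complex \<Rightarrow> 'a) \<Rightarrow> 'a::complex_banach"
  where "wedge_integral X G = ray_integral X \<phi> G - ray_integral X (- \<phi>) G"

text \<open>
  Two factors suffice for quadratic decay, and all poles of a symbol are negative, so one ray can be
  rotated into the other through the right half plane.
\<close>

lemma wedge_integral_symbol:
  assumes "0 < a" "0 < b" "all_pos hs"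
  shows "((\<lambda>X. wedge_integral X (symbol (a # b # hs))) \<longlongrightarrow> 0) at_top"
proof -
  let ?F = "symbol (a # b # hs)" and ?\<Omega> = "{l. 0 \<le> Re l}"
  have pos: "\<forall>h\<in>set (a # b # hs). 0 \<le> h" using assms by (auto intro: less_imp_le)
  obtain F' where F': "\<And>l. 0 \<le> Re l \<Longrightarrow> (?F has_field_derivative F' l) (at l)" "continuous_on ?\<Omega> F'"
    using symbol_derivative[OF pos] by blast
  show ?thesis unfolding wedge_integral_def
  proof (rule tendsto_ray_integral_rotate[where \<Omega> = ?\<Omega> and G' = F'])
    fix l :: complex assume l: "l \<in> ?\<Omega>"
    have "(?F has_derivative (*) (F' l)) (at l within ?\<Omega>)"
      using F'(1)[of l] l by (auto simp: has_field_derivative_def intro: has_derivative_at_withinI)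
    then show "(?F has_derivative (\<lambda>z. z *\<^sub>C F' l)) (at l within ?\<Omega>)"
      by (rule has_derivative_eq_rhs) (simp add: scaleC_complex_def fun_eq_iff mult.commute)
    have "cmod (?F l) \<le> 2 * ((1 + 1/a) / (1 + cmod l)) * (2 * ((1 + 1/b) / (1 + cmod l)) * 1)"
      unfolding symbol_simps norm_mult using assms l
      by (intro mult_mono norm_inverse_one_plus norm_symbol_le_1 mult_nonneg_nonneg) (auto simp: less_imp_le)
    also have "\<dots> = 4 * (1 + 1/a) * (1 + 1/b) / (1 + cmod l)\<^sup>2"
    proof -
      have "2 * (p / r) * (2 * (q / r) * 1) = 4 * p * q / r\<^sup>2" for p q r :: real
        by (simp add: power2_eq_square)
      then show ?thesis .
    qed
    finally show "cmod (?F l) \<le> 4 * (1 + 1/a) * (1 + 1/b) / (1 + cmod l)\<^sup>2" .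
  qed (use phi F'(2) in \<open>auto intro!: Re_ray_point_nonneg\<close>)
qed

lemma norm_one_minus_ge:
  assumes "0 < h" "l \<notin> sector \<phi>"
  shows "sqrt ((1 - cos \<phi>) / 2) * (1 + h * cmod l) \<le> cmod (1 - complex_of_real h * l)"
proof -
  have "Re (h * l) \<le> cmod (h * l) * cos \<phi>"
    using mult_left_mono[OF Re_le_of_notin_sector[OF assms(2)], of h] assms by (simp add: norm_mult)
  from one_minus_bound[OF this] show ?thesis using cos_phi assms by (simp add: norm_mult)
qed

lemma norm_inverse_one_minus:
  assumes "0 < h" "l \<notin> sector \<phi>"
  shows "1 - complex_of_real h * l \<noteq> 0"
    and "cmod (1 / (1 - complex_of_real h * l)) \<le> (1 + 1/h) / sqrt ((1 - cos \<phi>) / 2) / (1 + cmod l)"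
proof -
  let ?m = "sqrt ((1 - cos \<phi>) / 2)"
  have m: "0 < ?m" using cos_phi by simp
  have p: "0 < ?m * (1 + h * cmod l)" using m assms by (simp add: add_pos_nonneg)
  then show "1 - complex_of_real h * l \<noteq> 0" using norm_one_minus_ge[OF assms] by force
  have "cmod (1 / (1 - complex_of_real h * l)) \<le> 1 / (?m * (1 + h * cmod l))"
    unfolding norm_divide norm_one by (rule frac_le[OF _ _ p norm_one_minus_ge[OF assms]]) auto
  also have "\<dots> = 1 / ?m * (1 / (1 + h * cmod l))" by simp
  also have "\<dots> \<le> 1 / ?m * ((1 + 1/h) / (1 + cmod l))"
    using m assms by (intro mult_left_mono inverse_one_plus_mult_le) auto
  finally show "cmod (1 / (1 - complex_of_real h * l)) \<le> (1 + 1/h) / ?m / (1 + cmod l)"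
    by (simp add: mult_ac)
qed

text \<open>
  This scalar integral is the only place where the number \<open>2 * pi * \<i>\<close> arises.  The two rays are
  rotated to the imaginary axis, where the integrand becomes the derivative of an arctangent.
\<close>

lemma wedge_integral_pole:
  assumes z: "0 < h"
  shows "((\<lambda>X. wedge_integral X (\<lambda>l. 2 / ((1 - complex_of_real h * l) * (1 + complex_of_real h * l))))
           \<longlongrightarrow> 2 * pi * \<i> / h) at_top"
proof -
  let ?G = "\<lambda>l. 2 / ((1 - complex_of_real h * l) * (1 + complex_of_real h * l))"
  let ?\<Omega> = "{l. 0 \<le> Re l} - sector \<phi>"
  let ?G' = "\<lambda>l. 4 * (complex_of_real h)\<^sup>2 * l / ((1 - complex_of_real h * l) * (1 + complex_of_real h * l))\<^sup>2"
  let ?m = "sqrt ((1 - cos \<phi>) / 2)"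
  have nz: "(1 - complex_of_real h * l) * (1 + complex_of_real h * l) \<noteq> 0" if "l \<in> ?\<Omega>" for l
    using norm_inverse_one_minus(1)[OF z, of l] one_plus_nonzero[of h l] z that by auto
  have D: "(?G has_derivative (\<lambda>d. d *\<^sub>C ?G' l)) (at l within ?\<Omega>)" if "l \<in> ?\<Omega>" for l
  proof -
    have "(?G has_field_derivative ?G' l) (at l within ?\<Omega>)"
      using nz[OF that] by (auto intro!: derivative_eq_intros simp: power2_eq_square algebra_simps)
    then show ?thesis unfolding has_field_derivative_def
      by (rule has_derivative_eq_rhs) (simp add: scaleC_complex_def fun_eq_iff mult.commute)
  qed
  have cont: "continuous_on ?\<Omega> ?G'" using nz by (intro continuous_intros) auto
  have bd: "norm (?G l) \<le> 4 * (1 + 1/h)\<^sup>2 / ?m / (1 + cmod l)\<^sup>2" if l: "l \<in> ?\<Omega>" for l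
  proof -
    have "norm (?G l) = 2 * (cmod (1 / (1 - complex_of_real h * l)) * cmod (1 / (1 + complex_of_real h * l)))"
      by (simp add: norm_divide norm_mult)
    also have "\<dots> \<le> 2 * ((1 + 1/h) / ?m / (1 + cmod l) * (2 * ((1 + 1/h) / (1 + cmod l))))"
      using norm_inverse_one_minus(2)[OF z, of l] norm_inverse_one_plus[OF z, of l] l z cos_phi
      by (intro mult_left_mono mult_mono) (auto intro!: divide_nonneg_nonneg)
    also have "\<dots> = 4 * (1 + 1/h)\<^sup>2 / ?m / (1 + cmod l)\<^sup>2"
    proof -
      have "2 * (p / m / r * (2 * (p / r))) = 4 * p\<^sup>2 / m / r\<^sup>2" for p m r :: real
        by (simp add: power2_eq_square)
      then show ?thesis .
    qed
    finally show ?thesis .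
  qed
  have up: "((\<lambda>X. ray_integral X (pi/2) ?G - ray_integral X \<phi> ?G) \<longlongrightarrow> 0) at_top"
    by (rule tendsto_ray_integral_rotate[OF D cont _ bd])
       (use phi in \<open>auto intro!: Re_ray_point_nonneg simp: ray_point_upper ray_point_lower\<close>)
  have down: "((\<lambda>X. ray_integral X (-\<phi>) ?G - ray_integral X (-(pi/2)) ?G) \<longlongrightarrow> 0) at_top"
    by (rule tendsto_ray_integral_rotate[OF D cont _ bd])
       (use phi in \<open>auto intro!: Re_ray_point_nonneg simp: ray_point_upper ray_point_lower\<close>)
  have FTC: "ray_integral X (s * (pi/2)) ?G = s * (2 * \<i> / h) * complex_of_real (arctan (h * exp X) - arctan (h * exp (-X)))"
    if "0 \<le> X" and s: "s = 1 \<or> s = -1" for X s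
  proof -
    have "((\<lambda>x. complex_of_real (arctan (h * exp x))) has_vector_derivative
        complex_of_real (h * exp x / (1 + (h * exp x)\<^sup>2))) (at x within {-X..X})" for x
      by (rule has_vector_derivative_of_real)
         (auto intro!: derivative_eq_intros simp: field_simps power2_eq_square)
    from fundamental_theorem_of_calculus[OF _ this] that
    have "((\<lambda>x. complex_of_real (h * exp x / (1 + (h * exp x)\<^sup>2))) has_integral
        complex_of_real (arctan (h * exp X) - arctan (h * exp (-X)))) {-X..X}"
      by simp
    from has_integral_mult_right[OF this, of "s * (2 * \<i> / h)"]
    have "((\<lambda>x. s * (2 * \<i> / h) * complex_of_real (h * exp x / (1 + (h * exp x)\<^sup>2))) has_integral
        s * (2 * \<i> / h) * complex_of_real (arctan (h * exp X) - arctan (h * exp (-X)))) {-X..X}" .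
    moreover have "s * (2 * \<i> / h) * complex_of_real (h * exp x / (1 + (h * exp x)\<^sup>2)) =
        ray_point (s * (pi/2)) x *\<^sub>C ?G (ray_point (s * (pi/2)) x)" for x
    proof -
      have r: "ray_point (s * (pi/2)) x = s * \<i> * complex_of_real (exp x)"
        using s by (auto simp: ray_point_polar scaleR_conv_of_real complex_eq_iff)
      have "complex_of_real s * complex_of_real s = 1" using s by auto
      then have q: "(1 - complex_of_real h * (s * \<i> * complex_of_real (exp x))) * (1 + complex_of_real h * (s * \<i> * complex_of_real (exp x)))
          = complex_of_real (1 + (h * exp x)\<^sup>2)"
        by (simp add: algebra_simps power2_eq_square)
      show ?thesis unfolding r q scaleC_complex_def using z by (simp add: field_simps)
    qed
    ultimately show ?thesis unfolding ray_integral_def by (simp add: integral_unique)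
  qed
  have lim: "((\<lambda>X. (4 * \<i> / h) * complex_of_real (arctan (h * exp X) - arctan (h * exp (-X)))) \<longlongrightarrow>
      (4 * \<i> / h) * complex_of_real (pi / 2 - arctan (h * 0))) at_top"
  proof (intro tendsto_intros)
    show "((\<lambda>X. arctan (h * exp X)) \<longlongrightarrow> pi / 2) at_top"
      by (rule filterlim_compose[OF tendsto_arctan_at_top])
         (rule filterlim_tendsto_pos_mult_at_top[OF tendsto_const z exp_at_top])
    show "((\<lambda>X::real. exp (- X)) \<longlongrightarrow> 0) at_top"
      by (rule filterlim_compose[OF exp_at_bot filterlim_uminus_at_bot_at_top])
  qed
  have "\<forall>\<^sub>F X in at_top. (4 * \<i> / h) * complex_of_real (arctan (h * exp X) - arctan (h * exp (-X)))
      = ray_integral X (pi/2) ?G - ray_integral X (-(pi/2)) ?G"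
    using eventually_ge_at_top[of 0]
  proof eventually_elim
    case (elim X)
    show ?case using FTC[OF elim, of 1] FTC[OF elim, of "-1"] by simp
  qed
  from Lim_transform_eventually[OF lim this]
  have "((\<lambda>X. ray_integral X (pi/2) ?G - ray_integral X (-(pi/2)) ?G) \<longlongrightarrow> 2 * pi * \<i> / h) at_top"
    by (simp add: mult_ac)
  from tendsto_diff[OF tendsto_diff[OF this up] down]
  show ?thesis by (simp add: wedge_integral_def)
qed

text \<open>
  The pole \<open>1/h\<close> lies inside the sector, so both rays can be rotated through the complement of the
  sector to the negative axis, where their contributions cancel.
\<close>

lemma wedge_integral_remainder:
  fixes k :: 'x
  assumes z: "0 < h"
  shows "((\<lambda>X. wedge_integral X (\<lambda>l. (1 / (1 - complex_of_real h * l)) *\<^sub>C R l k)) \<longlongrightarrow> 0) at_top"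
proof -
  let ?\<Omega> = "- sector \<phi>"
  let ?G = "\<lambda>l. (1 / (1 - complex_of_real h * l)) *\<^sub>C R l k"
  let ?G' = "\<lambda>l. (h / (1 - complex_of_real h * l)\<^sup>2) *\<^sub>C R l k + (1 / (1 - complex_of_real h * l)) *\<^sub>C (- R l (R l k))"
  let ?K = "(1 + 1/h) / sqrt ((1 - cos \<phi>) / 2)"
  have nz: "l \<in> ?\<Omega> \<Longrightarrow> 1 - complex_of_real h * l \<noteq> 0" for l
    using norm_inverse_one_minus(1)[OF z] by auto
  have [simp]: "l \<notin> sector \<phi> \<Longrightarrow> complex_of_real h * l \<noteq> 1" for l
    using nz[of l] by auto
  have D: "(?G has_derivative (\<lambda>d. d *\<^sub>C ?G' l)) (at l within ?\<Omega>)" if l: "l \<in> ?\<Omega>" for l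
  proof -
    have "((\<lambda>l. 1 / (1 - complex_of_real h * l)) has_field_derivative (h / (1 - complex_of_real h * l)\<^sup>2)) (at l within ?\<Omega>)"
      using nz[OF l] by (auto intro!: derivative_eq_intros simp: power2_eq_square)
    from scaleC.FDERIV[OF this[unfolded has_field_derivative_def] R_has_derivative[OF l]]
    show ?thesis
      by (rule has_derivative_eq_rhs)
         (simp add: fun_eq_iff scaleC_add_right scaleC_scaleC mult.commute scaleC.minus_right scaleC.diff_right)
  qed
  have cont: "continuous_on ?\<Omega> ?G'"
    by (intro continuous_intros scaleC.continuous_on continuous_on_R continuous_on_R2) (use nz in auto)
  have bd: "norm (?G l) \<le> ?K * (C * norm k) / (1 + cmod l)\<^sup>2" if l: "l \<in> ?\<Omega>" for l
  proof -
    have "norm (?G l) \<le> (?K / (1 + cmod l)) * (C / (1 + cmod l) * norm k)"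
      unfolding norm_scaleC using norm_inverse_one_minus(2)[OF z, of l] norm_R[of l k] l z cos_phi
      by (intro mult_mono) (auto intro!: divide_nonneg_nonneg)
    then show ?thesis by (simp add: power2_eq_square mult.assoc)
  qed
  have up: "((\<lambda>X. ray_integral X pi ?G - ray_integral X \<phi> ?G) \<longlongrightarrow> 0) at_top"
    by (rule tendsto_ray_integral_rotate[OF D cont _ bd]) (use phi in \<open>auto simp: ray_point_upper ray_point_lower\<close>)
  have down: "((\<lambda>X. ray_integral X (-\<phi>) ?G - ray_integral X (-pi) ?G) \<longlongrightarrow> 0) at_top"
    by (rule tendsto_ray_integral_rotate[OF D cont _ bd]) (use phi in \<open>auto simp: ray_point_upper ray_point_lower\<close>)
  have "cis (- pi) = cis pi" by (simp add: complex_eq_iff)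
  then have "ray_integral X (-pi) ?G = ray_integral X pi ?G" for X
    by (simp only: ray_integral_def ray_point_polar)
  then show ?thesis using tendsto_minus[OF tendsto_add[OF up down]] by (simp add: wedge_integral_def)
qed

text \<open>
  Cauchy's formula for a single Euler step.  Expressing \<open>f\<close> by its resolvent \<open>g\<close> at \<open>-1/h\<close> turns the
  integrand into \<open>g / (1 + h l)\<close> plus a term without the pole at \<open>-1/h\<close>.  The scalar factor is written as
  \<open>2 / ((1 - h l) * (1 + h l)) - 1 / (1 - h l)\<close>: the first part decays quadratically and carries the
  residue, and the second one cancels the slow decay of the resolvent term.
\<close>

lemma wedge_integral_R:
  assumes z: "0 < h"
  shows "((\<lambda>X. wedge_integral X (\<lambda>l. symbol [h] l *\<^sub>C R l f)) \<longlongrightarrow> (- (2 * pi * \<i>)) *\<^sub>C J h f) at_top"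
proof -
  let ?w = "complex_of_real (- (1/h))"
  have w: "?w \<notin> sector \<phi>" by (rule neg_real_notin_sector) (use z in simp)
  define g where "g = R ?w f"
  \<comment> \<open>The remainder is the resolvent of this vector, divided by \<open>1 - h l\<close>: applying \<open>1 - h l\<close> to
    the slowly decaying terms leaves a fixed vector under the resolvent.\<close>
  define k where "k = - ((1/h) *\<^sub>R g + A g)"
  have g: "g \<in> D" unfolding g_def by (rule R_in_D[OF w])
  have Jg: "(- (2 * pi * \<i>)) *\<^sub>C J h f = (2 * pi * \<i> / h) *\<^sub>C g"
    using z by (simp add: J_def g_def scaleR_scaleC scaleC_scaleC)
  let ?P = "\<lambda>l. 2 / ((1 - complex_of_real h * l) * (1 + complex_of_real h * l))"
  let ?H = "\<lambda>l. (1 / (1 - complex_of_real h * l)) *\<^sub>C R l k"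
  have split: "symbol [h] l *\<^sub>C R l f = ?P l *\<^sub>C g + ?H l"
    if l: "l \<notin> sector \<phi>" "0 \<le> Re l" for l
  proof -
    interpret r: bounded_linear "R l" by (rule bounded_linear_R[OF l(1)])
    have n1: "1 + complex_of_real h * l \<noteq> 0" using one_plus_nonzero[of h l] z l by simp
    have n2: "1 - complex_of_real h * l \<noteq> 0" using norm_inverse_one_minus(1)[OF z l(1)] .
    have f: "f = A g - (1/h) *\<^sub>R g"
      using shift_R[OF w, of f] unfolding g_def[symmetric] by (simp add: scaleR_scaleC scaleC.minus_left)
    have Rg: "R l (A g) = g - l *\<^sub>C R l g"
      using R_shift[OF l(1) g] by (simp add: r.add R_scaleC[OF l(1)] algebra_simps)
    let ?a = "complex_of_real (1/h)"
    have Rf: "R l f = g - (l + ?a) *\<^sub>C R l g"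
      unfolding f by (simp add: r.diff R_scaleC[OF l(1)] Rg scaleR_scaleC scaleC_add_left)
    have Rk: "R l k = (l - ?a) *\<^sub>C R l g - g"
      unfolding k_def r.neg r.add Rg by (simp add: R_scaleC[OF l(1)] Rg scaleR_scaleC scaleC.diff_left)
    have c: "1 / (1 + complex_of_real h * l) * (l + ?a) = ?a"
      "1 / (1 - complex_of_real h * l) * (l - ?a) = - ?a"
      using n1 n2 z by (simp_all add: field_simps)
    have c2: "1 / (1 + complex_of_real h * l) = ?P l - 1 / (1 - complex_of_real h * l)"
    proof -
      have "1 / p = (p + q) / (q * p) - 1 / q" if "p \<noteq> 0" "q \<noteq> 0" for p q :: complex
        using that by (simp add: add_divide_distrib)
      from this[OF n1 n2] show ?thesis by simp
    qed
    show ?thesis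
      unfolding Rf Rk symbol_simps mult_1_right scaleC.diff_right scaleC_scaleC c
      unfolding c2 scaleC.diff_left scaleC.minus_left by simp
  qed
  have pts: "ray_point \<phi> x \<notin> sector \<phi>" "ray_point (-\<phi>) x \<notin> sector \<phi>"
    "0 \<le> Re (ray_point \<phi> x)" "0 \<le> Re (ray_point (-\<phi>) x)" for x
    using phi by (auto simp: ray_point_upper ray_point_lower intro!: Re_ray_point_nonneg)
  have side: "ray_integral X \<psi> (\<lambda>l. symbol [h] l *\<^sub>C R l f) = ray_integral X \<psi> ?P *\<^sub>C g + ray_integral X \<psi> ?H"
    if pt: "\<And>x. ray_point \<psi> x \<notin> sector \<phi>" "\<And>x. 0 \<le> Re (ray_point \<psi> x)" for X \<psi>
  proof -
    have P: "continuous_on UNIV (\<lambda>x. ?P (ray_point \<psi> x))"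
      using norm_inverse_one_minus(1)[OF z pt(1)] one_plus_nonzero[of h, OF _ pt(2)] z
      by (intro continuous_intros) auto
    have H: "continuous_on UNIV (\<lambda>x. ?H (ray_point \<psi> x))"
      using norm_inverse_one_minus(1)[OF z pt(1)] pt
      by (intro continuous_intros scaleC.continuous_on continuous_on_compose2[OF continuous_on_R]) auto
    have "ray_integral X \<psi> (\<lambda>l. symbol [h] l *\<^sub>C R l f) = ray_integral X \<psi> (\<lambda>l. ?P l *\<^sub>C g + ?H l)"
      unfolding ray_integral_def using split pt by simp
    also have "\<dots> = ray_integral X \<psi> ?P *\<^sub>C g + ray_integral X \<psi> ?H"
      using P H by (simp add: ray_integral_add ray_integral_scaleC scaleC.continuous_on continuous_on_const)
    finally show ?thesis .
  qed
  have "wedge_integral X (\<lambda>l. symbol [h] l *\<^sub>C R l f) = wedge_integral X ?P *\<^sub>C g + wedge_integral X ?H" for X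
    unfolding wedge_integral_def using side[of \<phi> X] side[of "-\<phi>" X] pts
    by (simp add: scaleC.diff_left)
  moreover have "((\<lambda>X. wedge_integral X ?P *\<^sub>C g + wedge_integral X ?H) \<longlongrightarrow> (2 * pi * \<i> / h) *\<^sub>C g + 0) at_top"
    by (intro tendsto_add scaleC.tendsto tendsto_const wedge_integral_pole wedge_integral_remainder z)
  ultimately show ?thesis unfolding Jg by simp
qed

lemma continuous_on_symbol_R:
  assumes "all_pos hs" "\<bar>\<psi>\<bar> = \<phi>"
  shows "continuous_on S (\<lambda>x. symbol hs (ray_point \<psi> x))"
    and "continuous_on S (\<lambda>x. R (ray_point \<psi> x) f)"
proof -
  obtain F' where F': "\<And>l. 0 \<le> Re l \<Longrightarrow> (symbol hs has_field_derivative F' l) (at l)"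
    using symbol_derivative[of hs] assms less_imp_le by metis
  have "continuous_on {l. 0 \<le> Re l} (symbol hs)"
    using F' by (metis (mono_tags) DERIV_isCont continuous_at_imp_continuous_on mem_Collect_eq)
  then show "continuous_on S (\<lambda>x. symbol hs (ray_point \<psi> x))"
    by (rule continuous_on_compose2) (use phi assms in \<open>auto intro!: continuous_intros Re_ray_point_nonneg\<close>)
  have "ray_point \<psi> x \<notin> sector \<phi>" for x by (rule ray_point_notin_sector) (use phi assms in auto)
  then show "continuous_on S (\<lambda>x. R (ray_point \<psi> x) f)"
    by (intro continuous_on_compose2[OF continuous_on_R]) (auto intro!: continuous_intros)
qed

text \<open>
  Induction on the number of factors by \<open>R_J\<close>; the additional term is the integral of a symbol with
  at least two factors, which vanishes.
\<close>

lemma wedge_integral_Jprod: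
  assumes "hs \<noteq> []" "all_pos hs"
  shows "((\<lambda>X. wedge_integral X (\<lambda>l. symbol hs l *\<^sub>C R l f)) \<longlongrightarrow> (- (2 * pi * \<i>)) *\<^sub>C Jprod hs f) at_top"
  using assms
proof (induction hs arbitrary: f rule: list_nonempty_induct)
  case (single h)
  then show ?case using wedge_integral_R by simp
next
  case (cons h hs)
  then have z: "0 < h" by simp
  obtain b bs where bs: "hs = b # bs" using cons by (cases hs) auto
  let ?F = "symbol (h # hs)" and ?y = "complex_of_real h *\<^sub>C J h f"
  have side: "ray_integral X \<psi> (\<lambda>l. symbol hs l *\<^sub>C R l (J h f)) =
      ray_integral X \<psi> (\<lambda>l. ?F l *\<^sub>C R l f) + ray_integral X \<psi> ?F *\<^sub>C ?y"
    if psi: "\<bar>\<psi>\<bar> = \<phi>" for X \<psi>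
  proof -
    have "symbol hs l *\<^sub>C R l (J h f) = ?F l *\<^sub>C R l f + ?F l *\<^sub>C ?y" if "l = ray_point \<psi> x" for l x
    proof -
      have "1 + complex_of_real h * l \<noteq> 0"
        unfolding that by (rule one_plus_nonzero) (use z psi phi in \<open>auto intro!: Re_ray_point_nonneg\<close>)
      moreover have "l \<notin> sector \<phi>" unfolding that by (rule ray_point_notin_sector) (use psi phi in auto)
      ultimately show ?thesis
        by (simp add: R_J z scaleC_scaleC scaleC_add_right mult.commute)
    qed
    then have "ray_integral X \<psi> (\<lambda>l. symbol hs l *\<^sub>C R l (J h f)) = ray_integral X \<psi> (\<lambda>l. ?F l *\<^sub>C R l f + ?F l *\<^sub>C ?y)"
      unfolding ray_integral_def by simp
    also have "\<dots> = ray_integral X \<psi> (\<lambda>l. ?F l *\<^sub>C R l f) + ray_integral X \<psi> ?F *\<^sub>C ?y"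
      using continuous_on_symbol_R[OF cons.prems psi]
      by (simp only: ray_integral_add ray_integral_scaleC scaleC.continuous_on continuous_on_const)
    finally show ?thesis .
  qed
  have eq: "wedge_integral X (\<lambda>l. ?F l *\<^sub>C R l f) =
      wedge_integral X (\<lambda>l. symbol hs l *\<^sub>C R l (J h f)) - wedge_integral X ?F *\<^sub>C ?y" for X
    unfolding wedge_integral_def using side[of \<phi> X] side[of "-\<phi>" X] phi
    by (simp add: scaleC.diff_left)
  have "((\<lambda>X. wedge_integral X (\<lambda>l. symbol hs l *\<^sub>C R l (J h f)) - wedge_integral X ?F *\<^sub>C ?y) \<longlongrightarrow>
      (- (2 * pi * \<i>)) *\<^sub>C Jprod hs (J h f) - 0 *\<^sub>C ?y) at_top"
    using cons.prems unfolding bs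
    by (intro tendsto_diff scaleC.tendsto tendsto_const wedge_integral_symbol cons.IH[unfolded bs]) auto
  then show ?case unfolding eq by simp
qed

end

section \<open>Uniform bounds for products of Euler steps\<close>

text \<open>
  The modulus of a symbol on the boundary of the sector is bounded by such a product, with \<open>ss\<close> the
  step sizes times the modulus of the spectral parameter and \<open>k\<close> the cosine of the angle (or half of
  it).
\<close>

definition damping :: "real \<Rightarrow> real list \<Rightarrow> real"
  where "damping k ss = prod_list (map (\<lambda>s. 1 / (1 + k * s)) ss)"

text \<open>
  The logarithmic derivative of \<open>damping\<close> under a dilation of the step sizes, up to sign and the
  factor \<open>k\<close>.
\<close>

definition saturated_sum :: "real \<Rightarrow> real list \<Rightarrow> real"
  where "saturated_sum k ss = sum_list (map (\<lambda>s. s / (1 + k * s)) ss)"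

lemma damping_simps [simp]: "damping k [] = 1" "damping k (s # ss) = damping k ss / (1 + k * s)"
  and saturated_sum_simps [simp]: "saturated_sum k [] = 0"
    "saturated_sum k (s # ss) = s / (1 + k * s) + saturated_sum k ss"
  by (simp_all add: damping_def saturated_sum_def)

lemma damping_bounds:
  assumes "0 < k" "\<forall>s\<in>set ss. 0 \<le> s"
  shows "0 < damping k ss" "damping k ss \<le> 1 / (1 + k * sum_list ss)"
    "damping k ss \<le> exp (- k * saturated_sum k ss)"
    "0 \<le> saturated_sum k ss" "saturated_sum k ss \<le> sum_list ss"
proof -
  have "0 < damping k ss \<and> damping k ss \<le> 1 / (1 + k * sum_list ss) \<and> damping k ss \<le> exp (- k * saturated_sum k ss)
     \<and> 0 \<le> saturated_sum k ss \<and> saturated_sum k ss \<le> sum_list ss"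
    using assms(2)
  proof (induction ss)
    case (Cons s ss)
    then have s: "0 \<le> s" and ss: "0 \<le> sum_list ss" by (auto intro: sum_list_nonneg)
    have ks: "0 \<le> k * s" "0 \<le> k * sum_list ss" using assms s ss by auto
    have 1: "damping k ss / (1 + k * s) \<le> (1 / (1 + k * sum_list ss)) / (1 + k * s)"
      using Cons ks by (intro divide_right_mono) auto
    also have "\<dots> \<le> 1 / (1 + k * (s + sum_list ss))"
      unfolding divide_divide_eq_left using ks mult_nonneg_nonneg[OF ks]
      by (intro frac_le) (auto simp: algebra_simps)
    finally have a: "damping k ss / (1 + k * s) \<le> 1 / (1 + k * (s + sum_list ss))" .
    have "1 - k * (s / (1 + k * s)) = 1 / (1 + k * s)" using ks by (simp add: field_simps)
    then have "1 / (1 + k * s) \<le> exp (- k * (s / (1 + k * s)))"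
      using exp_ge_add_one_self[of "- k * (s / (1 + k * s))"] by simp
    then have "damping k ss * (1 / (1 + k * s)) \<le> exp (- k * saturated_sum k ss) * exp (- k * (s / (1 + k * s)))"
      using Cons ks by (intro mult_mono) auto
    then have b: "damping k ss / (1 + k * s) \<le> exp (- k * (s / (1 + k * s) + saturated_sum k ss))"
      by (simp add: exp_add[symmetric] algebra_simps)
    have "s / (1 + k * s) \<le> s / 1" using s ks by (intro divide_left_mono) auto
    then show ?case using a b Cons s ks by (auto intro!: divide_nonneg_nonneg)
  qed simp
  then show "0 < damping k ss" "damping k ss \<le> 1 / (1 + k * sum_list ss)"
    "damping k ss \<le> exp (- k * saturated_sum k ss)"
    "0 \<le> saturated_sum k ss" "saturated_sum k ss \<le> sum_list ss" by blast+
qed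

lemma damping_scale:
  assumes "0 < k" "0 \<le> k'" "k \<le> k' * c" "0 \<le> c" "\<forall>s\<in>set ss. 0 \<le> s"
  shows "damping k' (map ((*) c) ss) \<le> damping k ss"
  using assms(5)
proof (induction ss)
  case (Cons s ss)
  have s: "0 \<le> s" using Cons.prems by simp
  have "k * s \<le> k' * c * s" using assms s by (intro mult_right_mono) auto
  moreover have "0 \<le> k * s" using assms s by simp
  moreover have "0 \<le> damping k ss" using Cons.prems assms damping_bounds(1)[of k ss] by auto
  ultimately have "damping k' (map ((*) c) ss) / (1 + k' * (c * s)) \<le> damping k ss / (1 + k * s)"
    using Cons by (intro frac_le) (auto simp: mult.assoc)
  then show ?case by simp
qed simp

text \<open>
  The damping \<open>P\<close> is split into two square roots.  One of them absorbs the factor \<open>saturated_sum\<close>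
  through \<open>P \<le> exp (- k * S)\<close>, the other one supplies the decay in the total step size.
\<close>

lemma saturated_damping_le:
  assumes k: "0 < k" "k \<le> 1" and ss: "\<forall>s\<in>set ss. 0 \<le> s"
  shows "saturated_sum k ss * damping k ss \<le> 2 / k powr (3/2) * (1 + sum_list ss) powr (-1/2)"
proof -
  let ?S = "saturated_sum k ss" and ?P = "damping k ss" and ?y = "sum_list ss"
  note b = damping_bounds[OF k(1) ss]
  have y: "0 \<le> ?y" using ss by (auto intro: sum_list_nonneg)
  have 1: "?S * ?P powr (1/2) \<le> 2 / k"
  proof -
    have "?P powr (1/2) \<le> exp (- k * ?S) powr (1/2)" using b by (intro powr_mono2) auto
    also have "\<dots> = exp (- (k * ?S / 2))" by (simp add: powr_def)
    finally have "?S * ?P powr (1/2) \<le> ?S * exp (- (k * ?S / 2))" using b by (intro mult_left_mono) auto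
    also have "\<dots> = 2 / k * (k * ?S / 2 / exp (k * ?S / 2))" using k by (simp add: exp_minus field_simps)
    also have "\<dots> \<le> 2 / k * 1"
    proof (rule mult_left_mono)
      have "k * ?S / 2 \<le> exp (k * ?S / 2)" using exp_ge_add_one_self[of "k * ?S / 2"] by linarith
      then show "k * ?S / 2 / exp (k * ?S / 2) \<le> 1" by (simp add: divide_le_eq)
    qed (use k in auto)
    finally show ?thesis by simp
  qed
  have 2: "?P powr (1/2) \<le> k powr (-1/2) * (1 + ?y) powr (-1/2)"
  proof -
    have "k * (1 + ?y) \<le> 1 + k * ?y" using k by (simp add: algebra_simps)
    then have "?P \<le> 1 / (k * (1 + ?y))"
      using b(2) k y by (intro order_trans[OF b(2)] divide_left_mono mult_pos_pos) (auto intro: add_pos_nonneg)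
    then have "?P powr (1/2) \<le> (1 / (k * (1 + ?y))) powr (1/2)" using b by (intro powr_mono2) auto
    also have "\<dots> = k powr (-1/2) * (1 + ?y) powr (-1/2)"
      using k y by (simp add: powr_divide powr_mult powr_minus divide_simps)
    finally show ?thesis .
  qed
  have "?S * ?P = (?S * ?P powr (1/2)) * ?P powr (1/2)"
    using b(1) by (simp add: mult.assoc flip: powr_add)
  also have "\<dots> \<le> 2 / k * (k powr (-1/2) * (1 + ?y) powr (-1/2))"
    using 1 2 b k by (intro mult_mono) auto
  also have "\<dots> = 2 / k powr (3/2) * (1 + ?y) powr (-1/2)"
  proof -
    have "k powr (3/2) = k * k powr (1/2)" using k powr_add[of k 1 "1/2"] by simp
    then show ?thesis using k by (simp add: powr_minus field_simps)
  qed
  finally show ?thesis .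
qed

text \<open>
  The profile \<open>y * (1 + y) powr (-3/2)\<close> combines linear growth at the origin with a decay of order one
  half at infinity, and it has an elementary integral with respect to \<open>dy / y\<close>.
\<close>

lemma damped_profile:
  fixes y :: real
  assumes y: "0 \<le> y" and a: "d \<le> a * y" "0 \<le> a" and b: "d \<le> b * (1 + y) powr (-1/2)" "0 \<le> b"
  shows "d \<le> (3 * a + 2 * b) * (y * (1 + y) powr (-3/2))"
proof (cases "y \<le> 1")
  case True
  have e: "(1 + y) powr (-3/2) * (1 + y) powr (3/2) = 1" using y by (simp flip: powr_add)
  have "(1 + y) powr (3/2) \<le> 2 powr (3/2)" using True y by (intro powr_mono2) auto
  also have "2 powr (3/2) \<le> (3::real)"
  proof -
    have "(2::real) powr (3/2) = 2 * sqrt 2" using powr_add[of 2 1 "1/2::real"] by (simp add: powr_half_sqrt)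
    moreover have "sqrt 2 \<le> (3/2::real)" by (rule real_le_lsqrt) (auto simp: power2_eq_square)
    ultimately show ?thesis by simp
  qed
  finally have "a * y * ((1 + y) powr (-3/2) * (1 + y) powr (3/2)) \<le> a * y * ((1 + y) powr (-3/2) * 3)"
    using y a by (intro mult_left_mono) auto
  then have "d \<le> 3 * a * (y * (1 + y) powr (-3/2))" using a(1) unfolding e by simp
  also have "\<dots> \<le> (3 * a + 2 * b) * (y * (1 + y) powr (-3/2))"
    using b y by (intro mult_right_mono) auto
  finally show ?thesis .
next
  case False
  have "(1 + y) powr (-1/2) = (1 + y) * (1 + y) powr (-3/2)"
    using y powr_add[of "1 + y" 1 "-3/2"] by simp
  also have "\<dots> \<le> 2 * (y * (1 + y) powr (-3/2))" using False by (simp add: mult_right_mono flip: mult.assoc)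
  finally have "b * (1 + y) powr (-1/2) \<le> b * (2 * (y * (1 + y) powr (-3/2)))" using b by (intro mult_left_mono) auto
  then have "d \<le> 2 * b * (y * (1 + y) powr (-3/2))" using b(1) by (simp add: mult_ac)
  also have "\<dots> \<le> (3 * a + 2 * b) * (y * (1 + y) powr (-3/2))"
    using a y by (intro mult_right_mono) auto
  finally show ?thesis .
qed

lemma integral_damped_profile:
  fixes \<sigma> X :: real
  assumes s: "0 < \<sigma>" and X: "0 \<le> X"
  shows "(\<lambda>x. \<sigma> * exp x * (1 + \<sigma> * exp x) powr (-3/2)) integrable_on {-X..X}"
    and "integral {-X..X} (\<lambda>x. \<sigma> * exp x * (1 + \<sigma> * exp x) powr (-3/2)) \<le> 2"
proof -
  have p: "0 < 1 + \<sigma> * exp x" for x :: real using s by (simp add: add_pos_pos)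
  have "((\<lambda>x. - 2 * (1 + \<sigma> * exp x) powr (-1/2)) has_vector_derivative
     \<sigma> * exp x * (1 + \<sigma> * exp x) powr (-3/2)) (at x within {-X..X})" for x
    unfolding has_real_derivative_iff_has_vector_derivative[symmetric]
    using p[of x] by (auto intro!: derivative_eq_intros simp: powr_diff field_simps)
  from fundamental_theorem_of_calculus[OF _ this] X
  have I: "((\<lambda>x. \<sigma> * exp x * (1 + \<sigma> * exp x) powr (-3/2)) has_integral
     (- 2 * (1 + \<sigma> * exp X) powr (-1/2)) - (- 2 * (1 + \<sigma> * exp (-X)) powr (-1/2))) {-X..X}"
    by simp
  then show "(\<lambda>x. \<sigma> * exp x * (1 + \<sigma> * exp x) powr (-3/2)) integrable_on {-X..X}" by blast
  have "(1 + \<sigma> * exp (-X)) powr (-1/2) \<le> 1 powr (-1/2)"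
    using s by (intro powr_mono2') auto
  then have "(1 + \<sigma> * exp (-X)) powr (-1/2) \<le> 1" by (simp only: powr_one_eq_one)
  moreover have "- 2 * q - (- 2 * p) \<le> 2" if "p \<le> 1" "0 \<le> q" for p q :: real
    using that by linarith
  ultimately have "(- 2 * (1 + \<sigma> * exp X) powr (-1/2)) - (- 2 * (1 + \<sigma> * exp (-X)) powr (-1/2)) \<le> 2"
    using powr_ge_zero by blast
  then show "integral {-X..X} (\<lambda>x. \<sigma> * exp x * (1 + \<sigma> * exp x) powr (-3/2)) \<le> 2"
    using integral_unique[OF I] by simp
qed

lemma sum_list_pos:
  "hs \<noteq> [] \<Longrightarrow> all_pos hs \<Longrightarrow> 0 < sum_list (hs :: real list)"
  by (induction hs rule: list_nonempty_induct) auto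

context sectorial_resolvent begin

text \<open>
  The bound of the resolvent cancels the length element of the rays, so only the integral of the
  difference of the symbols with respect to the logarithm of the modulus remains.  The scale \<open>\<sigma>\<close> does
  not enter the result, since a dilation is a translation of the logarithm.
\<close>

lemma Jprod_diff_le:
  assumes nz: "hs \<noteq> []" "ks \<noteq> []" and pos: "all_pos hs" "all_pos ks"
    and s: "0 < \<sigma>"
    and bound: "\<And>l. Re l = cmod l * cos \<phi> \<Longrightarrow>
        cmod (symbol hs l - symbol ks l) \<le> K * (\<sigma> * cmod l * (1 + \<sigma> * cmod l) powr (-3/2))"
  shows "norm (Jprod hs f - Jprod ks f) \<le> K * C * norm f"
proof -
  let ?g = "\<lambda>x. \<sigma> * exp x * (1 + \<sigma> * exp x) powr (-3/2)"
  have K: "0 \<le> K"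
  proof -
    define q where "q = \<sigma> * (1 + \<sigma>) powr (-3/2)"
    have "0 < q" using s by (simp add: q_def)
    have "0 \<le> K * q" using bound[of "cis \<phi>"] by (auto simp: q_def intro: order_trans[OF norm_ge_zero])
    with \<open>0 < q\<close> show ?thesis by (simp add: zero_le_mult_iff)
  qed
  let ?G = "\<lambda>hs l. symbol hs l *\<^sub>C R l f"
  have side: "norm (ray_integral X \<psi> (?G hs) - ray_integral X \<psi> (?G ks)) \<le> 2 * (K * C * norm f)"
    if X: "0 \<le> X" and psi: "\<bar>\<psi>\<bar> = \<phi>" for X \<psi>
  proof -
    let ?p = "ray_point \<psi>"
    have i: "(\<lambda>x. ?p x *\<^sub>C ?G ls (?p x)) integrable_on {-X..X}" if ls: "all_pos ls" for ls
    proof (rule integrable_continuous_interval)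
      have p: "continuous_on {-X..X} ?p" by (intro continuous_intros)
      show "continuous_on {-X..X} (\<lambda>x. ?p x *\<^sub>C ?G ls (?p x))"
        by (rule scaleC.continuous_on[OF p
              scaleC.continuous_on[OF continuous_on_symbol_R(1)[OF ls psi] continuous_on_symbol_R(2)[OF ls psi]]])
    qed
    have eq: "ray_integral X \<psi> (?G hs) - ray_integral X \<psi> (?G ks) =
        integral {-X..X} (\<lambda>x. ?p x *\<^sub>C ?G hs (?p x) - ?p x *\<^sub>C ?G ks (?p x))"
      unfolding ray_integral_def by (rule integral_diff[symmetric]) (rule i[OF pos(1)], rule i[OF pos(2)])
    have "norm (ray_integral X \<psi> (?G hs) - ray_integral X \<psi> (?G ks)) \<le>
        integral {-X..X} (\<lambda>x. K * C * norm f * ?g x)"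
      unfolding eq
    proof (rule integral_norm_bound_integral)
      show "(\<lambda>x. ?p x *\<^sub>C ?G hs (?p x) - ?p x *\<^sub>C ?G ks (?p x)) integrable_on {-X..X}"
        by (rule integrable_diff[OF i[OF pos(1)] i[OF pos(2)]])
      show "(\<lambda>x. K * C * norm f * ?g x) integrable_on {-X..X}"
        using integrable_cmul[OF integral_damped_profile(1)[OF s X], of "K * C * norm f"] by simp
      fix x
      have "cos \<psi> = cos \<phi>" using psi by (auto simp: abs_if split: if_splits)
      then have b: "cmod (symbol hs (?p x) - symbol ks (?p x)) \<le> K * ?g x"
        using bound[of "?p x"] by (simp add: ray_point_polar)
      have n: "?p x \<notin> sector \<phi>" by (rule ray_point_notin_sector) (use psi phi in auto)
      have "exp x * norm (R (?p x) f) \<le> exp x * (C / (1 + exp x) * norm f)"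
        using norm_R[OF n, of f] by (intro mult_left_mono) auto
      also have "\<dots> = exp x / (1 + exp x) * (C * norm f)" by simp
      also have "\<dots> \<le> 1 * (C * norm f)"
        using C_nonneg by (intro mult_right_mono) (auto simp: divide_le_eq add_pos_pos)
      finally have r: "exp x * norm (R (?p x) f) \<le> C * norm f" by simp
      have "norm (?p x *\<^sub>C ?G hs (?p x) - ?p x *\<^sub>C ?G ks (?p x)) =
         cmod (symbol hs (?p x) - symbol ks (?p x)) * (exp x * norm (R (?p x) f))"
        by (simp add: scaleC.diff_left[symmetric] scaleC.diff_right[symmetric] norm_scaleC)
      also have "\<dots> \<le> (K * ?g x) * (C * norm f)"
        by (rule mult_mono[OF b r order_trans[OF norm_ge_zero b]]) simp
      finally show "norm (?p x *\<^sub>C ?G hs (?p x) - ?p x *\<^sub>C ?G ks (?p x)) \<le> K * C * norm f * ?g x"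
        by (simp add: mult_ac)
    qed
    also have "\<dots> = K * C * norm f * integral {-X..X} ?g" by simp
    also have "\<dots> \<le> K * C * norm f * 2"
      using integral_damped_profile(2)[OF s X] K C_nonneg by (intro mult_left_mono) auto
    finally show ?thesis by simp
  qed
  have lim: "((\<lambda>X. wedge_integral X (?G hs) - wedge_integral X (?G ks)) \<longlongrightarrow>
     (- (2 * pi * \<i>)) *\<^sub>C Jprod hs f - (- (2 * pi * \<i>)) *\<^sub>C Jprod ks f) at_top"
    by (intro tendsto_diff wedge_integral_Jprod nz pos)
  have "\<forall>\<^sub>F X in at_top. norm (wedge_integral X (?G hs) - wedge_integral X (?G ks)) \<le> 4 * (K * C * norm f)"
    using eventually_ge_at_top[of 0]
  proof eventually_elim
    case (elim X)
    have eq: "wedge_integral X (?G hs) - wedge_integral X (?G ks) =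
      (ray_integral X \<phi> (?G hs) - ray_integral X \<phi> (?G ks)) - (ray_integral X (-\<phi>) (?G hs) - ray_integral X (-\<phi>) (?G ks))"
      by (simp add: wedge_integral_def)
    have "norm (wedge_integral X (?G hs) - wedge_integral X (?G ks)) \<le> 2 * (K * C * norm f) + 2 * (K * C * norm f)"
      unfolding eq using phi by (intro order_trans[OF norm_triangle_ineq4] add_mono side elim) auto
    then show ?case by linarith
  qed
  from Lim_norm_ubound[OF trivial_limit_at_top_linorder lim this]
  have "norm ((- (2 * pi * \<i>)) *\<^sub>C (Jprod hs f - Jprod ks f)) \<le> 4 * (K * C * norm f)"
    unfolding scaleC.diff_right .
  moreover have "cmod (- (2 * pi * \<i>)) = 2 * pi" by (simp add: norm_mult)
  ultimately have "2 * pi * norm (Jprod hs f - Jprod ks f) \<le> 4 * (K * C * norm f)"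
    unfolding norm_scaleC by simp
  moreover have "4 * norm (Jprod hs f - Jprod ks f) \<le> 2 * pi * norm (Jprod hs f - Jprod ks f)"
    using pi_ge_two by (intro mult_right_mono) auto
  ultimately show ?thesis by linarith
qed

lemma norm_one_plus_ray:
  assumes "0 \<le> h" "Re l = cmod l * cos \<phi>"
  shows "1 + cos \<phi> * (h * cmod l) \<le> cmod (1 + complex_of_real h * l)"
  using complex_Re_le_cmod[of "1 + complex_of_real h * l"] assms(2) by (simp add: mult_ac)

lemma symbol_minus_one:
  "\<forall>h\<in>set hs. 0 \<le> h \<Longrightarrow> 0 \<le> Re l \<Longrightarrow> cmod (symbol hs l - 1) \<le> sum_list hs * cmod l"
proof (induction hs)
  case (Cons h hs)
  let ?w = "complex_of_real h * l"
  have nz: "1 + ?w \<noteq> 0" and ge: "1 \<le> cmod (1 + ?w)"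
    using one_plus_nonzero[of h l] norm_one_plus_ge(1)[of h l] Cons.prems by auto
  have "symbol (h # hs) l - 1 = 1 / (1 + ?w) * (symbol hs l - 1) - ?w / (1 + ?w)"
  proof -
    have "1 / (1 + w) * F - 1 = 1 / (1 + w) * (F - 1) - w / (1 + w)" if "1 + w \<noteq> 0" for w F :: complex
    proof -
      have "1 / (1 + w) + w / (1 + w) = 1" using that by (simp flip: add_divide_distrib)
      moreover have "1 / (1 + w) * (F - 1) - w / (1 + w) = 1 / (1 + w) * F - (1 / (1 + w) + w / (1 + w))"
        by (simp add: right_diff_distrib)
      ultimately show ?thesis by simp
    qed
    from this[OF nz] show ?thesis by simp
  qed
  also have "cmod \<dots> \<le> 1 * (sum_list hs * cmod l) + h * cmod l"
  proof (rule order_trans[OF norm_triangle_ineq4 add_mono])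
    show "cmod (1 / (1 + ?w) * (symbol hs l - 1)) \<le> 1 * (sum_list hs * cmod l)"
      unfolding norm_mult using Cons ge by (intro mult_mono) (auto simp: norm_divide divide_le_eq)
    have "cmod ?w / cmod (1 + ?w) \<le> cmod ?w / 1" using ge by (intro divide_left_mono) auto
    then show "cmod (?w / (1 + ?w)) \<le> h * cmod l" using Cons.prems by (simp add: norm_divide norm_mult)
  qed
  finally show ?case by (simp add: algebra_simps)
qed simp

lemma norm_symbol_ray:
  assumes "\<forall>h\<in>set hs. 0 \<le> h" "Re l = cmod l * cos \<phi>" "0 < k" "k \<le> cos \<phi>"
  shows "cmod (symbol hs l) \<le> damping k (map (\<lambda>h. h * cmod l) hs)"
  using assms(1)
proof (induction hs)
  case (Cons h hs)
  have "k * (h * cmod l) \<le> cos \<phi> * (h * cmod l)" using Cons.prems assms by (intro mult_right_mono) auto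
  then have "1 + k * (h * cmod l) \<le> cmod (1 + complex_of_real h * l)"
    using norm_one_plus_ray[of h l] assms Cons.prems by simp
  then have "cmod (symbol hs l) / cmod (1 + complex_of_real h * l) \<le>
      damping k (map (\<lambda>h. h * cmod l) hs) / (1 + k * (h * cmod l))"
  proof (intro frac_le)
    show "0 < 1 + k * (h * cmod l)" using Cons.prems assms by (intro add_pos_nonneg) auto
    show "0 \<le> damping k (map (\<lambda>h. h * cmod l) hs)"
      using Cons.prems assms by (intro less_imp_le[OF damping_bounds(1)]) auto
  qed (use Cons in auto)
  then show ?case by (simp add: norm_mult norm_divide)
qed simp

lemma sum_list_map_mult_right: "sum_list (map (\<lambda>h. h * r) hs) = sum_list hs * (r::real)"
  by (induction hs) (auto simp: algebra_simps)

text \<open>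
  Symbols tend to one at the origin, so the symbol of a product is compared with the symbol of one Euler
  step with the total step size; the difference decays at both ends.
\<close>

lemma norm_Jprod:
  obtains M where "1 \<le> M" "\<And>hs f. all_pos hs \<Longrightarrow> norm (Jprod hs f) \<le> M * norm f"
proof -
  let ?k = "cos \<phi>"
  let ?K = "3 * 2 + 2 * (2 / ?k)"
  let ?M = "?K * C + C + 1"
  have k: "0 < ?k" "?k < 1" by (rule cos_phi)+
  have "norm (Jprod hs f) \<le> ?M * norm f" if pos: "all_pos hs" for hs f
  proof (cases "hs = []")
    case True
    have "1 * norm f \<le> ?M * norm f" using C_nonneg k by (intro mult_right_mono) auto
    then show ?thesis using True by simp
  next
    case False
    let ?s = "sum_list hs"
    have s: "0 < ?s"
      using False pos by (rule sum_list_pos)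
    have "norm (Jprod hs f - Jprod [?s] f) \<le> ?K * C * norm f"
    proof (rule Jprod_diff_le[where \<sigma> = ?s])
      fix l assume l: "Re l = cmod l * cos \<phi>"
      then have l0: "0 \<le> Re l" using k by simp
      let ?y = "?s * cmod l"
      have y: "0 \<le> ?y" using s by simp
      have dec: "cmod (symbol ls l) \<le> (1 / ?k) * (1 + ?y) powr (-1/2)"
        if "\<forall>h\<in>set ls. 0 \<le> h" "sum_list ls = ?s" for ls
      proof -
        have "cmod (symbol ls l) \<le> 1 / (1 + ?k * ?y)"
          using norm_symbol_ray[OF that(1) l k(1)] damping_bounds(2)[OF k(1), of "map (\<lambda>h. h * cmod l) ls"] that
          by (simp add: sum_list_map_mult_right)
        also have "\<dots> \<le> 1 / (?k * (1 + ?y))"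
        proof -
          have le: "?k * (1 + ?y) \<le> 1 + ?k * ?y" using k by (simp add: distrib_left)
          have "0 < ?k * (1 + ?y)" using k y by (intro mult_pos_pos) auto
          from frac_le[OF _ order_refl this le] show ?thesis by simp
        qed
        also have "\<dots> = (1 / ?k) * (1 + ?y) powr (-1)" using y by (simp add: powr_minus_divide)
        also have "\<dots> \<le> (1 / ?k) * (1 + ?y) powr (-1/2)"
          using k y by (intro mult_left_mono powr_mono) auto
        finally show ?thesis .
      qed
      have tri: "cmod (symbol hs l - symbol [?s] l) \<le> cmod (symbol hs l - 1) + cmod (symbol [?s] l - 1)"
        using norm_triangle_ineq4[of "symbol hs l - 1" "symbol [?s] l - 1"] by simp
      show "cmod (symbol hs l - symbol [?s] l) \<le> ?K * (?y * (1 + ?y) powr (-3/2))"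
      proof (rule damped_profile[OF y])
        have "cmod (symbol hs l - 1) \<le> ?y" "cmod (symbol [?s] l - 1) \<le> ?y"
          using symbol_minus_one[of hs l] symbol_minus_one[of "[?s]" l] pos s l0 by (auto simp: less_imp_le)
        then show "cmod (symbol hs l - symbol [?s] l) \<le> 2 * ?y" using tri by linarith
        show "cmod (symbol hs l - symbol [?s] l) \<le> (2 / ?k) * (1 + ?y) powr (-1/2)"
          using norm_triangle_ineq4[of "symbol hs l" "symbol [?s] l"] dec[of hs] dec[of "[?s]"] pos s
          by (simp add: less_imp_le)
      qed (use k in auto)
    qed (use False pos s in auto)
    moreover have "norm (Jprod [?s] f) \<le> C * norm f"
    proof -
      let ?w = "complex_of_real (- (1/?s))"
      have "norm (R ?w f) \<le> C / (1 + cmod ?w) * norm f"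
        by (rule norm_R[OF neg_real_notin_sector]) (use s in simp)
      then have "1/?s * norm (R ?w f) \<le> 1/?s * (C / (1 + 1/?s) * norm f)"
        using s by (intro mult_left_mono) (auto simp: norm_divide)
      also have "\<dots> = C * norm f * (1 / (?s + 1))" using s by (simp add: field_simps)
      also have "\<dots> \<le> C * norm f * 1" using s C_nonneg by (intro mult_left_mono) (auto simp: divide_le_eq)
      finally show ?thesis using s by (simp add: J_def)
    qed
    ultimately have "norm (Jprod hs f) \<le> ?K * C * norm f + C * norm f"
      using norm_triangle_ineq[of "Jprod hs f - Jprod [?s] f" "Jprod [?s] f"] by simp
    also have "\<dots> \<le> ?M * norm f" by (simp add: algebra_simps)
    finally show ?thesis .
  qed
  moreover have "1 \<le> ?M" using C_nonneg k by auto
  ultimately show ?thesis using that by blast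
qed

text \<open>
  Exchanging the factors for their dilations one at a time: each exchange contributes one term of
  \<open>saturated_sum\<close>, and all other factors are bounded by \<open>damping\<close>.  The constant \<open>k\<close> is halved
  because the dilated step sizes may be half as large.
\<close>

lemma symbol_scale_diff:
  assumes "\<forall>h\<in>set hs. 0 \<le> h" and l: "Re l = cmod l * cos \<phi>" and c: "1/2 \<le> c" "c \<le> 1"
  defines "k \<equiv> cos \<phi> / 2"
  shows "cmod (symbol hs l - symbol (map ((*) c) hs) l) \<le>
     (1 - c) * (saturated_sum k (map (\<lambda>h. h * cmod l) hs) * damping k (map (\<lambda>h. h * cmod l) hs))"
  using assms(1)
proof (induction hs)
  case (Cons h hs)
  let ?ss = "map (\<lambda>h. h * cmod l) hs"
  let ?s = "h * cmod l" and ?P = "damping k ?ss" and ?S = "saturated_sum k ?ss"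
  let ?u = "1 / (1 + complex_of_real h * l)" and ?v = "1 / (1 + complex_of_real (c * h) * l)"
  let ?F = "symbol hs l" and ?G = "symbol (map ((*) c) hs) l"
  have k: "0 < k" "k \<le> cos \<phi>" using cos_phi by (auto simp: k_def)
  have z: "0 \<le> h" "0 \<le> c * h" using Cons.prems c by auto
  have l0: "0 \<le> Re l" using l cos_phi by simp
  have s: "0 \<le> ?s" using z by simp
  have den: "0 < 1 + k * ?s" using k s by (simp add: add_pos_nonneg)
  have ss: "\<forall>s\<in>set ?ss. 0 \<le> s" using Cons.prems by auto
  note b = damping_bounds[OF k(1) ss]
  have lo: "1 + k * ?s \<le> cmod (1 + complex_of_real h * l)" "1 + k * ?s \<le> cmod (1 + complex_of_real (c * h) * l)"
  proof -
    have "k * ?s \<le> cos \<phi> * ?s" using k s by (intro mult_right_mono) auto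
    then show "1 + k * ?s \<le> cmod (1 + complex_of_real h * l)" using norm_one_plus_ray[OF z(1) l] by simp
    have "k * ?s \<le> (cos \<phi> * c) * ?s" using cos_phi c s by (intro mult_right_mono) (auto simp: k_def)
    then show "1 + k * ?s \<le> cmod (1 + complex_of_real (c * h) * l)"
      using norm_one_plus_ray[OF z(2) l] by (simp add: mult_ac)
  qed
  have nz: "1 + complex_of_real h * l \<noteq> 0" "1 + complex_of_real (c * h) * l \<noteq> 0"
    using one_plus_nonzero z l0 by blast+
  have u: "cmod ?u \<le> 1 / (1 + k * ?s)" unfolding norm_divide norm_one by (intro frac_le lo den) auto
  have uv: "cmod (?u - ?v) \<le> (1 - c) * (?s / (1 + k * ?s) / (1 + k * ?s))"
  proof -
    have "?u - ?v = - (complex_of_real (1 - c) * (complex_of_real h * l)) / ((1 + complex_of_real h * l) * (1 + complex_of_real (c * h) * l))"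
      using nz by (simp add: field_simps)
    also have "cmod \<dots> = (1 - c) * ?s / (cmod (1 + complex_of_real h * l) * cmod (1 + complex_of_real (c * h) * l))"
      using c z by (simp only: norm_divide norm_minus_cancel norm_mult norm_of_real)
    also have "\<dots> \<le> (1 - c) * ?s / ((1 + k * ?s) * (1 + k * ?s))"
      using c s z den lo by (intro frac_le mult_mono mult_pos_pos) auto
    finally show ?thesis by simp
  qed
  have G: "cmod ?G \<le> ?P"
  proof -
    have m: "map (\<lambda>h. h * cmod l) (map ((*) c) hs) = map ((*) c) ?ss" by (simp add: mult.assoc)
    have nonneg: "\<forall>h\<in>set (map ((*) c) hs). 0 \<le> h" using Cons.prems c by auto
    have "cmod ?G \<le> damping (cos \<phi>) (map ((*) c) ?ss)"
      using norm_symbol_ray[OF nonneg l cos_phi(1) order_refl] unfolding m .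
    also have "\<dots> \<le> ?P"
      by (rule damping_scale[OF k(1) _ _ _ ss]) (use cos_phi c in \<open>auto simp: k_def\<close>)
    finally show ?thesis .
  qed
  have "symbol (h # hs) l - symbol (map ((*) c) (h # hs)) l = ?u * (?F - ?G) + (?u - ?v) * ?G"
    by (simp only: symbol_simps list.map right_diff_distrib left_diff_distrib) simp
  also have "cmod \<dots> \<le> (1 / (1 + k * ?s)) * ((1 - c) * (?S * ?P)) + (1 - c) * (?s / (1 + k * ?s) / (1 + k * ?s)) * ?P"
  proof (rule order_trans[OF norm_triangle_ineq add_mono]; unfold norm_mult; rule mult_mono)
    show "cmod (?F - ?G) \<le> (1 - c) * (?S * ?P)" using Cons by simp
    show "cmod ?G \<le> ?P" using G by simp
    show "cmod ?u \<le> 1 / (1 + k * ?s)" by (rule u)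
    show "cmod (?u - ?v) \<le> (1 - c) * (?s / (1 + k * ?s) / (1 + k * ?s))" by (rule uv)
    show "0 \<le> 1 / (1 + k * ?s)" using den by simp
    show "0 \<le> (1 - c) * (?s / (1 + k * ?s) / (1 + k * ?s))" using den c s by simp
  qed simp_all
  also have "\<dots> = (1 - c) * ((?s / (1 + k * ?s) + ?S) * (?P / (1 + k * ?s)))"
  proof -
    have "(1 / d) * (e * (S * P)) + e * (s / d / d) * P = e * ((s / d + S) * (P / d))" for d e S P s :: real
      by (simp add: distrib_left distrib_right mult_ac)
    then show ?thesis .
  qed
  finally show ?case by (simp only: list.map damping_simps saturated_sum_simps)
qed simp

lemma norm_Jprod_scale:
  obtains L where "0 \<le> L" "\<And>hs f c. all_pos hs \<Longrightarrow> 1/2 \<le> c \<Longrightarrow> c \<le> 1 \<Longrightarrow>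
     norm (Jprod hs f - Jprod (map ((*) c) hs) f) \<le> L * (1 - c) * norm f"
proof -
  define k where "k = cos \<phi> / 2"
  have k: "0 < k" "k \<le> 1" using cos_phi by (auto simp: k_def)
  let ?b = "2 / k powr (3/2)"
  let ?K = "3 * 1 + 2 * ?b"
  have "norm (Jprod hs f - Jprod (map ((*) c) hs) f) \<le> ?K * C * (1 - c) * norm f"
    if pos: "all_pos hs" and c: "1/2 \<le> c" "c \<le> 1" for hs f c
  proof (cases "hs = []")
    case True
    then show ?thesis using k C_nonneg c by (auto intro!: mult_nonneg_nonneg add_nonneg_nonneg)
  next
    case False
    let ?s = "sum_list hs"
    have s: "0 < ?s"
      using False pos by (rule sum_list_pos)
    have "norm (Jprod hs f - Jprod (map ((*) c) hs) f) \<le> ((1 - c) * ?K) * C * norm f"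
    proof (rule Jprod_diff_le[where \<sigma> = ?s])
      fix l assume l: "Re l = cmod l * cos \<phi>"
      let ?y = "?s * cmod l" and ?ss = "map (\<lambda>h. h * cmod l) hs"
      have y: "0 \<le> ?y" using s by simp
      have ss: "\<forall>s\<in>set ?ss. 0 \<le> s" using pos by (auto simp: less_imp_le)
      have sum: "sum_list ?ss = ?y" by (rule sum_list_map_mult_right)
      note b = damping_bounds[OF k(1) ss, unfolded sum]
      have "saturated_sum k ?ss * damping k ?ss \<le> ?K * (?y * (1 + ?y) powr (-3/2))"
      proof (rule damped_profile[OF y])
        have "damping k ?ss \<le> 1" using b(2) k y by (smt (verit) divide_le_eq_1 mult_nonneg_nonneg)
        then show "saturated_sum k ?ss * damping k ?ss \<le> 1 * ?y"
          using mult_mono[OF b(5) _ y, of "damping k ?ss" 1] b(1) by simp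
        show "saturated_sum k ?ss * damping k ?ss \<le> ?b * (1 + ?y) powr (-1/2)"
          using saturated_damping_le[OF k ss] unfolding sum .
      qed (use k in auto)
      then have "(1 - c) * (saturated_sum k ?ss * damping k ?ss) \<le> (1 - c) * (?K * (?y * (1 + ?y) powr (-3/2)))"
        using c by (intro mult_left_mono) auto
      then show "cmod (symbol hs l - symbol (map ((*) c) hs) l) \<le> (1 - c) * ?K * (?y * (1 + ?y) powr (-3/2))"
        using symbol_scale_diff[of hs l c] pos l c unfolding k_def[symmetric]
        by (simp add: less_imp_le mult.assoc)
    qed (use False pos s c in auto)
    then show ?thesis by (simp add: mult_ac)
  qed
  moreover have "0 \<le> ?K * C" using k C_nonneg by (auto intro!: mult_nonneg_nonneg add_nonneg_nonneg)
  ultimately show ?thesis using that[of "?K * C"] by blast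
qed

end

section \<open>Maximum principle for the Caputo derivative\<close>

lemma vector_derivative_quotient:
  fixes w :: "real \<Rightarrow> 'x::real_normed_vector"
  assumes "(w has_vector_derivative v) (at t)"
  shows "((\<lambda>s. (1 / (s - t)) *\<^sub>R (w s - w t)) \<longlongrightarrow> v) (at t)"
proof -
  have "((\<lambda>s. (1 / norm (s - t)) *\<^sub>R (w s - (w t + (s - t) *\<^sub>R v))) \<longlongrightarrow> 0) (at t)"
    using assms by (simp add: has_vector_derivative_def has_derivative_within)
  from tendsto_norm[OF this]
  have "((\<lambda>s. norm ((1 / norm (s - t)) *\<^sub>R (w s - (w t + (s - t) *\<^sub>R v)))) \<longlongrightarrow> 0) (at t)" by simp
  moreover have "\<forall>\<^sub>F s in at t. norm ((1 / norm (s - t)) *\<^sub>R (w s - (w t + (s - t) *\<^sub>R v))) =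
      norm ((1 / (s - t)) *\<^sub>R (w s - w t) - v)"
    unfolding eventually_at_filter
  proof (intro always_eventually allI impI)
    fix s assume "s \<noteq> t"
    then have "(1 / (s - t)) *\<^sub>R ((s - t) *\<^sub>R v) = v" by simp
    then have "(1 / (s - t)) *\<^sub>R (w s - w t) - v = (1 / (s - t)) *\<^sub>R (w s - w t - (s - t) *\<^sub>R v)"
      by (simp only: scaleR_diff_right)
    then have "(1 / (s - t)) *\<^sub>R (w s - w t) - v = (1 / (s - t)) *\<^sub>R (w s - (w t + (s - t) *\<^sub>R v))"
      by (simp only: diff_diff_eq)
    then show "norm ((1 / norm (s - t)) *\<^sub>R (w s - (w t + (s - t) *\<^sub>R v))) = norm ((1 / (s - t)) *\<^sub>R (w s - w t) - v)"
      by simp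
  qed
  ultimately have "((\<lambda>s. norm ((1 / (s - t)) *\<^sub>R (w s - w t) - v)) \<longlongrightarrow> 0) (at t)"
    by (rule Lim_transform_eventually)
  then show ?thesis by (simp only: tendsto_norm_zero_iff Lim_null[of _ v])
qed

text \<open>
  The kernel and the atom at the origin have total mass one, so \<open>history_mean\<close> is an average of the
  values of \<open>g\<close> up to \<open>1 - d\<close>.  Time is
  measured in units of the present time, which makes the average invariant under dilations.
\<close>

definition history_mean :: "real \<Rightarrow> real \<Rightarrow> (real \<Rightarrow> 'x) \<Rightarrow> 'x::banach"
  where "history_mean \<alpha> d g = d powr \<alpha> *\<^sub>R g 0 +
    (\<alpha> * d powr \<alpha>) *\<^sub>R integral {0..1-d} (\<lambda>y. (1 - y) powr (-\<alpha>-1) *\<^sub>R g y)"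

lemma history_mean_integrable:
  assumes "0 < d" "continuous_on {0..1} g"
  shows "(\<lambda>y. (1 - y) powr (-\<alpha>-1) *\<^sub>R (g y :: 'x::banach)) integrable_on {0..1-d}"
  by (intro integrable_continuous_interval continuous_intros continuous_on_subset[OF assms(2)])
     (use assms in auto)

lemma history_mean_bounded_linear:
  fixes g :: "real \<Rightarrow> 'x::banach" and P :: "'x \<Rightarrow> 'y::banach"
  assumes "bounded_linear P" "0 < d" "continuous_on {0..1} g"
  shows "P (history_mean \<alpha> d g) = history_mean \<alpha> d (\<lambda>y. P (g y))"
proof -
  interpret bounded_linear P by fact
  show ?thesis
    using integral_linear[OF history_mean_integrable[OF assms(2,3), of \<alpha>] assms(1)]
    by (simp add: history_mean_def add scaleR o_def)
qed

lemma history_mean_diff: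
  fixes g k :: "real \<Rightarrow> 'x::banach"
  assumes "0 < d" "continuous_on {0..1} g" "continuous_on {0..1} k"
  shows "history_mean \<alpha> d g - history_mean \<alpha> d k = history_mean \<alpha> d (\<lambda>y. g y - k y)"
  using integral_diff[OF history_mean_integrable[OF assms(1,2), of \<alpha>] history_mean_integrable[OF assms(1,3), of \<alpha>]]
  by (simp add: history_mean_def scaleR_diff_right)

lemma norm_history_mean_le:
  fixes g :: "real \<Rightarrow> 'x::banach"
  assumes \<alpha>: "0 < \<alpha>" and d: "d \<in> {0<..<1}" and g: "continuous_on {0..1} g"
    and B: "norm (g 0) \<le> B" and Q: "\<And>y. y \<in> {0..1} \<Longrightarrow> norm (g y) \<le> Q"
  shows "norm (history_mean \<alpha> d g) \<le> d powr \<alpha> * B + (1 - d powr \<alpha>) * Q"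
proof -
  let ?k = "\<lambda>y. (1 - y) powr (-\<alpha>-1)"
  have dd: "d powr \<alpha> * d powr (-\<alpha>) = 1" using d by (simp flip: powr_add)
  have "((\<lambda>y. ?k y * Q) has_integral
      ((1 - (1 - d)) powr (-\<alpha>) / \<alpha> * Q - (1 - 0) powr (-\<alpha>) / \<alpha> * Q)) {0..1-d}"
  proof (rule fundamental_theorem_of_calculus)
    fix y assume "y \<in> {0..1-d}"
    then show "((\<lambda>y. (1 - y) powr (-\<alpha>) / \<alpha> * Q) has_vector_derivative ?k y * Q) (at y within {0..1-d})"
      unfolding has_real_derivative_iff_has_vector_derivative[symmetric]
      using d \<alpha> by (auto intro!: derivative_eq_intros simp: powr_diff field_simps)
  qed (use d in auto)
  then have FTC: "((\<lambda>y. ?k y * Q) has_integral (d powr (-\<alpha>) - 1) / \<alpha> * Q) {0..1-d}"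
    by (simp add: diff_divide_distrib left_diff_distrib)
  have "norm (integral {0..1-d} (\<lambda>y. ?k y *\<^sub>R g y)) \<le> integral {0..1-d} (\<lambda>y. ?k y * Q)"
  proof (rule integral_norm_bound_integral)
    fix y assume "y \<in> {0..1-d}"
    then show "norm (?k y *\<^sub>R g y) \<le> ?k y * Q" using Q[of y] d by (simp add: mult_left_mono)
  qed (use FTC history_mean_integrable[OF _ g] d in auto)
  then have "(\<alpha> * d powr \<alpha>) * norm (integral {0..1-d} (\<lambda>y. ?k y *\<^sub>R g y)) \<le> (\<alpha> * d powr \<alpha>) * ((d powr (-\<alpha>) - 1) / \<alpha> * Q)"
    unfolding integral_unique[OF FTC] using \<alpha> by (intro mult_left_mono) auto
  also have "\<dots> = (d powr \<alpha> * d powr (-\<alpha>) - d powr \<alpha>) * Q" using \<alpha> by (simp add: right_diff_distrib)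
  finally have "norm ((\<alpha> * d powr \<alpha>) *\<^sub>R integral {0..1-d} (\<lambda>y. ?k y *\<^sub>R g y)) \<le> (1 - d powr \<alpha>) * Q"
    unfolding dd using \<alpha> by simp
  moreover have "norm (d powr \<alpha> *\<^sub>R g 0) \<le> d powr \<alpha> * B" using B by (simp add: mult_left_mono)
  ultimately show ?thesis unfolding history_mean_def by (intro order_trans[OF norm_triangle_ineq] add_mono)
qed

text \<open>
  Here \<open>I\<close> is the Caputo derivative at time one without the Gamma factor.  Integration by parts up to
  time \<open>1 - d\<close> moves the derivative to the kernel; what is left of the integral tends to zero, and
  \<open>w 1 - w (1 - d)\<close> is of order \<open>d\<close>, hence small compared with \<open>d powr \<alpha>\<close>.
\<close>

lemma fractional_average:
  fixes w :: "real \<Rightarrow> 'x::banach"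
  assumes \<alpha>: "0 < \<alpha>" "\<alpha> < 1"
    and cont: "continuous_on {0..1} w"
    and deriv: "\<And>y. y \<in> {0<..1} \<Longrightarrow> (w has_vector_derivative w' y) (at y)"
    and int: "((\<lambda>y. (1 - y) powr (-\<alpha>) *\<^sub>R w' y) has_integral I) {0..1}"
  shows "\<exists>E. ((\<lambda>d. d powr (-\<alpha>) *\<^sub>R E d) \<longlongrightarrow> 0) (at_right 0) \<and>
    (\<forall>d\<in>{0<..<1}. w 1 - d powr \<alpha> *\<^sub>R I = history_mean \<alpha> d w + E d)"
proof -
  let ?k = "\<lambda>y. (1 - y) powr (-\<alpha>) *\<^sub>R w' y"
  define E where "E d = w 1 - w (1 - d) - d powr \<alpha> *\<^sub>R integral {1-d..1} ?k" for d
  have "((\<lambda>d. d powr (-\<alpha>) *\<^sub>R E d) \<longlongrightarrow> 0) (at_right 0)"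
  proof -
    have int1: "?k integrable_on {0..1}" using int by blast
    have "continuous_on {0..1} (\<lambda>x. integral {x..1} ?k)"
      by (rule indefinite_integral_continuous_1'[OF int1])
    then have "((\<lambda>x. integral {x..1} ?k) \<longlongrightarrow> integral {1..1} ?k) (at 1 within {0..1})"
      by (auto simp: continuous_on_def dest!: bspec[of _ _ 1])
    then have l1: "((\<lambda>x. integral {x..1} ?k) \<longlongrightarrow> 0) (at_left 1)"
      by (simp add: at_within_Icc_at_left)
    have sub: "filterlim (\<lambda>d::real. 1 - d) (at_left 1) (at_right 0)"
      unfolding filterlim_at
      by (auto intro!: tendsto_eq_intros eventually_mono[OF eventually_at_right_less[of 0]])
    have a: "((\<lambda>d. integral {1-d..1} ?k) \<longlongrightarrow> 0) (at_right 0)"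
      using filterlim_compose[OF l1 sub] .
    have "((\<lambda>x. (1 / (x - 1)) *\<^sub>R (w x - w 1)) \<longlongrightarrow> w' 1) (at_left 1)"
      using vector_derivative_quotient[OF deriv[of 1]] by (auto intro: filterlim_mono at_le)
    from filterlim_compose[OF this sub]
    have b: "((\<lambda>d. (1 / (1 - d - 1)) *\<^sub>R (w (1 - d) - w 1)) \<longlongrightarrow> w' 1) (at_right 0)" .
    have c: "((\<lambda>d::real. d powr (1 - \<alpha>)) \<longlongrightarrow> 0) (at_right 0)"
    proof -
      have "((\<lambda>d::real. d powr (1 - \<alpha>)) \<longlongrightarrow> 0 powr (1 - \<alpha>)) (at_right 0)"
        using \<alpha> by (intro tendsto_powr') (auto intro!: tendsto_intros simp: eventually_at_filter)
      then show ?thesis by simp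
    qed
    have "((\<lambda>d. d powr (1 - \<alpha>) *\<^sub>R ((1 / (1 - d - 1)) *\<^sub>R (w (1 - d) - w 1)) - integral {1-d..1} ?k) \<longlongrightarrow> 0 *\<^sub>R w' 1 - 0) (at_right 0)"
      by (intro tendsto_intros a b c)
    moreover have "\<forall>\<^sub>F d in at_right 0. d powr (1 - \<alpha>) *\<^sub>R ((1 / (1 - d - 1)) *\<^sub>R (w (1 - d) - w 1)) - integral {1-d..1} ?k = d powr (-\<alpha>) *\<^sub>R E d"
      using eventually_at_right_less[of 0]
    proof eventually_elim
      case (elim d)
      have "d powr (1 - \<alpha>) = d * d powr (-\<alpha>)" using elim powr_add[of d 1 "-\<alpha>"] by simp
      then have "d powr (1 - \<alpha>) *\<^sub>R ((1 / (1 - d - 1)) *\<^sub>R (w (1 - d) - w 1)) = d powr (-\<alpha>) *\<^sub>R (w 1 - w (1 - d))"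
        using elim by (simp add: scaleR_diff_right)
      moreover have "d powr (-\<alpha>) * d powr \<alpha> = 1" using elim by (simp flip: powr_add)
      ultimately show ?case by (simp add: E_def scaleR_diff_right)
    qed
    ultimately show ?thesis by (auto intro: Lim_transform_eventually)
  qed
  moreover have "w 1 - d powr \<alpha> *\<^sub>R I = history_mean \<alpha> d w + E d"
    if d: "d \<in> {0<..<1}" for d
  proof -
    have i1: "?k integrable_on {0..1-d}"
      by (rule integrable_subinterval_real[of _ 0 1]) (use int d in auto)
    have "((\<lambda>y. (\<alpha> * (1 - y) powr (-\<alpha>-1)) *\<^sub>R w y) has_integral
       (1 - (1 - d)) powr (-\<alpha>) *\<^sub>R w (1 - d) - (1 - 0) powr (-\<alpha>) *\<^sub>R w 0 - integral {0..1-d} ?k) {0..1-d}"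
    proof (rule integration_by_parts_interior[OF bounded_bilinear_scaleR])
      show "continuous_on {0..1-d} (\<lambda>y. (1 - y) powr (-\<alpha>))" using d by (intro continuous_intros) auto
      show "continuous_on {0..1-d} w" by (rule continuous_on_subset[OF cont]) (use d in auto)
      fix y assume y: "y \<in> {0<..<1-d}"
      show "((\<lambda>y. (1 - y) powr (-\<alpha>)) has_vector_derivative \<alpha> * (1 - y) powr (-\<alpha>-1)) (at y)"
        unfolding has_real_derivative_iff_has_vector_derivative[symmetric]
        using y d by (auto intro!: derivative_eq_intros simp: powr_diff field_simps)
      show "(w has_vector_derivative w' y) (at y)" using y d by (intro deriv) auto
    qed (use d i1 in \<open>auto simp: has_integral_iff\<close>)
    from integral_unique[OF this]
    have "integral {0..1-d} (\<lambda>y. (\<alpha> * (1 - y) powr (-\<alpha>-1)) *\<^sub>R w y) =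
       d powr (-\<alpha>) *\<^sub>R w (1 - d) - w 0 - integral {0..1-d} ?k" by simp
    moreover have "integral {0..1-d} (\<lambda>y. (\<alpha> * (1 - y) powr (-\<alpha>-1)) *\<^sub>R w y) =
       \<alpha> *\<^sub>R integral {0..1-d} (\<lambda>y. (1 - y) powr (-\<alpha>-1) *\<^sub>R w y)"
      by (simp only: scaleR_scaleR[symmetric] integral_cmul)
    ultimately have eq: "integral {0..1-d} ?k = d powr (-\<alpha>) *\<^sub>R w (1 - d) - w 0 - \<alpha> *\<^sub>R integral {0..1-d} (\<lambda>y. (1 - y) powr (-\<alpha>-1) *\<^sub>R w y)"
      by (simp add: algebra_simps)
    have "I = integral {0..1-d} ?k + integral {1-d..1} ?k"
      using Henstock_Kurzweil_Integration.integral_combine[of 0 "1-d" 1 ?k] int d by (auto simp: has_integral_iff)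
    moreover have "d powr \<alpha> * d powr (-\<alpha>) = 1" using d by (simp flip: powr_add)
    ultimately show ?thesis unfolding eq E_def history_mean_def
      by (simp add: scaleR_add_right scaleR_diff_right mult.commute)
  qed
  ultimately show ?thesis by blast
qed

text \<open>
  The index \<open>i\<close> runs through the Euler products by which the values are measured, and the average of
  the past at \<open>i\<close> may be measured by another index \<open>j\<close>.  At a time where the supremum \<open>Q\<close> over all
  indices is maximal the average contains the initial value with weight \<open>d powr \<alpha>\<close> and values at most
  \<open>Q\<close> otherwise; so \<open>d powr \<alpha>\<close> times the excess of \<open>Q\<close> over the initial bound is at most the error,
  which is of smaller order.  The function \<open>y\<close> controls all indices at once and makes \<open>Q\<close> continuous.
\<close>

lemma fractional_maximum_principle:
  fixes p :: "'i \<Rightarrow> real \<Rightarrow> 'x::banach" and y :: "real \<Rightarrow> 'y::real_normed_vector"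
  assumes \<alpha>: "0 < \<alpha>" and T: "0 < T"
    and cont: "continuous_on {0..T} y"
    and dom: "\<And>i s t. i \<in> I \<Longrightarrow> s \<in> {0..T} \<Longrightarrow> t \<in> {0..T} \<Longrightarrow> norm (p i s - p i t) \<le> M * norm (y s - y t)"
    and B: "\<And>i. i \<in> I \<Longrightarrow> norm (p i 0) \<le> B"
    and avg: "\<And>t. t \<in> {0<..<T} \<Longrightarrow> \<exists>E. ((\<lambda>d. d powr (-\<alpha>) * E d) \<longlongrightarrow> 0) (at_right 0) \<and>
      (\<forall>d\<in>{0<..<1}. \<forall>i\<in>I. \<exists>j\<in>I. norm (p i t) \<le> norm (history_mean \<alpha> d (\<lambda>x. p j (t * x))) + E d)"
    and t: "t \<in> {0..T}" and i: "i \<in> I"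
  shows "norm (p i t) \<le> B"
proof -
  have M: "norm (p i s - p i t) \<le> \<bar>M\<bar> * norm (y s - y t)" if "i \<in> I" "s \<in> {0..T}" "t \<in> {0..T}" for i s t
    by (rule order_trans[OF dom[OF that] mult_right_mono[OF abs_ge_self norm_ge_zero]])
  have cp: "continuous_on {0..T} (p i)" if "i \<in> I" for i
    by (rule continuous_on_dominated[OF cont dom[OF that]])
  obtain K where K: "\<And>t. t \<in> {0..T} \<Longrightarrow> norm (y t - y 0) \<le> K"
  proof -
    have "continuous_on {0..T} (\<lambda>t. y t - y 0)" by (intro continuous_intros cont)
    then have "bounded ((\<lambda>t. y t - y 0) ` {0..T})"
      by (intro compact_imp_bounded compact_continuous_image compact_Icc)
    then obtain K where "\<forall>z\<in>(\<lambda>t. y t - y 0) ` {0..T}. norm z \<le> K" by (auto simp: bounded_iff)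
    then show ?thesis using that by blast
  qed
  have bd: "norm (p i t) \<le> B + \<bar>M\<bar> * K" if i: "i \<in> I" and t: "t \<in> {0..T}" for i t
  proof -
    have "norm (p i t - p i 0) \<le> \<bar>M\<bar> * norm (y t - y 0)" using M[OF i t] T by auto
    also have "\<dots> \<le> \<bar>M\<bar> * K" using K[OF t] by (intro mult_left_mono) auto
    finally show ?thesis using norm_triangle_ineq[of "p i 0" "p i t - p i 0"] B[OF i] by simp
  qed
  define Q where "Q t = (SUP i\<in>I. norm (p i t))" for t
  have le_Q: "norm (p i t) \<le> Q t" if "i \<in> I" "t \<in> {0..T}" for i t
    unfolding Q_def using bd that by (intro cSUP_upper bdd_aboveI2) auto
  have Q_le: "Q t \<le> b" if "\<And>i. i \<in> I \<Longrightarrow> norm (p i t) \<le> b" for t b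
    unfolding Q_def using i by (intro cSUP_least that) auto
  have Q_lip: "Q s \<le> Q t + \<bar>M\<bar> * norm (y s - y t)" if s: "s \<in> {0..T}" and t: "t \<in> {0..T}" for s t
  proof (rule Q_le)
    fix i assume i: "i \<in> I"
    show "norm (p i s) \<le> Q t + \<bar>M\<bar> * norm (y s - y t)"
      using norm_triangle_ineq[of "p i t" "p i s - p i t"] le_Q[OF i t] M[OF i s t] by simp
  qed
  have cQ: "continuous_on {0..T} Q"
  proof (rule continuous_on_dominated[OF cont])
    fix s t assume st: "s \<in> {0..T}" "t \<in> {0..T}"
    show "norm (Q s - Q t) \<le> \<bar>M\<bar> * norm (y s - y t)"
      using Q_lip[OF st] Q_lip[OF st(2,1)] by (simp add: norm_minus_commute abs_le_iff)
  qed
  have QB: "Q t \<le> B" if t: "0 \<le> t" "t < T" for t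
  proof -
    obtain t0 where t0: "t0 \<in> {0..t}" and max: "\<And>s. s \<in> {0..t} \<Longrightarrow> Q s \<le> Q t0"
      using continuous_attains_sup[of "{0..t}" Q] continuous_on_subset[OF cQ, of "{0..t}"] t by auto
    have "Q t0 \<le> B"
    proof (cases "t0 = 0")
      case True
      then show ?thesis using Q_le[of 0 B] B by simp
    next
      case False
      then have "t0 \<in> {0<..<T}" using t0 t by auto
      from avg[OF this] obtain E where E: "((\<lambda>d. d powr (-\<alpha>) * E d) \<longlongrightarrow> 0) (at_right 0)"
        and avg': "\<And>d i. d\<in>{0<..<1} \<Longrightarrow> i\<in>I \<Longrightarrow> \<exists>j\<in>I. norm (p i t0) \<le> norm (history_mean \<alpha> d (\<lambda>x. p j (t0 * x))) + E d"
        by blast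
      have tx: "t0 * x \<in> {0..t}" if "x \<in> {0..1}" for x
        using that t0 mult_left_mono[of x 1 t0] by auto
      have "Q t0 - B \<le> d powr (-\<alpha>) * E d" if d: "d \<in> {0<..<1}" for d
      proof -
        have "Q t0 \<le> d powr \<alpha> * B + (1 - d powr \<alpha>) * Q t0 + E d"
        proof (rule Q_le)
          fix i assume "i \<in> I"
          then obtain j where j: "j \<in> I" and le: "norm (p i t0) \<le> norm (history_mean \<alpha> d (\<lambda>x. p j (t0 * x))) + E d"
            using avg'[OF d] by blast
          have "norm (history_mean \<alpha> d (\<lambda>x. p j (t0 * x))) \<le> d powr \<alpha> * B + (1 - d powr \<alpha>) * Q t0"
          proof (rule norm_history_mean_le[OF \<alpha> d])
            show "continuous_on {0..1} (\<lambda>x. p j (t0 * x))"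
              by (rule continuous_on_compose2[OF cp[OF j]]) (use tx t in \<open>force intro!: continuous_intros\<close>)+
            fix x :: real assume x: "x \<in> {0..1}"
            show "norm (p j (t0 * x)) \<le> Q t0"
              using le_Q[OF j, of "t0 * x"] max[OF tx[OF x]] tx[OF x] t by auto
          qed (use B[OF j] in simp)
          then show "norm (p i t0) \<le> d powr \<alpha> * B + (1 - d powr \<alpha>) * Q t0 + E d" using le by linarith
        qed
        then have "d powr \<alpha> * (Q t0 - B) \<le> E d" by (simp add: algebra_simps)
        then have "d powr (-\<alpha>) * (d powr \<alpha> * (Q t0 - B)) \<le> d powr (-\<alpha>) * E d" by (intro mult_left_mono) auto
        moreover have "d powr (-\<alpha>) * d powr \<alpha> = 1" using d by (simp flip: powr_add)
        ultimately show ?thesis by (simp flip: mult.assoc)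
      qed
      then have "\<forall>\<^sub>F d in at_right 0. Q t0 - B \<le> d powr (-\<alpha>) * E d"
        by (intro eventually_mono[OF eventually_at_right_real[of 0 1]]) auto
      from tendsto_lowerbound[OF E this] show ?thesis by simp
    qed
    then show ?thesis using max[of t] t by simp
  qed
  have "Q T \<le> B"
  proof -
    have "(Q \<longlongrightarrow> Q T) (at T within {0..T})" using cQ T by (simp add: continuous_on_def)
    then have "(Q \<longlongrightarrow> Q T) (at_left T)" using T by (simp add: at_within_Icc_at_left)
    moreover have "\<forall>\<^sub>F t in at_left T. Q t \<le> B"
      using T QB by (intro eventually_mono[OF eventually_at_left_real[of 0 T]]) auto
    ultimately show ?thesis by (rule tendsto_upperbound) simp
  qed
  then have "Q t \<le> B" using QB[of t] t by (cases "t = T") auto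
  then show ?thesis using le_Q[OF i t] by simp
qed

section \<open>A priori estimates for solutions\<close>

lemma continuous_on_time_scale:
  assumes "continuous_on {0..T} u" "(t::real) \<in> {0..T}"
  shows "continuous_on {0..1} (\<lambda>y. u (t * y))"
proof (rule continuous_on_compose2[OF assms(1)])
  show "(*) t ` {0..1} \<subseteq> {0..T}"
  proof clarify
    fix y :: real assume y: "y \<in> {0..1}"
    then have "t * y \<le> t * 1" using assms(2) by (intro mult_left_mono) auto
    then have "t * y \<le> T" using assms(2)[unfolded atLeastAtMost_iff] by linarith
    then show "t * y \<in> {0..T}" using y assms(2) by auto
  qed
qed (intro continuous_intros)

context sectorial_resolvent begin

text \<open>
  The equation replaces the Caputo derivative in \<open>fractional_average\<close> by \<open>A (u t)\<close>, and moving this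
  term to the left completes an Euler step.
\<close>

lemma cauchy_solution_average:
  assumes \<alpha>: "0 < \<alpha>" "\<alpha> < 1" and sol: "cauchy_solution D A \<alpha> T f u" and t: "t \<in> {0<..<T}"
  shows "\<exists>E. ((\<lambda>d. d powr (-\<alpha>) *\<^sub>R E d) \<longlongrightarrow> 0) (at_right 0) \<and>
    (\<forall>d\<in>{0<..<1}. u t = J (Gamma (1 - \<alpha>) * (d * t) powr \<alpha>) (history_mean \<alpha> d (\<lambda>y. u (t * y)) + E d))"
proof -
  let ?g = "Gamma (1 - \<alpha>)"
  have g: "0 < ?g" using \<alpha> by (intro Gamma_real_pos) auto
  let ?w = "\<lambda>y. u (t * y)" and ?w' = "\<lambda>y. t *\<^sub>R deriv_vec u (t * y)"
  have uD: "u t \<in> D" and capt: "caputo \<alpha> u t = A (u t)" and int: "rl_integrable (1 - \<alpha>) (deriv_vec u) t"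
    and cu: "continuous_on {0..T} u" and du: "\<And>s. s \<in> {0<..<T} \<Longrightarrow> u differentiable (at s)"
    using sol t by (auto simp: cauchy_solution_def caputo_exists_def)
  have cont: "continuous_on {0..1} ?w" by (rule continuous_on_time_scale[OF cu]) (use t in auto)
  have deriv: "(?w has_vector_derivative ?w' y) (at y)" if y: "y \<in> {0<..1}" for y
  proof -
    have "t * y \<le> t * 1" using y t by (intro mult_left_mono) auto
    then have "t * y < T" using t[unfolded greaterThanLessThan_iff] by linarith
    then have "t * y \<in> {0<..<T}" using y t by auto
    from du[OF this] have "(u has_vector_derivative deriv_vec u (t * y)) (at (t * y))"
      by (simp add: deriv_vec_def vector_derivative_works)
    moreover have "((\<lambda>y. t * y) has_vector_derivative t) (at y)"
      by (auto intro!: derivative_eq_intros simp flip: has_real_derivative_iff_has_vector_derivative)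
    ultimately show ?thesis using vector_diff_chain_at[of "\<lambda>y. t * y" t y u "deriv_vec u (t * y)"] by (simp add: o_def)
  qed
  have "(rl_kernel (1 - \<alpha>) (deriv_vec u) t has_integral ?g *\<^sub>R A (u t)) {0..t}"
  proof -
    have "?g *\<^sub>R caputo \<alpha> u t = integral {0..t} (rl_kernel (1 - \<alpha>) (deriv_vec u) t)"
      using g by (simp add: caputo_def rl_integral_def)
    then show ?thesis using int capt by (simp add: rl_integrable_def has_integral_iff)
  qed
  from has_integral_stretch_real[OF this, of t]
  have "((\<lambda>y. rl_kernel (1 - \<alpha>) (deriv_vec u) t (t * y)) has_integral (1 / t) *\<^sub>R ?g *\<^sub>R A (u t)) {0..1}"
    using t by simp
  from has_integral_cmul[OF this, of "t powr (1 + \<alpha>)"]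
  have "((\<lambda>y. t powr (1 + \<alpha>) *\<^sub>R rl_kernel (1 - \<alpha>) (deriv_vec u) t (t * y)) has_integral (?g * t powr \<alpha>) *\<^sub>R A (u t)) {0..1}"
    using t by (simp add: powr_add mult.commute)
  moreover have "t powr (1 + \<alpha>) *\<^sub>R rl_kernel (1 - \<alpha>) (deriv_vec u) t (t * y) = (1 - y) powr (-\<alpha>) *\<^sub>R ?w' y"
    if "y \<in> {0..1}" for y
  proof -
    have "t - t * y = t * (1 - y)" by (simp add: algebra_simps)
    then have "(t - t * y) powr \<alpha> = t powr \<alpha> * (1 - y) powr \<alpha>" using that t by (simp add: powr_mult)
    then show ?thesis using t by (simp add: rl_kernel_def powr_add powr_minus field_simps)
  qed
  ultimately have hint: "((\<lambda>y. (1 - y) powr (-\<alpha>) *\<^sub>R ?w' y) has_integral (?g * t powr \<alpha>) *\<^sub>R A (u t)) {0..1}"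
    by (subst has_integral_cong[symmetric]) auto
  from fractional_average[OF \<alpha> cont deriv hint] obtain E where E: "((\<lambda>d. d powr (-\<alpha>) *\<^sub>R E d) \<longlongrightarrow> 0) (at_right 0)"
    and eq: "\<And>d. d\<in>{0<..<1} \<Longrightarrow> u t - d powr \<alpha> *\<^sub>R (?g * t powr \<alpha>) *\<^sub>R A (u t) = history_mean \<alpha> d ?w + E d"
    by auto
  have "u t = J (?g * (d * t) powr \<alpha>) (history_mean \<alpha> d ?w + E d)"
    if d: "d \<in> {0<..<1}" for d
  proof (rule J_eqI[symmetric])
    show "u t - (?g * (d * t) powr \<alpha>) *\<^sub>R A (u t) = history_mean \<alpha> d ?w + E d"
      using eq[OF d] d t by (simp add: powr_mult mult_ac)
  qed (use uD g d t in auto)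
  then show ?thesis using E by blast
qed

lemma Jprod_average:
  assumes d: "0 < d" and z: "0 < h" and zs: "all_pos hs" and g: "continuous_on {0..1} g"
    and eq: "v = J h (history_mean \<alpha> d g + e)"
  shows "Jprod hs v = history_mean \<alpha> d (\<lambda>y. Jprod (h # hs) (g y)) + Jprod (h # hs) e"
proof -
  have P: "bounded_linear (Jprod (h # hs))" using z zs by (intro bounded_linear_Jprod) auto
  have "Jprod hs v = Jprod (h # hs) (history_mean \<alpha> d g + e)" unfolding eq by (simp only: Jprod.simps)
  then show ?thesis
    by (simp only: history_mean_bounded_linear[OF P d g] linear_add[OF bounded_linear.linear[OF P]])
qed

text \<open>
  The solution at time \<open>t\<close> is compared with its dilation: a product with step sizes \<open>hs\<close> acts on
  \<open>u t\<close> and the one with step sizes multiplied by \<open>r powr \<alpha>\<close> acts on \<open>u (r t)\<close>.  By the averaging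
  identities at \<open>t\<close> and at \<open>r t\<close> both lists grow by corresponding steps, so the maximum principle
  applies to the difference.  The factor \<open>\<beta>\<close> allows a comparison with zero.
\<close>

lemma cauchy_solution_comparison:
  assumes \<alpha>: "0 < \<alpha>" "\<alpha> < 1" and T: "0 < T" and sol: "cauchy_solution D A \<alpha> T f u" and t: "t \<in> {0..T}"
    and r: "0 < r" "r \<le> 1"
    and M: "0 \<le> M" "\<And>hs f. all_pos hs \<Longrightarrow> norm (Jprod hs f) \<le> M * norm f"
    and B: "\<And>hs. all_pos hs \<Longrightarrow>
       norm (Jprod hs f - \<beta> *\<^sub>R Jprod (map ((*) (r powr \<alpha>)) hs) f) \<le> B"
  shows "norm (u t - \<beta> *\<^sub>R u (r * t)) \<le> B"
proof -
  have cu: "continuous_on {0..T} u" and u0: "u 0 = f" using sol by (auto simp: cauchy_solution_def)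
  define c where "c = r powr \<alpha>"
  have c: "0 < c" using r by (simp add: c_def)
  have rs: "r * s \<in> {0..T}" if "s \<in> {0..T}" for s
    using that r mult_left_le_one_le[of s r] by auto
  let ?I = "{hs. \<forall>h\<in>set hs. (0::real) < h}"
  let ?m = "map ((*) c)"
  let ?p = "\<lambda>hs t. Jprod hs (u t) - \<beta> *\<^sub>R Jprod (?m hs) (u (r * t))"
  have mI: "all_pos (?m hs)" if "all_pos hs" for hs using that c by auto
  have lin: "Jprod hs (x - y) = Jprod hs x - Jprod hs y" if "all_pos hs" for hs x y
    by (rule linear_diff[OF bounded_linear.linear[OF bounded_linear_Jprod[OF that]]])
  have cont: "continuous_on {0..T} (\<lambda>t. (u t, u (r * t)))"
    by (intro continuous_intros continuous_on_compose2[OF cu]) (use rs in auto)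
  have "norm (?p [] t) \<le> B"
  proof (rule fractional_maximum_principle[where I = ?I and p = ?p and M = "M + \<bar>\<beta>\<bar> * M", OF \<alpha>(1) T cont])
    fix t assume t: "t \<in> {0<..<T}"
    have "r * t \<le> 1 * t" using t r by (intro mult_right_mono) auto
    then have "r * t < T" using t[unfolded greaterThanLessThan_iff] by linarith
    then have rt: "r * t \<in> {0<..<T}" using t r by auto
    from cauchy_solution_average[OF \<alpha> sol t] obtain E where
      E: "((\<lambda>d. d powr (-\<alpha>) *\<^sub>R E d) \<longlongrightarrow> 0) (at_right 0)"
      and eq: "\<And>d. d\<in>{0<..<1} \<Longrightarrow> u t = J (Gamma (1 - \<alpha>) * (d * t) powr \<alpha>) (history_mean \<alpha> d (\<lambda>y. u (t * y)) + E d)" by blast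
    from cauchy_solution_average[OF \<alpha> sol rt] obtain E' where
      E': "((\<lambda>d. d powr (-\<alpha>) *\<^sub>R E' d) \<longlongrightarrow> 0) (at_right 0)"
      and eq': "\<And>d. d\<in>{0<..<1} \<Longrightarrow> u (r * t) = J (Gamma (1 - \<alpha>) * (d * (r * t)) powr \<alpha>) (history_mean \<alpha> d (\<lambda>y. u (r * t * y)) + E' d)" by blast
    have g: "continuous_on {0..1} (\<lambda>y. u (t * y))" "continuous_on {0..1} (\<lambda>y. u (r * t * y))"
      using t rt by (auto intro: continuous_on_time_scale[OF cu])
    show "\<exists>E. ((\<lambda>d. d powr (-\<alpha>) * E d) \<longlongrightarrow> 0) (at_right 0) \<and>
      (\<forall>d\<in>{0<..<1}. \<forall>i\<in>?I. \<exists>j\<in>?I. norm (?p i t) \<le> norm (history_mean \<alpha> d (\<lambda>x. ?p j (t * x))) + E d)"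
    proof (intro exI[of _ "\<lambda>d. M * norm (E d) + \<bar>\<beta>\<bar> * (M * norm (E' d))"] conjI ballI)
      from tendsto_add[OF tendsto_mult_right[OF tendsto_norm[OF E], of M] tendsto_mult_right[OF tendsto_norm[OF E'], of "\<bar>\<beta>\<bar> * M"]]
      show "((\<lambda>d. d powr (-\<alpha>) * (M * norm (E d) + \<bar>\<beta>\<bar> * (M * norm (E' d)))) \<longlongrightarrow> 0) (at_right 0)"
        by (simp add: mult_ac distrib_left)
      fix d :: real and hs assume d: "d \<in> {0<..<1}" and zs: "hs \<in> ?I"
      define z where "z = Gamma (1 - \<alpha>) * (d * t) powr \<alpha>"
      have z: "0 < z" "0 < c * z" and d0: "0 < d" using \<alpha> d t c by (auto simp: Gamma_real_pos z_def)
      have z': "Gamma (1 - \<alpha>) * (d * (r * t)) powr \<alpha> = c * z"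
        using d t r by (simp add: z_def c_def powr_mult mult_ac)
      let ?j = "z # hs"
      have j: "all_pos ?j" using z zs by auto
      note P = bounded_linear_Jprod[OF j] and P' = bounded_linear_Jprod[OF mI[OF j]]
      have a: "Jprod hs (u t) = history_mean \<alpha> d (\<lambda>x. Jprod ?j (u (t * x))) + Jprod ?j (E d)"
        by (rule Jprod_average[OF d0 z(1) _ g(1) eq[OF d, folded z_def]]) (use zs in auto)
      have b: "Jprod (?m hs) (u (r * t)) = history_mean \<alpha> d (\<lambda>x. Jprod (?m ?j) (u (r * t * x))) + Jprod (?m ?j) (E' d)"
        unfolding list.map
        by (rule Jprod_average[OF d0 z(2) _ g(2) eq'[OF d, unfolded z']]) (use zs c in auto)
      have c1: "continuous_on {0..1} (\<lambda>x. Jprod ?j (u (t * x)))" and c2: "continuous_on {0..1} (\<lambda>x. Jprod (?m ?j) (u (r * t * x)))"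
        by (intro bounded_linear.continuous_on[OF P] bounded_linear.continuous_on[OF P'] g)+
      have "history_mean \<alpha> d (\<lambda>x. ?p ?j (t * x)) =
          history_mean \<alpha> d (\<lambda>x. Jprod ?j (u (t * x))) - \<beta> *\<^sub>R history_mean \<alpha> d (\<lambda>x. Jprod (?m ?j) (u (r * t * x)))"
        unfolding history_mean_bounded_linear[OF bounded_linear_scaleR_right d0 c2]
          history_mean_diff[OF d0 c1 continuous_on_scaleR[OF continuous_on_const c2]] by (simp only: mult.assoc)
      then have "?p hs t = history_mean \<alpha> d (\<lambda>x. ?p ?j (t * x)) + (Jprod ?j (E d) - \<beta> *\<^sub>R Jprod (?m ?j) (E' d))"
        unfolding a b by (simp only: scaleR_add_right) simp
      then have "norm (?p hs t) \<le> norm (history_mean \<alpha> d (\<lambda>x. ?p ?j (t * x))) + norm (Jprod ?j (E d) - \<beta> *\<^sub>R Jprod (?m ?j) (E' d))"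
        by (simp only: norm_triangle_ineq)
      moreover have "norm (Jprod ?j (E d) - \<beta> *\<^sub>R Jprod (?m ?j) (E' d)) \<le> M * norm (E d) + \<bar>\<beta>\<bar> * (M * norm (E' d))"
        unfolding norm_scaleR[symmetric] using M(2)[OF mI[OF j], of "E' d"]
        by (intro order_trans[OF norm_triangle_ineq4] add_mono M(2) j) (simp only: norm_scaleR mult_left_mono abs_ge_zero)
      ultimately have "norm (?p hs t) \<le> norm (history_mean \<alpha> d (\<lambda>x. ?p ?j (t * x))) + (M * norm (E d) + \<bar>\<beta>\<bar> * (M * norm (E' d)))" by linarith
      then show "\<exists>j\<in>?I. norm (?p hs t) \<le> norm (history_mean \<alpha> d (\<lambda>x. ?p j (t * x))) + (M * norm (E d) + \<bar>\<beta>\<bar> * (M * norm (E' d)))"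
        using j by (intro bexI[of _ ?j]) (simp_all only: mem_Collect_eq)
    qed
  next
    fix hs s t assume "hs \<in> ?I"
    then have zs: "all_pos hs" by simp
    let ?y = "\<lambda>t. (u t, u (r * t))"
    have eq: "?p hs s - ?p hs t = Jprod hs (u s - u t) - \<beta> *\<^sub>R Jprod (?m hs) (u (r * s) - u (r * t))"
      by (simp add: lin[OF zs] lin[OF mI[OF zs]] scaleR_diff_right)
    have "norm (u s - u t) \<le> norm (?y s - ?y t)" "norm (u (r * s) - u (r * t)) \<le> norm (?y s - ?y t)"
      by (auto intro: order_trans[OF _ norm_fst_le] order_trans[OF _ norm_snd_le])
    then have "norm (Jprod hs (u s - u t)) \<le> M * norm (?y s - ?y t)"
      "norm (Jprod (?m hs) (u (r * s) - u (r * t))) \<le> M * norm (?y s - ?y t)"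
      using M(1) by (blast intro: order_trans[OF M(2)[OF zs] mult_left_mono] order_trans[OF M(2)[OF mI[OF zs]] mult_left_mono])+
    then have "norm (?p hs s - ?p hs t) \<le> M * norm (?y s - ?y t) + \<bar>\<beta>\<bar> * (M * norm (?y s - ?y t))"
      unfolding eq by (intro order_trans[OF norm_triangle_ineq4] add_mono) (simp_all add: mult_left_mono)
    then show "norm (?p hs s - ?p hs t) \<le> (M + \<bar>\<beta>\<bar> * M) * norm (?y s - ?y t)"
      by (simp only: distrib_right mult.assoc)
  next
    fix hs assume "hs \<in> ?I"
    then show "norm (?p hs 0) \<le> B" using B[of hs] u0 by (simp add: c_def)
  qed (use t in auto)
  then show ?thesis by simp
qed

text \<open>
  The comparison with \<open>\<beta> = 0\<close> bounds the solution, the one with \<open>\<beta> = 1\<close> its oscillation; the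
  derivative is a limit of difference quotients.
\<close>

lemma cauchy_solution_estimates:
  assumes \<alpha>: "0 < \<alpha>" "\<alpha> < 1" and T: "0 < T"
  obtains K where "1 \<le> K"
    "\<And>hs f. all_pos hs \<Longrightarrow> norm (Jprod hs f) \<le> K * norm f"
    "\<And>f u t. cauchy_solution D A \<alpha> T f u \<Longrightarrow> t \<in> {0..T} \<Longrightarrow> norm (u t) \<le> K * norm f"
    "\<And>f u s t. cauchy_solution D A \<alpha> T f u \<Longrightarrow> 0 < s \<Longrightarrow> t \<le> 2 * s \<Longrightarrow> s \<le> t \<Longrightarrow> t \<le> T \<Longrightarrow>
       norm (u t - u s) \<le> K * ((t - s) / t) * norm f"
    "\<And>f u t. cauchy_solution D A \<alpha> T f u \<Longrightarrow> t \<in> {0<..<T} \<Longrightarrow> norm (deriv_vec u t) \<le> K / t * norm f"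
proof -
  obtain M where M: "1 \<le> M" "\<And>hs f. all_pos hs \<Longrightarrow> norm (Jprod hs f) \<le> M * norm f"
    using norm_Jprod by blast
  obtain L where L: "0 \<le> L" "\<And>hs f c. all_pos hs \<Longrightarrow> 1/2 \<le> c \<Longrightarrow> c \<le> 1 \<Longrightarrow>
     norm (Jprod hs f - Jprod (map ((*) c) hs) f) \<le> L * (1 - c) * norm f"
    using norm_Jprod_scale by blast
  let ?K = "max M L"
  have M0: "0 \<le> M" using M(1) by simp
  have osc: "norm (u t - u s) \<le> ?K * ((t - s) / t) * norm f"
    if sol: "cauchy_solution D A \<alpha> T f u" and st: "0 < s" "t \<le> 2 * s" "s \<le> t" "t \<le> T" for f u s t
  proof -
    define r where "r = s / t"
    have r: "1/2 \<le> r" "0 < r" "r \<le> 1" "r * t = s" using st by (auto simp: r_def field_simps)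
    have rc: "r \<le> r powr \<alpha>" using powr_mono'[of \<alpha> 1 r] r \<alpha> by simp
    have c: "1/2 \<le> r powr \<alpha>" "r powr \<alpha> \<le> 1" using rc r \<alpha> powr_le1[of \<alpha> r] by auto
    have t: "t \<in> {0..T}" using st by auto
    have "norm (u t - 1 *\<^sub>R u (r * t)) \<le> L * (1 - r powr \<alpha>) * norm f"
      by (rule cauchy_solution_comparison[OF \<alpha> T sol t r(2,3) M0 M(2)]) (use L(2)[OF _ c] in simp_all)
    also have "\<dots> \<le> L * (1 - r) * norm f" using rc L(1) by (intro mult_right_mono mult_left_mono) auto
    finally have "norm (u t - u s) \<le> L * (1 - s / t) * norm f" using r by (simp add: r_def)
    also have "\<dots> \<le> ?K * (1 - s / t) * norm f"
      using st by (intro mult_right_mono) (auto simp: field_simps)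
    finally show ?thesis using st by (simp add: diff_divide_distrib)
  qed
  show ?thesis
  proof (rule that[of ?K])
    show "1 \<le> ?K" using M(1) by simp
    show "norm (Jprod hs f) \<le> ?K * norm f" if "all_pos hs" for hs f
      using M(2)[OF that, of f] mult_right_mono[of M ?K "norm f"] by simp
    show "norm (u t) \<le> ?K * norm f" if "cauchy_solution D A \<alpha> T f u" "t \<in> {0..T}" for f u t
    proof -
      have "norm (u t - 0 *\<^sub>R u (1 * t)) \<le> M * norm f"
        by (rule cauchy_solution_comparison[OF \<alpha> T that zero_less_one order_refl M0 M(2)]) (simp_all add: M(2))
      then show ?thesis using mult_right_mono[of M ?K "norm f"] by simp
    qed
    fix f u t assume sol: "cauchy_solution D A \<alpha> T f u"
    show "norm (deriv_vec u t) \<le> ?K / t * norm f" if t: "t \<in> {0<..<T}"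
    proof -
      have "(u has_vector_derivative deriv_vec u t) (at t)"
        using sol t by (simp add: cauchy_solution_def caputo_exists_def deriv_vec_def vector_derivative_works)
      then have "((\<lambda>s. (1 / (s - t)) *\<^sub>R (u s - u t)) \<longlongrightarrow> deriv_vec u t) (at_left t)"
        using vector_derivative_quotient by (auto intro: filterlim_mono at_le)
      moreover have "\<forall>\<^sub>F s in at_left t. norm ((1 / (s - t)) *\<^sub>R (u s - u t)) \<le> ?K / t * norm f"
      proof (rule eventually_mono[OF eventually_at_left_real[of "t / 2" t]])
        fix s assume s: "s \<in> {t/2<..<t}"
        then have "norm (u t - u s) \<le> ?K * ((t - s) / t) * norm f"
          using t by (intro osc[OF sol]) auto
        then have "norm (u s - u t) / (t - s) \<le> ?K * ((t - s) / t) * norm f / (t - s)"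
          using s by (intro divide_right_mono) (auto simp: norm_minus_commute)
        then show "norm ((1 / (s - t)) *\<^sub>R (u s - u t)) \<le> ?K / t * norm f"
          using s by simp
      qed (use t in auto)
      ultimately show ?thesis by (intro Lim_norm_ubound[of "at_left t"]) auto
    qed
  qed (rule osc)
qed

end

section \<open>Weights of the difference scheme\<close>

abbreviation kernel_gap :: "real \<Rightarrow> real \<Rightarrow> real"
  where "kernel_gap \<alpha> x \<equiv> x powr (-\<alpha>) - (x + 1) powr (-\<alpha>)"

text \<open>
  The average of \<open>(n - x) powr (-\<alpha>)\<close> over the \<open>j\<close>-th interval with respect to the measure with density
  proportional to \<open>x powr (\<alpha> - 1)\<close>.  In these terms the coefficients of the scheme are differences of
  consecutive weights (\<open>coeff_a_sum\<close>).
\<close>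

definition step_weight :: "real \<Rightarrow> nat \<Rightarrow> nat \<Rightarrow> real"
  where "step_weight \<alpha> j n = \<alpha> * coeff_ratio \<alpha> j n"

text \<open>
  The kernel over the whole interval from \<open>0\<close> to \<open>n\<close> is a rescaled Beta density.
\<close>

lemma coeff_kernel_integrable:
  assumes \<alpha>: "0 < \<alpha>" "\<alpha> < 1" and j: "1 \<le> j" "j \<le> n"
  shows "(\<lambda>x. 1 / (x powr (1 - \<alpha>) * (real n - x) powr \<alpha>)) integrable_on {real j - 1..real j}"
proof -
  have n: "0 < real n" using j by simp
  have "(\<lambda>t. t powr (\<alpha> - 1) * (1 - t) powr ((1 - \<alpha>) - 1)) integrable_on {0..1}"
    using \<alpha> by (intro integrable_Beta') auto
  from integrable_stretch_real[OF this, of "1 / real n"]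
  have "(\<lambda>x. (1 / real n * x) powr (\<alpha> - 1) * (1 - 1 / real n * x) powr ((1 - \<alpha>) - 1)) integrable_on {0..real n}"
    using n by (simp add: mult.commute[of _ "real n"])
  from integrable_cmul[OF this, of "1 / real n"]
  have "(\<lambda>x. 1 / real n * ((1 / real n * x) powr (\<alpha> - 1) * (1 - 1 / real n * x) powr ((1 - \<alpha>) - 1))) integrable_on {0..real n}"
    by simp
  moreover have "1 / real n * ((1 / real n * x) powr (\<alpha> - 1) * (1 - 1 / real n * x) powr ((1 - \<alpha>) - 1)) =
      1 / (x powr (1 - \<alpha>) * (real n - x) powr \<alpha>)" if "x \<in> {0..real n}" for x
  proof -
    have "1 - 1 / real n * x = (1 / real n) * (real n - x)" using n by (simp add: field_simps)
    then have "(1 / real n * x) powr (\<alpha> - 1) * (1 - 1 / real n * x) powr ((1 - \<alpha>) - 1) =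
       ((1 / real n) powr (\<alpha> - 1) * (1 / real n) powr (- \<alpha>)) * (x powr (\<alpha> - 1) * (real n - x) powr (- \<alpha>))"
      using that n by (simp only: powr_mult) simp
    also have "(1 / real n) powr (\<alpha> - 1) * (1 / real n) powr (- \<alpha>) = real n"
      using n by (simp only: powr_add[symmetric]) (simp add: powr_minus)
    also have "x powr (\<alpha> - 1) * (real n - x) powr (- \<alpha>) = 1 / (x powr (1 - \<alpha>) * (real n - x) powr \<alpha>)"
      using powr_minus_divide[of x "1 - \<alpha>"] powr_minus_divide[of "real n - x" \<alpha>] by simp
    finally show ?thesis using n by simp
  qed
  ultimately have "(\<lambda>x. 1 / (x powr (1 - \<alpha>) * (real n - x) powr \<alpha>)) integrable_on {0..real n}"
    by (subst integrable_cong[symmetric]) auto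
  then show ?thesis by (rule integrable_subinterval_real) (use j in auto)
qed

lemma has_integral_power_increment:
  assumes \<alpha>: "0 < \<alpha>" and j: "1 \<le> j"
  shows "((\<lambda>x. x powr (\<alpha> - 1)) has_integral (real j powr \<alpha> - (real j - 1) powr \<alpha>) / \<alpha>) {real j - 1..real j}"
proof -
  have "((\<lambda>x. x powr (\<alpha> - 1)) has_integral real j powr \<alpha> / \<alpha> - (real j - 1) powr \<alpha> / \<alpha>) {real j - 1..real j}"
  proof (rule fundamental_theorem_of_calculus_interior)
    show "continuous_on {real j - 1..real j} (\<lambda>x. x powr \<alpha> / \<alpha>)"
      using \<alpha> j by (intro continuous_on_divide continuous_on_powr' continuous_intros) auto
    fix x assume "x \<in> {real j - 1<..<real j}"
    then have "0 < x" using j by auto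
    then show "((\<lambda>x. x powr \<alpha> / \<alpha>) has_vector_derivative x powr (\<alpha> - 1)) (at x)"
      unfolding has_real_derivative_iff_has_vector_derivative[symmetric]
      using \<alpha> by (auto intro!: derivative_eq_intros)
  qed simp
  then show ?thesis by (simp add: diff_divide_distrib)
qed

lemma power_increment_pos:
  assumes "0 < \<alpha>" "1 \<le> j" shows "0 < real j powr \<alpha> - (real j - 1) powr \<alpha>"
  using assms powr_less_mono2[of \<alpha> "real j - 1" "real j"] by auto

lemma step_weight_eq:
  assumes "1 \<le> j"
  shows "step_weight \<alpha> j n = coeff_b \<alpha> j n / ((real j powr \<alpha> - (real j - 1) powr \<alpha>) / \<alpha>)"
  by (simp add: step_weight_def coeff_ratio_def)

text \<open>
  An average of the kernel is at least its value at the left end point.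
\<close>

lemma step_weight_ge:
  assumes \<alpha>: "0 < \<alpha>" "\<alpha> < 1" and j: "1 \<le> j" "j \<le> n"
  shows "(real n - real j + 1) powr (-\<alpha>) \<le> step_weight \<alpha> j n"
proof -
  let ?I = "(real j powr \<alpha> - (real j - 1) powr \<alpha>) / \<alpha>" and ?q = "(real n - real j + 1) powr (-\<alpha>)"
  have I: "0 < ?I" using power_increment_pos[OF \<alpha>(1) j(1)] \<alpha> by simp
  \<comment> \<open>At \<open>x = n\<close> the kernel takes the default value zero of the division, so the point has to
    be excluded from the pointwise comparison.\<close>
  have "((\<lambda>x. if x = real n then 0 else ?q * x powr (\<alpha> - 1)) has_integral ?q * ?I) {real j - 1..real j}"
    by (rule has_integral_spike_finite[OF _ _ has_integral_mult_right[OF has_integral_power_increment[OF \<alpha>(1) j(1)]], of "{real n}"]) auto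
  then have "?q * ?I \<le> coeff_b \<alpha> j n"
    unfolding coeff_b_def
  proof (rule has_integral_le[OF _ integrable_integral[OF coeff_kernel_integrable[OF \<alpha> j]]])
    fix x assume x: "x \<in> {real j - 1..real j}"
    show "(if x = real n then 0 else ?q * x powr (\<alpha> - 1)) \<le> 1 / (x powr (1 - \<alpha>) * (real n - x) powr \<alpha>)"
    proof (cases "x = real n")
      case False
      then have pos: "0 < real n - x" using x j by auto
      have "?q \<le> (real n - x) powr (-\<alpha>)" using pos x \<alpha> by (intro powr_mono2') auto
      then have "?q * x powr (\<alpha> - 1) \<le> (real n - x) powr (-\<alpha>) * x powr (\<alpha> - 1)" by (intro mult_right_mono) auto
      also have "\<dots> = 1 / (x powr (1 - \<alpha>) * (real n - x) powr \<alpha>)"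
        using powr_minus_divide[of x "1 - \<alpha>"] powr_minus_divide[of "real n - x" \<alpha>] by simp
      finally show ?thesis using False by simp
    qed simp
  qed
  then show ?thesis unfolding step_weight_eq[OF j(1)] using I by (simp only: pos_le_divide_eq)
qed

lemma step_weight_le:
  assumes \<alpha>: "0 < \<alpha>" "\<alpha> < 1" and j: "1 \<le> j" "j < n"
  shows "step_weight \<alpha> j n \<le> (real n - real j) powr (-\<alpha>)"
proof -
  let ?I = "(real j powr \<alpha> - (real j - 1) powr \<alpha>) / \<alpha>" and ?q = "(real n - real j) powr (-\<alpha>)"
  have I: "0 < ?I" using power_increment_pos[OF \<alpha>(1) j(1)] \<alpha> by simp
  have "coeff_b \<alpha> j n \<le> ?q * ?I"
    unfolding coeff_b_def
  proof (rule has_integral_le[OF integrable_integral[OF coeff_kernel_integrable[OF \<alpha> j(1) less_imp_le[OF j(2)]]]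
        has_integral_mult_right[OF has_integral_power_increment[OF \<alpha>(1) j(1)]]])
    fix x assume x: "x \<in> {real j - 1..real j}"
    have "(real n - x) powr (-\<alpha>) \<le> ?q" using x \<alpha> j by (intro powr_mono2') auto
    then have "(real n - x) powr (-\<alpha>) * x powr (\<alpha> - 1) \<le> ?q * x powr (\<alpha> - 1)" by (intro mult_right_mono) auto
    then show "1 / (x powr (1 - \<alpha>) * (real n - x) powr \<alpha>) \<le> ?q * x powr (\<alpha> - 1)"
      using powr_minus_divide[of x "1 - \<alpha>"] powr_minus_divide[of "real n - x" \<alpha>] by simp
  qed
  then show ?thesis unfolding step_weight_eq[OF j(1)] using I by (simp only: pos_divide_le_eq)
qed

lemma kernel_has_integral:
  fixes \<alpha> :: real
  assumes \<alpha>: "\<alpha> < 1" and a: "a \<le> t"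
  shows "((\<lambda>s. (t - s) powr (-\<alpha>)) has_integral (t - a) powr (1 - \<alpha>) / (1 - \<alpha>)) {a..t}"
proof -
  have "((\<lambda>s. (t - s) powr (-\<alpha>)) has_integral
     (- ((t - t) powr (1 - \<alpha>) / (1 - \<alpha>)) - - ((t - a) powr (1 - \<alpha>) / (1 - \<alpha>)))) {a..t}"
  proof (rule fundamental_theorem_of_calculus_interior[OF a])
    show "continuous_on {a..t} (\<lambda>s. - ((t - s) powr (1 - \<alpha>) / (1 - \<alpha>)))"
      using \<alpha> by (intro continuous_on_minus continuous_on_divide continuous_on_powr' continuous_intros) auto
    fix s assume "s \<in> {a<..<t}"
    then show "((\<lambda>s. - ((t - s) powr (1 - \<alpha>) / (1 - \<alpha>))) has_vector_derivative (t - s) powr (-\<alpha>)) (at s)"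
      unfolding has_real_derivative_iff_has_vector_derivative[symmetric]
      using \<alpha> by (auto intro!: derivative_eq_intros)
  qed
  then show ?thesis using \<alpha> by simp
qed

lemma step_weight_last_le:
  assumes \<alpha>: "0 < \<alpha>" "\<alpha> < 1" and n: "2 \<le> n"
  shows "step_weight \<alpha> n n \<le> 2 / (1 - \<alpha>)"
proof -
  let ?I = "(real n powr \<alpha> - (real n - 1) powr \<alpha>) / \<alpha>" and ?m = "real n - 1"
  have n1: "1 \<le> n" "0 < ?m" using n by auto
  have I: "0 < ?I" using power_increment_pos[OF \<alpha>(1) n1(1)] \<alpha> by simp
  have K: "((\<lambda>x. (real n - x) powr (-\<alpha>)) has_integral 1 / (1 - \<alpha>)) {?m..real n}"
    using kernel_has_integral[OF \<alpha>(2), of ?m "real n"] by simp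
  have up: "coeff_b \<alpha> n n \<le> ?m powr (\<alpha> - 1) * (1 / (1 - \<alpha>))"
    unfolding coeff_b_def
  proof (rule has_integral_le[OF integrable_integral[OF coeff_kernel_integrable[OF \<alpha> n1(1) order_refl]] has_integral_mult_right[OF K]])
    fix x assume x: "x \<in> {?m..real n}"
    have "x powr (\<alpha> - 1) \<le> ?m powr (\<alpha> - 1)" using x \<alpha> n1 by (intro powr_mono2') auto
    then have "x powr (\<alpha> - 1) * (real n - x) powr (-\<alpha>) \<le> ?m powr (\<alpha> - 1) * (real n - x) powr (-\<alpha>)" by (intro mult_right_mono) auto
    then show "1 / (x powr (1 - \<alpha>) * (real n - x) powr \<alpha>) \<le> ?m powr (\<alpha> - 1) * (real n - x) powr (-\<alpha>)"
      using powr_minus_divide[of x "1 - \<alpha>"] powr_minus_divide[of "real n - x" \<alpha>] by simp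
  qed
  have low: "real n powr (\<alpha> - 1) \<le> ?I"
  proof -
    have "((\<lambda>x. real n powr (\<alpha> - 1)) has_integral real n powr (\<alpha> - 1)) {?m..real n}"
      using has_integral_const_real[of "real n powr (\<alpha> - 1)" ?m "real n"] by simp
    then show ?thesis
    proof (rule has_integral_le[OF _ has_integral_power_increment[OF \<alpha>(1) n1(1)]])
      fix x assume "x \<in> {?m..real n}"
      then show "real n powr (\<alpha> - 1) \<le> x powr (\<alpha> - 1)" using \<alpha> n1 by (intro powr_mono2') auto
    qed
  qed
  have n0: "0 < real n powr (\<alpha> - 1)" using n by simp
  have "step_weight \<alpha> n n \<le> (?m powr (\<alpha> - 1) * (1 / (1 - \<alpha>))) / (real n powr (\<alpha> - 1))"
    unfolding step_weight_eq[OF n1(1)] using \<alpha> by (intro frac_le up low n0) auto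
  also have "\<dots> = (real n / ?m) powr (1 - \<alpha>) / (1 - \<alpha>)"
    using n1 n powr_minus_divide[of ?m "1 - \<alpha>"] powr_minus_divide[of "real n" "1 - \<alpha>"]
    by (simp add: powr_divide)
  also have "\<dots> \<le> 2 / (1 - \<alpha>)"
  proof (rule divide_right_mono)
    have "(real n / ?m) powr (1 - \<alpha>) \<le> 2 powr (1 - \<alpha>)" using n \<alpha> by (intro powr_mono2) (auto simp: field_simps)
    also have "\<dots> \<le> 2 powr 1" using \<alpha> by (intro powr_mono) auto
    finally show "(real n / ?m) powr (1 - \<alpha>) \<le> 2" by simp
  qed (use \<alpha> in auto)
  finally show ?thesis .
qed

lemma step_weight_last_ge:
  assumes "0 < \<alpha>" "\<alpha> < 1" "1 \<le> n" shows "1 \<le> step_weight \<alpha> n n"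
  using step_weight_ge[OF assms(1,2,3) order_refl] by simp

text \<open>
  The kernel increases towards the present, so its averages over consecutive intervals do.  This is the
  sign condition behind the maximum principle of the scheme.
\<close>

lemma step_weight_mono:
  assumes \<alpha>: "0 < \<alpha>" "\<alpha> < 1" and j: "1 \<le> j" "j < n"
  shows "step_weight \<alpha> j n \<le> step_weight \<alpha> (Suc j) n"
  using step_weight_le[OF \<alpha> j] step_weight_ge[OF \<alpha>, of "Suc j" n] j by simp

lemma sum_increments_by_parts:
  fixes v :: "nat \<Rightarrow> 'x::real_vector"
  assumes "1 \<le> n"
  shows "(\<Sum>j=1..n. q j *\<^sub>R (v j - v (j - 1))) = q n *\<^sub>R v n - (q 1 *\<^sub>R v 0 + (\<Sum>j=1..<n. (q (Suc j) - q j) *\<^sub>R v j))"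
  using assms by (induction n rule: dec_induct) (simp_all add: algebra_simps)

lemma coeff_a_sum:
  fixes v :: "nat \<Rightarrow> 'x::real_vector"
  assumes n: "1 \<le> n"
  shows "(\<Sum>j=0..n. coeff_a \<alpha> j n *\<^sub>R v j) =
    (1 / Gamma (1 - \<alpha>)) *\<^sub>R (\<Sum>j=1..n. step_weight \<alpha> j n *\<^sub>R (v j - v (j - 1)))"
proof -
  let ?q = "\<lambda>j. step_weight \<alpha> j n" and ?g = "1 / Gamma (1 - \<alpha>)"
  have set: "{0..n} = insert 0 (insert n {1..<n})" using n by auto
  have "(\<Sum>j=0..n. coeff_a \<alpha> j n *\<^sub>R v j) =
     coeff_a \<alpha> 0 n *\<^sub>R v 0 + (coeff_a \<alpha> n n *\<^sub>R v n + (\<Sum>j=1..<n. coeff_a \<alpha> j n *\<^sub>R v j))"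
    unfolding set using n by simp
  also have "coeff_a \<alpha> 0 n = - (?g * ?q 1)"
    by (simp add: coeff_a_def step_weight_def coeff_ratio_def)
  also have "coeff_a \<alpha> n n = ?g * ?q n"
    using n by (simp add: coeff_a_def step_weight_def)
  also have "(\<Sum>j=1..<n. coeff_a \<alpha> j n *\<^sub>R v j) = (\<Sum>j=1..<n. - ?g *\<^sub>R ((?q (Suc j) - ?q j) *\<^sub>R v j))"
    by (rule sum.cong) (auto simp: coeff_a_def step_weight_def algebra_simps)
  also have "\<dots> = - ?g *\<^sub>R (\<Sum>j=1..<n. (?q (Suc j) - ?q j) *\<^sub>R v j)"
    by (rule scaleR_sum_right[symmetric])
  finally show ?thesis
    unfolding sum_increments_by_parts[OF n, of ?q v] by (simp add: scaleR_diff_right scaleR_add_right)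
qed

text \<open>
  For exponents up to one the power of \<open>k / (k + 1)\<close> is at least \<open>k / (k + 1)\<close> itself.
\<close>

lemma power_gap_le:
  assumes "0 \<le> \<alpha>" "\<alpha> \<le> 1" "1 \<le> (k::real)"
  shows "k powr (-\<alpha>) - (k + 1) powr (-\<alpha>) \<le> k powr (-\<alpha>) / (k + 1)"
proof -
  have "k / (k + 1) = (k / (k + 1)) powr 1" using assms by simp
  also have "\<dots> \<le> (k / (k + 1)) powr \<alpha>" using assms by (intro powr_mono') auto
  finally have "k powr (-\<alpha>) * (k / (k + 1)) \<le> k powr (-\<alpha>) * (k / (k + 1)) powr \<alpha>" by (intro mult_left_mono) auto
  also have "\<dots> = (k + 1) powr (-\<alpha>)" using assms by (simp add: powr_divide powr_minus field_simps)
  finally have "k powr (-\<alpha>) * (1 - 1 / (k + 1)) \<le> (k + 1) powr (-\<alpha>)"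
    using assms by (simp add: diff_divide_eq_iff)
  then show ?thesis by (simp add: right_diff_distrib)
qed

lemma power_gap_nonneg: "0 \<le> \<alpha> \<Longrightarrow> 0 < k \<Longrightarrow> 0 \<le> k powr (-\<alpha>) - (k + 1) powr (-\<alpha> :: real)"
  using powr_mono2'[of "-\<alpha>" k "k + 1"] by simp

text \<open>
  With \<open>k = n - j\<close> the gap is at most \<open>k powr (-1 - \<alpha>)\<close>.  Writing \<open>n = j + k\<close> distributes
  \<open>n / (j * k powr (1 + \<alpha>))\<close> over terms of two convergent series.
\<close>

lemma sum_gap_over_index:
  assumes \<alpha>: "0 < \<alpha>" "\<alpha> < 1"
  obtains Z where "0 \<le> Z"
    "\<And>n. 1 \<le> n \<Longrightarrow> (\<Sum>j=1..<n. kernel_gap \<alpha> (real n - real j) / real j) \<le> Z / real n"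
proof -
  let ?f = "\<lambda>k::nat. real k powr (-1-\<alpha>)"
  have sm: "summable ?f" using \<alpha> by (simp add: summable_real_powr_iff)
  define S where "S = suminf ?f"
  have S: "sum ?f {1..<n} \<le> S" for n unfolding S_def by (rule sum_le_suminf[OF sm]) auto
  have S0: "0 \<le> S" using S[of 0] by simp
  have "(\<Sum>j=1..<n. kernel_gap \<alpha> (real n - real j) / real j) \<le> 3 * S / real n" for n
  proof -
    have term_le: "kernel_gap \<alpha> (real n - real j) / real j \<le> (2 * ?f (n - j) + ?f j) / real n"
      if j: "j \<in> {1..<n}" for j
    proof -
      define k i where "k = real (n - j)" and "i = real j"
      have k: "1 \<le> k" "1 \<le> i" and n: "real n - i = k" "real n = k + i"
        using j by (auto simp: k_def i_def of_nat_diff)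
      define F where "F = k powr (-1-\<alpha>)"
      have "k powr (-\<alpha>) - (k + 1) powr (-\<alpha>) \<le> k powr (-\<alpha>) / (k + 1)"
        using \<alpha> k by (intro power_gap_le) auto
      also have "\<dots> \<le> k powr (-\<alpha>) / k" using k by (intro divide_left_mono) auto
      also have "\<dots> = F" using k powr_add[of k "-1" "-\<alpha>"] by (simp add: F_def powr_neg_one)
      finally have gap: "k powr (-\<alpha>) - (k + 1) powr (-\<alpha>) \<le> F" .
      \<comment> \<open>The left hand side is \<open>1 / (i * k powr \<alpha>)\<close>, which increases if the larger one of \<open>i\<close> and \<open>k\<close>
        is replaced by the smaller one.\<close>
      have mix: "k * F / i \<le> F + i powr (-1-\<alpha>)"
      proof (cases "k \<le> i")
        case True
        then have "k * F \<le> i * F" by (intro mult_right_mono) (auto simp: F_def)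
        then have "k * F / i \<le> F" using k by (simp add: pos_divide_le_eq mult.commute)
        then show ?thesis by (simp add: add_increasing2)
      next
        case False
        have "k * F = k powr (-\<alpha>)" using k powr_add[of k 1 "-1-\<alpha>"] by (simp add: F_def)
        also have "\<dots> \<le> i powr (-\<alpha>)" using False k \<alpha> by (intro powr_mono2') auto
        also have "\<dots> = i powr (-1-\<alpha>) * i" using k powr_add[of i 1 "-1-\<alpha>"] by simp
        finally have "k * F / i \<le> i powr (-1-\<alpha>)" using k by (simp add: pos_divide_le_eq)
        then show ?thesis by (simp add: add_increasing F_def)
      qed
      have "(k + i) * (F / i) = k * F / i + F"
        using k(2) by (simp add: distrib_right add_divide_distrib)
      also have "\<dots> \<le> 2 * F + i powr (-1-\<alpha>)" using mix by simp
      finally have "F / i \<le> (2 * F + i powr (-1-\<alpha>)) / (k + i)"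
        using k by (simp add: pos_le_divide_eq mult.commute)
      moreover have "(k powr (-\<alpha>) - (k + 1) powr (-\<alpha>)) / i \<le> F / i"
        using gap k by (intro divide_right_mono) auto
      ultimately have "(k powr (-\<alpha>) - (k + 1) powr (-\<alpha>)) / i \<le> (2 * F + i powr (-1-\<alpha>)) / (k + i)"
        by linarith
      then show ?thesis
        unfolding F_def n(1)[unfolded i_def] unfolding n(2) unfolding k_def[symmetric] i_def[symmetric] .
    qed
    have "(\<Sum>j=1..<n. kernel_gap \<alpha> (real n - real j) / real j) \<le> (\<Sum>j=1..<n. (2 * ?f (n - j) + ?f j) / real n)"
      by (rule sum_mono[OF term_le])
    also have "\<dots> = (2 * (\<Sum>j=1..<n. ?f (n - j)) + (\<Sum>j=1..<n. ?f j)) / real n"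
      by (simp add: sum.distrib sum_distrib_left flip: sum_divide_distrib)
    also have "(\<Sum>j=1..<n. ?f (n - j)) = (\<Sum>j=1..<n. ?f j)"
      by (rule sum.reindex_bij_witness[of _ "\<lambda>j. n - j" "\<lambda>j. n - j"]) auto
    also have "(2 * (\<Sum>j=1..<n. ?f j) + (\<Sum>j=1..<n. ?f j)) / real n \<le> 3 * S / real n"
      using S[of n] by (intro divide_right_mono) auto
    finally show ?thesis .
  qed
  then show ?thesis using that[of "3 * S"] S0 by auto
qed

section \<open>A barrier for the scheme\<close>

text \<open>
  The value zero at the initial time produces the jump without which a decreasing sequence could not be
  a supersolution.
\<close>

definition barrier :: "real \<Rightarrow> nat \<Rightarrow> real"
  where "barrier s j = (if j = 0 then 0 else real j powr (-s))"

lemma barrier_simps: "barrier s 0 = 0" "barrier s 1 = 1" "1 \<le> j \<Longrightarrow> barrier s j = real j powr (-s)"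
  by (auto simp: barrier_def)

lemma barrier_drop:
  assumes s: "0 < s" "s \<le> 1" and j: "2 \<le> j"
  shows "0 \<le> barrier s (j - 1) - barrier s j" "barrier s (j - 1) - barrier s j \<le> 1 / real j"
proof -
  define k where "k = real j - 1"
  have k: "1 \<le> k" and jk: "real j = k + 1" using j by (auto simp: k_def)
  have b: "barrier s (j - 1) = k powr (-s)" "barrier s j = (k + 1) powr (-s)"
    using j by (auto simp: barrier_def k_def of_nat_diff)
  show "0 \<le> barrier s (j - 1) - barrier s j" unfolding b using power_gap_nonneg[of s k] s k by simp
  have "barrier s (j - 1) - barrier s j \<le> k powr (-s) / (k + 1)"
    unfolding b using s k by (intro power_gap_le) auto
  also have "\<dots> \<le> 1 / (k + 1)"
    using k s powr_mono2'[of "-s" 1 k] by (intro divide_right_mono) auto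
  finally show "barrier s (j - 1) - barrier s j \<le> 1 / real j" unfolding jk .
qed

text \<open>
  The left hand side is at most the integral of \<open>s * (n - x) powr (-\<alpha>) * x powr (-s-1)\<close> from \<open>1\<close> to \<open>n\<close>.  The
  function \<open>\<Psi>\<close> in the proof decreases at least as fast as this integrand and vanishes at \<open>n\<close>, so its
  value at \<open>1\<close> is an upper bound.  The term with \<open>\<eta>\<close> is the gain that makes the barrier a strict
  supersolution; it is available exactly because \<open>s < 1 - \<alpha>\<close>.
\<close>

lemma barrier_potential:
  assumes \<alpha>: "0 < \<alpha>" "\<alpha> < 1" and s: "0 < s" "s < 1 - \<alpha>" and n: "2 \<le> n"
  defines "\<eta> \<equiv> (1 - \<alpha> - s) / (1 - \<alpha>)"
  shows "(\<Sum>j=2..<n. (real n - real j + 1) powr (-\<alpha>) * (barrier s (j - 1) - barrier s j))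
     \<le> real n powr (-\<alpha>) - \<eta> * real n powr (-\<alpha>-s)"
proof -
  define N where "N = real n"
  have N: "2 \<le> N" using n by (simp add: N_def)
  have \<eta>: "0 < \<eta>" "\<eta> \<le> 1" "\<eta> * (1 - \<alpha>) = 1 - \<alpha> - s" using \<alpha> s by (auto simp: \<eta>_def)
  define e where "e = 1 / N"
  have e: "0 \<le> e" "e * N = 1" using N by (auto simp: e_def)
  define \<Psi> where "\<Psi> x = e * (N - x) powr (1 - \<alpha>) * (x powr (-s) - \<eta> * N powr (-s))" for x
  have deriv: "(\<Psi> has_real_derivative e * (- ((1 - \<alpha>) * (N - x) powr (-\<alpha>)) * (x powr (-s) - \<eta> * N powr (-s))
     + (N - x) powr (1 - \<alpha>) * (- s * x powr (-s-1)))) (at x)" if "0 < x" "x < N" for x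
    unfolding \<Psi>_def using that by (auto intro!: derivative_eq_intros simp: algebra_simps)
  have slope: "e * (- ((1 - \<alpha>) * (N - x) powr (-\<alpha>)) * (x powr (-s) - \<eta> * N powr (-s))
     + (N - x) powr (1 - \<alpha>) * (- s * x powr (-s-1))) \<le> - s * (N - x) powr (-\<alpha>) * x powr (-s-1)" if x: "0 < x" "x < N" for x
  proof -
    have p: "(N - x) powr (1 - \<alpha>) = (N - x) * (N - x) powr (-\<alpha>)" "x powr (-s) = x * x powr (-s-1)"
      using x powr_add[of "N - x" 1 "-\<alpha>"] powr_add[of x 1 "-s-1"] by auto
    have key: "\<eta> * (1 - \<alpha>) * N powr (-s) \<le> (1 - \<alpha> - s) * x powr (-s)"
      unfolding \<eta>(3) using x s by (intro mult_left_mono powr_mono2') auto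
    have "- ((1 - \<alpha>) * (N - x) powr (-\<alpha>)) * (x powr (-s) - \<eta> * N powr (-s)) + (N - x) powr (1 - \<alpha>) * (- s * x powr (-s-1))
      = (N - x) powr (-\<alpha>) * (\<eta> * (1 - \<alpha>) * N powr (-s) - (1 - \<alpha>) * x powr (-s) - s * (N - x) * x powr (-s-1))"
      unfolding p(1) by (simp add: algebra_simps)
    also have "\<dots> \<le> (N - x) powr (-\<alpha>) * ((1 - \<alpha> - s) * x powr (-s) - (1 - \<alpha>) * x powr (-s) - s * (N - x) * x powr (-s-1))"
      using key by (intro mult_left_mono) auto
    also have "(1 - \<alpha> - s) * x powr (-s) - (1 - \<alpha>) * x powr (-s) - s * (N - x) * x powr (-s-1) = - s * N * x powr (-s-1)"
      unfolding p(2) by (simp add: algebra_simps)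
    finally have "e * (- ((1 - \<alpha>) * (N - x) powr (-\<alpha>)) * (x powr (-s) - \<eta> * N powr (-s)) + (N - x) powr (1 - \<alpha>) * (- s * x powr (-s-1)))
      \<le> e * ((N - x) powr (-\<alpha>) * (- s * N * x powr (-s-1)))" by (rule mult_left_mono) (rule e(1))
    also have "\<dots> = - s * (N - x) powr (-\<alpha>) * x powr (-s-1)" using e(2) by (simp add: mult_ac)
    finally show ?thesis .
  qed
  have step: "(N - real j + 1) powr (-\<alpha>) * (barrier s (j - 1) - barrier s j) \<le> \<Psi> (real j - 1) - \<Psi> (real j)"
    if j: "j \<in> {2..<n}" for j
  proof -
    let ?K = "(N - real j + 1) powr (-\<alpha>)"
    have jN: "1 \<le> real j - 1" "real j < N" using j by (auto simp: N_def)
    have "\<Psi> (real j) - ?K * (real j powr (-s)) \<le> \<Psi> (real j - 1) - ?K * ((real j - 1) powr (-s))"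
    proof (rule DERIV_nonpos_imp_nonincreasing[of "real j - 1" "real j" "\<lambda>x. \<Psi> x - ?K * (x powr (-s))"])
      fix x assume x: "real j - 1 \<le> x" "x \<le> real j"
      then have x': "0 < x" "x < N" using jN by auto
      have "((\<lambda>x. \<Psi> x - ?K * (x powr (-s))) has_real_derivative
          e * (- ((1 - \<alpha>) * (N - x) powr (-\<alpha>)) * (x powr (-s) - \<eta> * N powr (-s))
          + (N - x) powr (1 - \<alpha>) * (- s * x powr (-s-1))) - ?K * (- s * x powr (-s-1))) (at x)"
        using x' by (auto intro!: derivative_eq_intros deriv)
      moreover have "e * (- ((1 - \<alpha>) * (N - x) powr (-\<alpha>)) * (x powr (-s) - \<eta> * N powr (-s))
          + (N - x) powr (1 - \<alpha>) * (- s * x powr (-s-1))) - ?K * (- s * x powr (-s-1)) \<le> 0"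
      proof -
        have "?K \<le> (N - x) powr (-\<alpha>)" using x x' \<alpha> by (intro powr_mono2') auto
        then have "?K * (s * x powr (-s-1)) \<le> (N - x) powr (-\<alpha>) * (s * x powr (-s-1))"
          using s by (intro mult_right_mono) auto
        then show ?thesis using slope[OF x'] by (simp add: mult_ac)
      qed
      ultimately show "\<exists>y. ((\<lambda>x. \<Psi> x - ?K * (x powr (-s))) has_real_derivative y) (at x) \<and> y \<le> 0" by blast
    qed simp
    moreover have "barrier s (j - 1) = (real j - 1) powr (-s)" "barrier s j = real j powr (-s)"
      using j by (auto simp: barrier_def)
    ultimately show ?thesis by (simp add: right_diff_distrib)
  qed
  have "(\<Sum>j=2..<n. (N - real j + 1) powr (-\<alpha>) * (barrier s (j - 1) - barrier s j)) \<le> (\<Sum>j=2..<n. \<Psi> (real j - 1) - \<Psi> (real j))"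
    by (rule sum_mono[OF step])
  also have "\<dots> = \<Psi> 1 - \<Psi> (N - 1)"
    unfolding N_def using n by (induction n rule: dec_induct) simp_all
  also have "\<dots> \<le> \<Psi> 1"
  proof -
    have "\<eta> * N powr (-s) \<le> 1 * N powr (-s)" using \<eta> by (intro mult_right_mono) auto
    also have "\<dots> \<le> (N - 1) powr (-s)" using N s by (simp, intro powr_mono2') auto
    finally show ?thesis unfolding \<Psi>_def using e(1) by (auto intro!: mult_nonneg_nonneg)
  qed
  also have "\<Psi> 1 \<le> N powr (-\<alpha>) * (1 - \<eta> * N powr (-s))"
  proof -
    have "N powr (-s) \<le> 1" using N s powr_mono2'[of "-s" 1 N] by simp
    then have "\<eta> * N powr (-s) \<le> 1 * 1" using \<eta> by (intro mult_mono) auto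
    moreover have "e * (N - 1) powr (1 - \<alpha>) \<le> e * N powr (1 - \<alpha>)"
      using N \<alpha> e(1) by (intro mult_left_mono powr_mono2) auto
    moreover have "e * N powr (1 - \<alpha>) = N powr (-\<alpha>)"
      using N powr_add[of N 1 "-\<alpha>"] by (simp add: e_def)
    ultimately show ?thesis unfolding \<Psi>_def by (simp add: mult_right_mono)
  qed
  also have "\<dots> = N powr (-\<alpha>) - \<eta> * N powr (-\<alpha>-s)"
    using N powr_add[of N "-\<alpha>" "-s"] by (simp add: right_diff_distrib)
  finally show ?thesis unfolding N_def .
qed

text \<open>
  The jump at the initial time contributes at least \<open>n powr (-\<alpha>)\<close>, and by \<open>barrier_potential\<close> the later
  decrease takes away less than that by a multiple of \<open>n powr (-\<alpha>-s)\<close>.  The errors from replacing the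
  weights by end point values of the kernel are of order \<open>1 / n\<close>, which is smaller as \<open>\<alpha> + s < 1\<close>; this
  is why the estimate holds from some index on only.
\<close>

lemma barrier_supersolution:
  assumes \<alpha>: "0 < \<alpha>" "\<alpha> < 1" and s: "0 < s" "s < 1 - \<alpha>"
  obtains c n0 where "0 < c" "2 \<le> n0"
    "\<And>n. n0 \<le> n \<Longrightarrow> c / real n \<le> (\<Sum>j=1..n. step_weight \<alpha> j n * (barrier s j - barrier s (j - 1)))"
proof -
  obtain Z where Z: "0 \<le> Z" "\<And>n. 1 \<le> n \<Longrightarrow> (\<Sum>j=1..<n. kernel_gap \<alpha> (real n - real j) / real j) \<le> Z / real n"
    using sum_gap_over_index[OF \<alpha>] by blast
  define \<eta> where "\<eta> = (1 - \<alpha> - s) / (1 - \<alpha>)"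
  have \<eta>: "0 < \<eta>" using \<alpha> s by (simp add: \<eta>_def)
  let ?B = "Z + 2 / (1 - \<alpha>)"
  have B: "0 \<le> ?B" using Z \<alpha> by simp
  have lower: "\<eta> * real n powr (-\<alpha>-s) - ?B / real n \<le> (\<Sum>j=1..n. step_weight \<alpha> j n * (barrier s j - barrier s (j - 1)))"
    if n: "2 \<le> n" for n
  proof -
    let ?r = "\<lambda>j. step_weight \<alpha> j n" and ?d = "\<lambda>j. barrier s (j - 1) - barrier s j"
    let ?lo = "\<lambda>j. (real n - real j + 1) powr (-\<alpha>)"
    have set: "{1..n} = insert 1 (insert n {2..<n})" using n by auto
    have "(\<Sum>j=1..n. ?r j * (barrier s j - barrier s (j - 1))) = ?r 1 - ?r n * ?d n - (\<Sum>j=2..<n. ?r j * ?d j)"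
      unfolding set using n by (simp add: barrier_simps(1) barrier_simps(2)[simplified] right_diff_distrib sum_subtractf)
    moreover have "real n powr (-\<alpha>) \<le> ?r 1" using step_weight_ge[OF \<alpha>, of 1 n] n by simp
    moreover have "?r n * ?d n \<le> (2 / (1 - \<alpha>)) * (1 / real n)"
      using step_weight_last_le[OF \<alpha> n] barrier_drop[of s n] s \<alpha> n by (intro mult_mono) auto
    moreover have "(\<Sum>j=2..<n. ?r j * ?d j) \<le> (real n powr (-\<alpha>) - \<eta> * real n powr (-\<alpha>-s)) + Z / real n"
    proof -
      have "(\<Sum>j=2..<n. ?r j * ?d j) \<le> (\<Sum>j=2..<n. ?lo j * ?d j + ((real n - real j) powr (-\<alpha>) - ?lo j) / real j)"
      proof (rule sum_mono)
        fix j assume j: "j \<in> {2..<n}"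
        have d: "0 \<le> ?d j" "?d j \<le> 1 / real j" using barrier_drop[of s j] s \<alpha> j by auto
        have "?r j * ?d j \<le> (real n - real j) powr (-\<alpha>) * ?d j"
          using step_weight_le[OF \<alpha>, of j n] j d by (intro mult_right_mono) auto
        also have "\<dots> = ?lo j * ?d j + ((real n - real j) powr (-\<alpha>) - ?lo j) * ?d j" by (simp add: algebra_simps)
        also have "((real n - real j) powr (-\<alpha>) - ?lo j) * ?d j \<le> ((real n - real j) powr (-\<alpha>) - ?lo j) * (1 / real j)"
          using power_gap_nonneg[of \<alpha> "real n - real j"] \<alpha> j by (intro mult_left_mono d) auto
        finally show "?r j * ?d j \<le> ?lo j * ?d j + ((real n - real j) powr (-\<alpha>) - ?lo j) / real j" by simp
      qed
      also have "\<dots> = (\<Sum>j=2..<n. ?lo j * ?d j) + (\<Sum>j=2..<n. ((real n - real j) powr (-\<alpha>) - ?lo j) / real j)"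
        by (rule sum.distrib)
      also have "(\<Sum>j=2..<n. ((real n - real j) powr (-\<alpha>) - ?lo j) / real j) \<le> (\<Sum>j=1..<n. ((real n - real j) powr (-\<alpha>) - ?lo j) / real j)"
        using \<alpha> power_gap_nonneg[of \<alpha>] by (intro sum_mono2) (auto intro!: divide_nonneg_nonneg)
      also have "\<dots> \<le> Z / real n" using Z(2)[of n] n by simp
      finally show ?thesis using barrier_potential[OF \<alpha> s n] unfolding \<eta>_def by linarith
    qed
    moreover have "?B / real n = Z / real n + (2 / (1 - \<alpha>)) * (1 / real n)" by (simp add: add_divide_distrib)
    ultimately show ?thesis by linarith
  qed
  have "filterlim (\<lambda>n::nat. real n powr (1 - \<alpha> - s)) at_top sequentially"
    using s by (intro filterlim_compose[OF real_powr_at_top filterlim_real_sequentially]) auto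
  then have "\<forall>\<^sub>F n in sequentially. (?B + 1) / \<eta> \<le> real n powr (1 - \<alpha> - s)"
    by (simp add: filterlim_at_top)
  then obtain m where m: "\<And>n. m \<le> n \<Longrightarrow> (?B + 1) / \<eta> \<le> real n powr (1 - \<alpha> - s)"
    by (auto simp: eventually_sequentially)
  show ?thesis
  proof (rule that[of 1 "max m 2"])
    fix n assume n: "max m 2 \<le> n"
    then have "?B + 1 \<le> \<eta> * real n powr (1 - \<alpha> - s)" using m[of n] \<eta> by (simp add: pos_divide_le_eq mult.commute)
    then have "(?B + 1) / real n \<le> \<eta> * real n powr (1 - \<alpha> - s) / real n" by (intro divide_right_mono) auto
    also have "1 - \<alpha> - s = 1 + (-\<alpha>-s)" by simp
    also have "\<eta> * real n powr (1 + (-\<alpha>-s)) / real n = \<eta> * real n powr (-\<alpha>-s)"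
      using n by (simp only: powr_add) simp
    finally have "(?B + 1) / real n \<le> \<eta> * real n powr (-\<alpha>-s)" .
    then show "1 / real n \<le> (\<Sum>j=1..n. step_weight \<alpha> j n * (barrier s j - barrier s (j - 1)))"
      using lower[of n] n by (simp add: add_divide_distrib)
  qed auto
qed

section \<open>Truncation error\<close>

text \<open>
  After an integration by parts only the increments of \<open>u\<close> enter, multiplied by the total variation
  of the monotone kernel.  In this form the estimate also covers the first interval, where the
  derivative of \<open>u\<close> may grow like \<open>1 / s\<close>.
\<close>

lemma kernel_quadrature_error:
  fixes u :: "real \<Rightarrow> 'x::banach"
  assumes \<alpha>: "0 < \<alpha>" and ab: "a \<le> b" "b < t"
    and cont: "continuous_on {a..b} u"
    and deriv: "\<And>s. s \<in> {a<..<b} \<Longrightarrow> (u has_vector_derivative u' s) (at s)"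
    and int: "((\<lambda>s. (t - s) powr (-\<alpha>) *\<^sub>R u' s) has_integral I) {a..b}"
    and osc: "\<And>s. s \<in> {a..b} \<Longrightarrow> norm (u s - u a) \<le> \<omega>"
    and r: "(t - a) powr (-\<alpha>) \<le> r" "r \<le> (t - b) powr (-\<alpha>)"
  shows "norm (r *\<^sub>R (u b - u a) - I) \<le> 2 * \<omega> * ((t - b) powr (-\<alpha>) - (t - a) powr (-\<alpha>))"
proof -
  let ?k = "\<lambda>s. (t - s) powr (-\<alpha>)" and ?k' = "\<lambda>s. \<alpha> * (t - s) powr (-\<alpha>-1)" and ?w = "\<lambda>s. u s - u a"
  have \<omega>: "0 \<le> \<omega>" using osc[of a] ab by simp
  have dk: "(?k has_vector_derivative ?k' s) (at s within S)" if "s < t" for s S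
    unfolding has_real_derivative_iff_has_vector_derivative[symmetric]
    using that by (auto intro!: derivative_eq_intros)
  have parts: "((\<lambda>s. ?k' s *\<^sub>R ?w s) has_integral ?k b *\<^sub>R ?w b - I) {a..b}"
  proof (rule integration_by_parts_interior[OF bounded_bilinear_scaleR])
    show "continuous_on {a..b} ?k" using ab by (intro continuous_intros) auto
    show "continuous_on {a..b} ?w" by (intro continuous_intros cont)
    show "(?k has_vector_derivative ?k' s) (at s)" if "s \<in> {a<..<b}" for s using dk that ab by auto
    show "(?w has_vector_derivative u' s) (at s)" if "s \<in> {a<..<b}" for s
      using deriv[OF that] by (auto intro!: derivative_eq_intros)
  qed (use ab int in auto)
  have "((\<lambda>s. ?k' s) has_integral (?k b - ?k a)) {a..b}"
    by (rule fundamental_theorem_of_calculus) (use ab dk in auto)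
  from has_integral_mult_left[OF this, of \<omega>]
  have k'int: "((\<lambda>s. ?k' s * \<omega>) has_integral (?k b - ?k a) * \<omega>) {a..b}" .
  have tail: "norm (?k b *\<^sub>R ?w b - I) \<le> (?k b - ?k a) * \<omega>"
  proof -
    have "norm (integral {a..b} (\<lambda>s. ?k' s *\<^sub>R ?w s)) \<le> integral {a..b} (\<lambda>s. ?k' s * \<omega>)"
    proof (rule integral_norm_bound_integral)
      fix s assume "s \<in> {a..b}"
      then show "norm (?k' s *\<^sub>R ?w s) \<le> ?k' s * \<omega>" using osc[of s] \<alpha> by (simp add: mult_left_mono)
    qed (use parts k'int in auto)
    then show ?thesis unfolding integral_unique[OF parts] integral_unique[OF k'int] .
  qed
  have "r *\<^sub>R ?w b - I = (?k b *\<^sub>R ?w b - I) - (?k b - r) *\<^sub>R ?w b" by (simp add: algebra_simps)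
  also have "norm \<dots> \<le> (?k b - ?k a) * \<omega> + (?k b - r) * \<omega>"
  proof (rule order_trans[OF norm_triangle_ineq4 add_mono[OF tail]])
    show "norm ((?k b - r) *\<^sub>R ?w b) \<le> (?k b - r) * \<omega>"
      using osc[of b] ab r by (simp add: mult_left_mono)
  qed
  also have "\<dots> \<le> (?k b - ?k a) * \<omega> + (?k b - ?k a) * \<omega>"
    using r \<omega> by (intro add_left_mono mult_right_mono) auto
  finally show ?thesis by (simp add: algebra_simps)
qed

lemma kernel_last_interval:
  fixes u' :: "real \<Rightarrow> 'x::banach"
  assumes \<alpha>: "\<alpha> < 1" and a: "a < t"
    and int: "((\<lambda>s. (t - s) powr (-\<alpha>) *\<^sub>R u' s) has_integral I) {a..t}"
    and bound: "\<And>s. s \<in> {a..<t} \<Longrightarrow> norm (u' s) \<le> B"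
  shows "norm I \<le> B * ((t - a) powr (1 - \<alpha>) / (1 - \<alpha>))"
proof -
  from has_integral_mult_right[OF kernel_has_integral[OF \<alpha> less_imp_le[OF a]], of B]
  have k: "((\<lambda>s. B * (t - s) powr (-\<alpha>)) has_integral B * ((t - a) powr (1 - \<alpha>) / (1 - \<alpha>))) {a..t}" .
  have "norm (integral {a..t} (\<lambda>s. (t - s) powr (-\<alpha>) *\<^sub>R u' s)) \<le> integral {a..t} (\<lambda>s. B * (t - s) powr (-\<alpha>))"
  proof (rule integral_norm_bound_integral)
    fix s assume s: "s \<in> {a..t}"
    show "norm ((t - s) powr (-\<alpha>) *\<^sub>R u' s) \<le> B * (t - s) powr (-\<alpha>)"
    proof (cases "s = t")
      case False
      then have "norm (u' s) \<le> B" using s by (intro bound) auto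
      from mult_left_mono[OF this, of "(t - s) powr (-\<alpha>)"] show ?thesis by (simp add: mult.commute)
    qed simp
  qed (use int k in auto)
  then show ?thesis unfolding integral_unique[OF int] integral_unique[OF k] .
qed

lemma integral_grid_sum:
  fixes g :: "real \<Rightarrow> 'x::banach"
  assumes h: "0 \<le> h" and int: "g integrable_on {0..real n * h}" and m: "m \<le> n"
  shows "integral {0..real m * h} g = (\<Sum>j=1..m. integral {(real j - 1) * h..real j * h} g)"
  using m
proof (induction m)
  case (Suc m)
  have le: "real m * h \<le> real (Suc m) * h" "real (Suc m) * h \<le> real n * h"
    using Suc.prems h by (auto intro!: mult_right_mono)
  have "g integrable_on {0..real (Suc m) * h}"
    by (rule integrable_subinterval_real[OF int]) (use le in auto)
  from Henstock_Kurzweil_Integration.integral_combine[OF _ le(1) this]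
  have "integral {0..real (Suc m) * h} g = integral {0..real m * h} g + integral {real m * h..real (Suc m) * h} g"
    using h by simp
  then show ?case using Suc by simp
qed simp

text \<open>
  On the \<open>j\<close>-th interval \<open>u\<close> oscillates by at most a multiple of \<open>F / j\<close>, so the errors of all
  intervals but the last add up to the sum of \<open>sum_gap_over_index\<close>.  On the last one the kernel is
  unbounded but integrable and the derivative is of order \<open>F / (n h)\<close>.
\<close>

lemma truncation_error:
  fixes u :: "real \<Rightarrow> 'x::banach"
  assumes \<alpha>: "0 < \<alpha>" "\<alpha> < 1" and h: "0 < h" and n: "2 \<le> n"
    and Z: "(\<Sum>j=1..<n. kernel_gap \<alpha> (real n - real j) / real j) \<le> Z / real n"
    and cont: "continuous_on {0..real n * h} u"
    and deriv: "\<And>s. s \<in> {0<..<real n * h} \<Longrightarrow> (u has_vector_derivative u' s) (at s)"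
    and int: "((\<lambda>s. (real n * h - s) powr (-\<alpha>) *\<^sub>R u' s) has_integral I) {0..real n * h}"
    and bound: "\<And>s. s \<in> {0..real n * h} \<Longrightarrow> norm (u s) \<le> F"
    and osc: "\<And>s t. 0 < s \<Longrightarrow> t \<le> 2 * s \<Longrightarrow> s \<le> t \<Longrightarrow> t \<le> real n * h \<Longrightarrow> norm (u t - u s) \<le> F * ((t - s) / t)"
    and d: "\<And>s. s \<in> {0<..<real n * h} \<Longrightarrow> norm (u' s) \<le> F / s"
  shows "norm ((\<Sum>j=1..n. step_weight \<alpha> j n *\<^sub>R (u (real j * h) - u (real (j - 1) * h))) - h powr \<alpha> *\<^sub>R I)
    \<le> (4 * Z + 4 / (1 - \<alpha>)) * F / real n"
proof -
  let ?g = "\<lambda>s. (real n * h - s) powr (-\<alpha>) *\<^sub>R u' s"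
  let ?I = "\<lambda>j. integral {(real j - 1) * h..real j * h} ?g"
  let ?r = "\<lambda>j. step_weight \<alpha> j n"
  let ?du = "\<lambda>j. u (real j * h) - u (real (j - 1) * h)"
  have F: "0 \<le> F" using bound[of 0] h by (auto intro: order_trans[OF norm_ge_zero])
  have hh: "h powr \<alpha> * h powr (-\<alpha>) = 1" using h by (simp flip: powr_add)
  have grid: "0 \<le> (real j - 1) * h" "(real j - 1) * h \<le> real j * h" "real j * h \<le> real n * h"
    if "j \<in> {1..n}" for j using that h by (auto intro!: mult_right_mono)
  have Iint: "(?g has_integral ?I j) {(real j - 1) * h..real j * h}" if j: "j \<in> {1..n}" for j
    by (rule integrable_integral, rule integrable_subinterval_real[of _ 0 "real n * h"]) (use int grid[OF j] in auto)
  have Isum: "I = (\<Sum>j=1..n. ?I j)"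
    using integral_grid_sum[of h ?g n n] int h integral_unique[OF int] by auto
  have eq: "(\<Sum>j=1..n. ?r j *\<^sub>R ?du j) - h powr \<alpha> *\<^sub>R I =
     (\<Sum>j=1..<n. ?r j *\<^sub>R ?du j - h powr \<alpha> *\<^sub>R ?I j) + (?r n *\<^sub>R ?du n - h powr \<alpha> *\<^sub>R ?I n)"
  proof -
    have "(\<Sum>j=1..n. ?r j *\<^sub>R ?du j) - h powr \<alpha> *\<^sub>R I = (\<Sum>j=1..n. ?r j *\<^sub>R ?du j - h powr \<alpha> *\<^sub>R ?I j)"
      unfolding Isum by (simp only: scaleR_sum_right sum_subtractf)
    moreover have "{1..n} = insert n {1..<n}" using n by auto
    ultimately show ?thesis by simp
  qed
  have inner: "norm (?r j *\<^sub>R ?du j - h powr \<alpha> *\<^sub>R ?I j) \<le>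
      4 * F * (kernel_gap \<alpha> (real n - real j) / real j)" if j: "j \<in> {1..<n}" for j
  proof -
    have j': "j \<in> {1..n}" "1 \<le> j" "j < n" using j by auto
    let ?a = "(real j - 1) * h" and ?b = "real j * h" and ?t = "real n * h"
    have jm: "real (j - 1) = real j - 1" using j by auto
    have ta: "?t - ?a = h * (real n - real j + 1)" and tb: "?t - ?b = h * (real n - real j)" by (simp_all add: algebra_simps)
    have pa: "(?t - ?a) powr (-\<alpha>) = h powr (-\<alpha>) * (real n - real j + 1) powr (-\<alpha>)"
      and pb: "(?t - ?b) powr (-\<alpha>) = h powr (-\<alpha>) * (real n - real j) powr (-\<alpha>)"
      unfolding ta tb using h j' by (simp_all add: powr_mult)
    have os: "norm (u s - u ?a) \<le> 2 * F / real j" if s: "s \<in> {?a..?b}" for s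
    proof (cases "j = 1")
      case True
      have "s \<in> {0..?t}" "?a \<in> {0..?t}" using s grid[OF j'(1)] by auto
      then have "norm (u s - u ?a) \<le> F + F"
        by (intro order_trans[OF norm_triangle_ineq4] add_mono bound)
      then show ?thesis using True by simp
    next
      case False
      then have j2: "2 \<le> j" using j by auto
      then have a0: "0 < ?a" using h by auto
      have "norm (u s - u ?a) \<le> F * ((s - ?a) / s)"
      proof (rule osc)
        have "2 \<le> real j" using j2 by simp
        then have "real j \<le> 2 * (real j - 1)" by (simp add: algebra_simps)
        then have "real j * h \<le> 2 * (real j - 1) * h" using h by (intro mult_right_mono) auto
        then have "real j * h \<le> 2 * ?a" by (simp only: mult.assoc)
        then show "s \<le> 2 * ?a" using s[unfolded atLeastAtMost_iff] by (meson order_trans)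
      qed (use a0 s grid[OF j'(1)] in auto)
      also have "\<dots> \<le> F * (2 / real j)"
      proof (rule mult_left_mono[OF _ F])
        have "(s - ?a) / s \<le> h / ?a" using s a0 h by (intro frac_le) (auto simp: algebra_simps)
        also have "\<dots> = 1 / (real j - 1)" using h by simp
        also have "\<dots> \<le> 2 / real j" using j2 by (simp add: field_simps)
        finally show "(s - ?a) / s \<le> 2 / real j" .
      qed
      finally show ?thesis by (simp add: mult.commute)
    qed
    have "norm ((h powr (-\<alpha>) * ?r j) *\<^sub>R (u ?b - u ?a) - ?I j) \<le> 2 * (2 * F / real j) * ((?t - ?b) powr (-\<alpha>) - (?t - ?a) powr (-\<alpha>))"
    proof (rule kernel_quadrature_error[where u = u and u' = u' and t = ?t and a = ?a and b = ?b and \<alpha> = \<alpha> and I = "?I j", OF \<alpha>(1) grid(2)[OF j'(1)] _ _ _ Iint[OF j'(1)] os])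
      show "?b < ?t" using h j' by simp
      show "continuous_on {?a..?b} u" by (rule continuous_on_subset[OF cont]) (use grid[OF j'(1)] in auto)
      show "(u has_vector_derivative u' s) (at s)" if "s \<in> {?a<..<?b}" for s
        by (rule deriv) (use that grid[OF j'(1)] in auto)
      show "(?t - ?a) powr (-\<alpha>) \<le> h powr (-\<alpha>) * ?r j"
        unfolding pa using step_weight_ge[OF \<alpha>, of j n] j' by (intro mult_left_mono) auto
      show "h powr (-\<alpha>) * ?r j \<le> (?t - ?b) powr (-\<alpha>)"
        unfolding pb using step_weight_le[OF \<alpha>, of j n] j' by (intro mult_left_mono) auto
    qed
    then have "h powr \<alpha> * norm ((h powr (-\<alpha>) * ?r j) *\<^sub>R (u ?b - u ?a) - ?I j) \<le>
        h powr \<alpha> * (2 * (2 * F / real j) * ((?t - ?b) powr (-\<alpha>) - (?t - ?a) powr (-\<alpha>)))" by (intro mult_left_mono) auto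
    also have "\<dots> = (h powr \<alpha> * h powr (-\<alpha>)) * (4 * F * (kernel_gap \<alpha> (real n - real j) / real j))"
      unfolding pa pb by (simp add: algebra_simps diff_divide_distrib)
    also have "h powr \<alpha> * norm ((h powr (-\<alpha>) * ?r j) *\<^sub>R (u ?b - u ?a) - ?I j) =
        norm (h powr \<alpha> *\<^sub>R ((h powr (-\<alpha>) * ?r j) *\<^sub>R (u ?b - u ?a) - ?I j))" by simp
    also have "h powr \<alpha> *\<^sub>R ((h powr (-\<alpha>) * ?r j) *\<^sub>R (u ?b - u ?a) - ?I j) = ?r j *\<^sub>R ?du j - h powr \<alpha> *\<^sub>R ?I j"
    proof -
      have "h powr \<alpha> * (h powr (-\<alpha>) * ?r j) = ?r j" using hh by (simp flip: mult.assoc)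
      then show ?thesis unfolding jm scaleR_diff_right[of "h powr \<alpha>"] scaleR_scaleR by (simp only:)
    qed
    finally show ?thesis unfolding hh by simp
  qed
  have last: "norm (?r n *\<^sub>R ?du n - h powr \<alpha> *\<^sub>R ?I n) \<le> 4 / (1 - \<alpha>) * F / real n"
  proof -
    have nn: "n \<in> {1..n}" using n by auto
    let ?a = "(real n - 1) * h"
    have nm: "real (n - 1) = real n - 1" using n by auto
    have a0: "0 < ?a" using n h by auto
    have "norm (u (real n * h) - u ?a) \<le> F * ((real n * h - ?a) / (real n * h))"
    proof (rule osc)
      have "2 \<le> real n" using n by simp
      then have "real n \<le> 2 * (real n - 1)" by (simp add: algebra_simps)
      then have "real n * h \<le> 2 * (real n - 1) * h" using h by (intro mult_right_mono) auto
      then show "real n * h \<le> 2 * ?a" by (simp only: mult.assoc)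
    qed (use a0 grid[OF nn] in auto)
    also have "\<dots> = F / real n" using h by (simp add: algebra_simps)
    finally have du: "norm (?du n) \<le> F / real n" unfolding nm .
    have "norm (?r n *\<^sub>R ?du n) \<le> 2 / (1 - \<alpha>) * (F / real n)"
      using du step_weight_last_le[OF \<alpha> n] step_weight_last_ge[OF \<alpha>, of n] n \<alpha>
      unfolding norm_scaleR by (intro mult_mono) auto
    moreover have "norm (h powr \<alpha> *\<^sub>R ?I n) \<le> 2 / (1 - \<alpha>) * (F / real n)"
    proof -
      have "norm (?I n) \<le> F / ?a * ((real n * h - ?a) powr (1 - \<alpha>) / (1 - \<alpha>))"
      proof (rule kernel_last_interval[where u' = u' and t = "real n * h" and a = ?a and \<alpha> = \<alpha>, OF \<alpha>(2) _ Iint[OF nn]])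
        fix s assume s: "s \<in> {?a..<real n * h}"
        then have "norm (u' s) \<le> F / s" using a0 by (intro d) auto
        also have "\<dots> \<le> F / ?a" using s by (intro frac_le F order_refl a0) auto
        finally show "norm (u' s) \<le> F / ?a" .
      qed (use h in auto)
      also have "real n * h - ?a = h" by (simp add: algebra_simps)
      finally have "h powr \<alpha> * norm (?I n) \<le> h powr \<alpha> * (F / ?a * (h powr (1 - \<alpha>) / (1 - \<alpha>)))" by (intro mult_left_mono) auto
      also have "\<dots> = (h powr \<alpha> * h powr (1 - \<alpha>)) * (F / ?a / (1 - \<alpha>))" by simp
      also have "h powr \<alpha> * h powr (1 - \<alpha>) = h" using h by (simp flip: powr_add)
      also have "h * (F / ?a / (1 - \<alpha>)) = 1 / (real n - 1) * (F / (1 - \<alpha>))"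
      proof -
        have "h * (F / (m * h) / q) = 1 / m * (F / q)" for m q :: real using h by simp
        then show ?thesis .
      qed
      also have "\<dots> \<le> 2 / real n * (F / (1 - \<alpha>))"
        using n F \<alpha> by (intro mult_right_mono) (auto simp: field_simps)
      finally show ?thesis by (simp add: mult_ac)
    qed
    ultimately have "norm (?r n *\<^sub>R ?du n - h powr \<alpha> *\<^sub>R ?I n) \<le> 2 / (1 - \<alpha>) * (F / real n) + 2 / (1 - \<alpha>) * (F / real n)"
      by (intro order_trans[OF norm_triangle_ineq4] add_mono)
    moreover have "2 / q * (F / m) + 2 / q * (F / m) = 4 / q * F / m" for q m :: real by simp
    ultimately show ?thesis by (simp only:)
  qed
  have "norm (\<Sum>j=1..<n. ?r j *\<^sub>R ?du j - h powr \<alpha> *\<^sub>R ?I j) \<le>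
      (\<Sum>j=1..<n. 4 * F * (kernel_gap \<alpha> (real n - real j) / real j))"
    by (rule sum_norm_le) (rule inner)
  also have "\<dots> = 4 * F * (\<Sum>j=1..<n. kernel_gap \<alpha> (real n - real j) / real j)"
    by (simp only: sum_distrib_left)
  also have "\<dots> \<le> 4 * F * (Z / real n)" using Z F by (intro mult_left_mono) auto
  finally have "norm (\<Sum>j=1..<n. ?r j *\<^sub>R ?du j - h powr \<alpha> *\<^sub>R ?I j) \<le> 4 * F * (Z / real n)" .
  then have "norm ((\<Sum>j=1..n. ?r j *\<^sub>R ?du j) - h powr \<alpha> *\<^sub>R I) \<le> 4 * F * (Z / real n) + 4 / (1 - \<alpha>) * F / real n"
    unfolding eq using last by (intro order_trans[OF norm_triangle_ineq] add_mono)
  also have "\<dots> = (4 * Z + 4 / (1 - \<alpha>)) * F / real n"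
  proof -
    have "4 * F * (Z / m) + q * F / m = (4 * Z + q) * F / m" for q m :: real
      by (simp add: algebra_simps add_divide_distrib)
    then show ?thesis .
  qed
  finally show ?thesis .
qed

section \<open>Stability and error of the scheme\<close>

context sectorial_resolvent begin

text \<open>
  The discrete maximum principle for sequences that satisfy the scheme up to residuals \<open>\<rho>\<close>.  Summation
  by parts writes \<open>e n\<close> as an Euler step applied to a convex combination of earlier values plus
  \<open>\<rho> n\<close> over the last weight; the same summation by parts for \<open>w\<close> shows that the bound \<open>B * w\<close> is
  inherited.  Bounding all products \<open>Jprod hs\<close> at once absorbs the new Euler step into the list.  The
  first \<open>m\<close> values may be bounded by other means.
\<close>

lemma discrete_comparison:
  assumes \<alpha>: "0 < \<alpha>" "\<alpha> < 1" and H: "0 < H" and B: "0 \<le> B"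
    and w0: "\<And>hs. all_pos hs \<Longrightarrow> norm (Jprod hs (e 0)) \<le> B * w 0"
    and M: "\<And>hs f. all_pos hs \<Longrightarrow> norm (Jprod hs f) \<le> M * norm f"
    and step: "\<And>n. n \<in> {1..N} \<Longrightarrow> m \<le> n \<Longrightarrow> e n \<in> D \<and>
       (\<Sum>j=1..n. step_weight \<alpha> j n *\<^sub>R (e j - e (j - 1))) = H *\<^sub>R A (e n) + \<rho> n \<and>
       M * norm (\<rho> n) \<le> B * (\<Sum>j=1..n. step_weight \<alpha> j n * (w j - w (j - 1)))"
    and start: "\<And>n hs. n \<in> {1..N} \<Longrightarrow> n < m \<Longrightarrow> all_pos hs \<Longrightarrow> norm (Jprod hs (e n)) \<le> B * w n"
    and n: "n \<le> N" and zs: "all_pos hs"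
  shows "norm (Jprod hs (e n)) \<le> B * w n"
  using n zs
proof (induction n arbitrary: hs rule: less_induct)
  case (less n)
  show ?case
  proof (cases "n = 0 \<or> n < m")
    case True
    then show ?thesis using w0[OF less.prems(2)] start[of n hs] less.prems by (cases "n = 0") auto
  next
    case False
    then have n1: "1 \<le> n" "n \<in> {1..N}" "m \<le> n" using less.prems by auto
    let ?r = "\<lambda>j. step_weight \<alpha> j n"
    note st = step[OF n1(2,3)]
    have rn: "0 < ?r n" using step_weight_last_ge[OF \<alpha> n1(1)] by linarith
    define h where "h = H / ?r n"
    have z: "0 < h" using H rn by (simp add: h_def)
    let ?b = "?r 1 *\<^sub>R e 0 + (\<Sum>j=1..<n. (?r (Suc j) - ?r j) *\<^sub>R e j) + \<rho> n"
    have "?r n *\<^sub>R e n - H *\<^sub>R A (e n) = ?b"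
      using st sum_increments_by_parts[OF n1(1), of ?r e] by (simp add: algebra_simps)
    then have "(1 / ?r n) *\<^sub>R (?r n *\<^sub>R e n - H *\<^sub>R A (e n)) = (1 / ?r n) *\<^sub>R ?b" by simp
    then have "e n - h *\<^sub>R A (e n) = (1 / ?r n) *\<^sub>R ?b"
      using rn by (simp add: scaleR_diff_right h_def)
    then have "e n = J h ((1 / ?r n) *\<^sub>R ?b)" using J_eqI[OF z] st by auto
    then have E: "Jprod hs (e n) = Jprod (h # hs) ((1 / ?r n) *\<^sub>R ?b)" by simp
    have zs': "all_pos (h # hs)" using z less.prems by auto
    interpret P: bounded_linear "Jprod (h # hs)" by (rule bounded_linear_Jprod[OF zs'])
    have r1: "0 \<le> ?r 1" by (rule order_trans[OF _ step_weight_ge[OF \<alpha>]]) (use n1 in auto)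
    have mono: "?r j \<le> ?r (Suc j)" if "j \<in> {1..<n}" for j using step_weight_mono[OF \<alpha>, of j n] that by auto
    have IH: "norm (Jprod (h # hs) (e j)) \<le> B * w j" if "j < n" for j
      using less.IH[OF that _ zs'] that less.prems by auto
    have "norm (Jprod (h # hs) ?b) \<le> ?r 1 * (B * w 0) + (\<Sum>j=1..<n. (?r (Suc j) - ?r j) * (B * w j)) + M * norm (\<rho> n)"
      unfolding P.add P.sum P.scaleR
    proof (rule order_trans[OF norm_triangle_ineq add_mono[OF order_trans[OF norm_triangle_ineq add_mono]]])
      show "norm (?r 1 *\<^sub>R Jprod (h # hs) (e 0)) \<le> ?r 1 * (B * w 0)"
        using IH[of 0] r1 n1 by (simp add: mult_left_mono)
      show "norm (\<Sum>j=1..<n. (?r (Suc j) - ?r j) *\<^sub>R Jprod (h # hs) (e j)) \<le> (\<Sum>j=1..<n. (?r (Suc j) - ?r j) * (B * w j))"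
      proof (rule sum_norm_le)
        fix j assume j: "j \<in> {1..<n}"
        then have "(?r (Suc j) - ?r j) * norm (Jprod (h # hs) (e j)) \<le> (?r (Suc j) - ?r j) * (B * w j)"
          using IH[of j] mono[OF j] by (intro mult_left_mono) auto
        then show "norm ((?r (Suc j) - ?r j) *\<^sub>R Jprod (h # hs) (e j)) \<le> (?r (Suc j) - ?r j) * (B * w j)"
          using mono[OF j] by simp
      qed
      show "norm (Jprod (h # hs) (\<rho> n)) \<le> M * norm (\<rho> n)" by (rule M[OF zs'])
    qed
    also have "\<dots> = B * (?r 1 * w 0 + (\<Sum>j=1..<n. (?r (Suc j) - ?r j) * w j)) + M * norm (\<rho> n)"
      by (simp add: distrib_left sum_distrib_left mult_ac)
    also have "\<dots> \<le> B * (?r 1 * w 0 + (\<Sum>j=1..<n. (?r (Suc j) - ?r j) * w j)) + B * (\<Sum>j=1..n. ?r j * (w j - w (j - 1)))"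
      using st by simp
    also have "\<dots> = B * (?r n * w n)"
      using sum_increments_by_parts[OF n1(1), of ?r w] by (simp flip: distrib_left)
    finally have "1 / ?r n * norm (Jprod (h # hs) ?b) \<le> 1 / ?r n * (B * (?r n * w n))"
      using rn by (intro mult_left_mono) auto
    then show ?thesis unfolding E P.scaleR using rn by simp
  qed
qed

lemma fd_scheme_step:
  assumes \<alpha>: "0 < \<alpha>" "\<alpha> < 1" and h: "0 < step_size T N"
    and v: "fd_scheme D A \<alpha> T N f v" and n: "n \<in> {1..N}"
  shows "(\<Sum>j=1..n. step_weight \<alpha> j n *\<^sub>R (v j - v (j - 1))) = (Gamma (1 - \<alpha>) * step_size T N powr \<alpha>) *\<^sub>R A (v n)"
proof -
  let ?h = "step_size T N powr \<alpha>" and ?g = "Gamma (1 - \<alpha>)"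
  have g: "0 < ?g" using \<alpha> by (intro Gamma_real_pos) auto
  have h': "0 < ?h" using h by simp
  have "A (v n) = (\<Sum>j=0..n. (coeff_a \<alpha> j n / ?h) *\<^sub>R v j)"
    using v n by (simp add: fd_scheme_def)
  also have "\<dots> = (1 / ?h) *\<^sub>R (\<Sum>j=0..n. coeff_a \<alpha> j n *\<^sub>R v j)"
    by (simp add: scaleR_sum_right)
  also have "\<dots> = (1 / ?h) *\<^sub>R (1 / ?g) *\<^sub>R (\<Sum>j=1..n. step_weight \<alpha> j n *\<^sub>R (v j - v (j - 1)))"
    using n by (subst coeff_a_sum) auto
  finally show ?thesis using g h' by simp
qed

lemma fd_scheme_stable:
  assumes \<alpha>: "0 < \<alpha>" "\<alpha> < 1" and T: "0 < T" and N: "1 \<le> N"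
    and v: "fd_scheme D A \<alpha> T N f v" and n: "n \<le> N"
    and M: "0 \<le> M" "\<And>hs f. all_pos hs \<Longrightarrow> norm (Jprod hs f) \<le> M * norm f"
  shows "norm (v n) \<le> M * norm f"
proof -
  have h: "0 < step_size T N" using T N by (simp add: step_size_def)
  have "norm (Jprod [] (v n)) \<le> (M * norm f) * 1"
  proof (rule discrete_comparison[OF \<alpha>, where H = "Gamma (1 - \<alpha>) * step_size T N powr \<alpha>" and N = N and m = 0
        and \<rho> = "\<lambda>_. 0" and e = v and w = "\<lambda>_. 1" and M = M])
    show "0 < Gamma (1 - \<alpha>) * step_size T N powr \<alpha>" using \<alpha> h by (simp add: Gamma_real_pos)
    show "norm (Jprod hs (v 0)) \<le> M * norm f * 1" if "all_pos hs" for hs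
      using M(2)[OF that, of f] v by (simp add: fd_scheme_def)
    show "v n \<in> D \<and> (\<Sum>j=1..n. step_weight \<alpha> j n *\<^sub>R (v j - v (j - 1))) = (Gamma (1 - \<alpha>) * step_size T N powr \<alpha>) *\<^sub>R A (v n) + 0 \<and>
        M * norm (0::'x) \<le> M * norm f * (\<Sum>j=1..n. step_weight \<alpha> j n * (1 - 1))" if "n \<in> {1..N}" for n
      using fd_scheme_step[OF \<alpha> h v that] v that by (simp add: fd_scheme_def)
  qed (use M n in auto)
  then show ?thesis by simp
qed

text \<open>
  The error solves the scheme with the truncation error as residual and vanishes initially.  From the
  index \<open>n0\<close> on it is controlled by the barrier, before that by the stability of the scheme and the
  bound of the solution.
\<close>

lemma fd_scheme_error:
  assumes \<alpha>: "0 < \<alpha>" "\<alpha> < 1" and T: "0 < T" and s: "0 < s" "s < 1 - \<alpha>"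
  obtains B where "0 < B"
    "\<And>f u N v n. cauchy_solution D A \<alpha> T f u \<Longrightarrow> fd_scheme D A \<alpha> T N f v \<Longrightarrow> 1 \<le> N \<Longrightarrow> n \<in> {1..N} \<Longrightarrow>
      norm (v n - u (real n * step_size T N)) \<le> B * norm f * real n powr (-s)"
proof -
  obtain K where K: "1 \<le> K"
    and KJ: "\<And>hs f. all_pos hs \<Longrightarrow> norm (Jprod hs f) \<le> K * norm f"
    and Ku: "\<And>f u t. cauchy_solution D A \<alpha> T f u \<Longrightarrow> t \<in> {0..T} \<Longrightarrow> norm (u t) \<le> K * norm f"
    and Kosc: "\<And>f u s t. cauchy_solution D A \<alpha> T f u \<Longrightarrow> 0 < s \<Longrightarrow> t \<le> 2 * s \<Longrightarrow> s \<le> t \<Longrightarrow> t \<le> T \<Longrightarrow>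
       norm (u t - u s) \<le> K * ((t - s) / t) * norm f"
    and Kd: "\<And>f u t. cauchy_solution D A \<alpha> T f u \<Longrightarrow> t \<in> {0<..<T} \<Longrightarrow> norm (deriv_vec u t) \<le> K / t * norm f"
    using cauchy_solution_estimates[OF \<alpha> T] by blast
  obtain Z where Z: "0 \<le> Z" "\<And>n. 1 \<le> n \<Longrightarrow> (\<Sum>j=1..<n. kernel_gap \<alpha> (real n - real j) / real j) \<le> Z / real n"
    using sum_gap_over_index[OF \<alpha>] by blast
  define E where "E = 4 * Z + 4 / (1 - \<alpha>)"
  have E: "0 \<le> E" using Z \<alpha> by (simp add: E_def)
  obtain c n0 where c: "0 < c" and n0: "2 \<le> n0" and bar:
    "\<And>n. n0 \<le> n \<Longrightarrow> c / real n \<le> (\<Sum>j=1..n. step_weight \<alpha> j n * (barrier s j - barrier s (j - 1)))"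
    using barrier_supersolution[OF \<alpha> s] by blast
  \<comment> \<open>The first summand covers the indices below \<open>n0\<close>, the second one makes the barrier dominate the
    truncation error.\<close>
  let ?B = "2 * K\<^sup>2 * real n0 powr s + K * E * K / c"
  have B: "0 < ?B" using K n0 E c by (intro add_pos_nonneg mult_pos_pos) auto
  have "norm (v n - u (real n * step_size T N)) \<le> ?B * norm f * real n powr (-s)"
    if sol: "cauchy_solution D A \<alpha> T f u" and v: "fd_scheme D A \<alpha> T N f v" and N: "1 \<le> N" and n: "n \<in> {1..N}"
    for f u N v n
  proof -
    define h where "h = step_size T N"
    have h: "0 < h" using T N by (simp add: h_def step_size_def)
    have grid: "real n * h \<in> {0<..T}" "real n * h \<in> {0..T}" if "n \<in> {1..N}" for n
    proof -
      have "real n * h \<le> real N * h" using that h by (intro mult_right_mono) auto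
      also have "\<dots> = T" using N by (simp add: h_def step_size_def)
      finally show "real n * h \<in> {0<..T}" "real n * h \<in> {0..T}" using that h by auto
    qed
    define e where "e n = v n - u (real n * h)" for n
    define H where "H = Gamma (1 - \<alpha>) * h powr \<alpha>"
    have H: "0 < H" using \<alpha> h by (simp add: H_def Gamma_real_pos)
    define \<rho> where "\<rho> n = H *\<^sub>R A (u (real n * h)) - (\<Sum>j=1..n. step_weight \<alpha> j n *\<^sub>R (u (real j * h) - u (real (j - 1) * h)))" for n
    have uf: "u 0 = f" and vf: "v 0 = f" and uD: "\<And>t. t \<in> {0..T} \<Longrightarrow> u t \<in> D" and vD: "\<And>n. n \<in> {1..N} \<Longrightarrow> v n \<in> D"
      using sol v by (auto simp: cauchy_solution_def fd_scheme_def)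
    have C1: "K * E * K / c \<le> ?B" and C2: "2 * K\<^sup>2 * real n0 powr s \<le> ?B" using K n0 E c by auto
    have \<rho>_le: "norm (\<rho> n) \<le> E * (K * norm f) / real n" if n: "n \<in> {1..N}" "2 \<le> n" for n
    proof -
      let ?t = "real n * h"
      have t: "?t \<in> {0<..T}" "?t \<in> {0..T}" using grid[OF n(1)] by auto
      have kern: "rl_kernel (1 - \<alpha>) (deriv_vec u) ?t = (\<lambda>s. (?t - s) powr (-\<alpha>) *\<^sub>R deriv_vec u s)"
        by (simp add: rl_kernel_def fun_eq_iff powr_minus_divide)
      have int: "rl_integrable (1 - \<alpha>) (deriv_vec u) ?t" and cap: "caputo \<alpha> u ?t = A (u ?t)"
        using sol t by (auto simp: cauchy_solution_def caputo_exists_def)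
      have g: "0 < Gamma (1 - \<alpha>)" using \<alpha> by (intro Gamma_real_pos) auto
      have "Gamma (1 - \<alpha>) *\<^sub>R caputo \<alpha> u ?t = integral {0..?t} (\<lambda>s. (?t - s) powr (-\<alpha>) *\<^sub>R deriv_vec u s)"
        using g by (simp add: caputo_def rl_integral_def kern)
      then have I: "((\<lambda>s. (?t - s) powr (-\<alpha>) *\<^sub>R deriv_vec u s) has_integral Gamma (1 - \<alpha>) *\<^sub>R A (u ?t)) {0..?t}"
        using int cap by (simp add: rl_integrable_def has_integral_iff kern)
      have "norm ((\<Sum>j=1..n. step_weight \<alpha> j n *\<^sub>R (u (real j * h) - u (real (j - 1) * h))) - h powr \<alpha> *\<^sub>R Gamma (1 - \<alpha>) *\<^sub>R A (u ?t)) \<le> E * (K * norm f) / real n"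
        unfolding E_def
      proof (rule truncation_error[OF \<alpha> h n(2) Z(2) _ _ I])
        show "1 \<le> n" using n by simp
        show "continuous_on {0..?t} u"
          using sol t continuous_on_subset[of "{0..T}" u "{0..?t}"] by (auto simp: cauchy_solution_def)
        show "(u has_vector_derivative deriv_vec u s) (at s)" if "s \<in> {0<..<?t}" for s
          using sol that t by (auto simp: cauchy_solution_def caputo_exists_def deriv_vec_def simp flip: vector_derivative_works)
        show "norm (u s) \<le> K * norm f" if "s \<in> {0..?t}" for s using Ku[OF sol, of s] that t by auto
        show "norm (u t' - u s) \<le> K * norm f * ((t' - s) / t')" if "0 < s" "t' \<le> 2 * s" "s \<le> t'" "t' \<le> ?t" for s t'
        proof -
          have "norm (u t' - u s) \<le> K * ((t' - s) / t') * norm f" by (rule Kosc[OF sol]) (use that t in auto)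
          then show ?thesis by (simp only: mult_ac)
        qed
        show "norm (deriv_vec u s) \<le> K * norm f / s" if "s \<in> {0<..<?t}" for s using Kd[OF sol, of s] that t by auto
      qed
      moreover have "h powr \<alpha> *\<^sub>R Gamma (1 - \<alpha>) *\<^sub>R A (u ?t) = H *\<^sub>R A (u ?t)" by (simp add: H_def mult.commute)
      ultimately show ?thesis unfolding \<rho>_def by (simp only: norm_minus_commute)
    qed
    have "norm (Jprod [] (e n)) \<le> (?B * norm f) * barrier s n"
    proof (rule discrete_comparison[OF \<alpha> H, where N = N and m = n0 and \<rho> = \<rho> and M = K])
      show "norm (Jprod hs (e 0)) \<le> ?B * norm f * barrier s 0" if "all_pos hs" for hs
        using linear_0[OF bounded_linear.linear[OF bounded_linear_Jprod[OF that]]] by (simp add: e_def uf vf barrier_simps)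
    next
      fix n assume n: "n \<in> {1..N}" "n0 \<le> n"
      have "(\<Sum>j=1..n. step_weight \<alpha> j n *\<^sub>R (e j - e (j - 1))) =
        (\<Sum>j=1..n. step_weight \<alpha> j n *\<^sub>R (v j - v (j - 1))) - (\<Sum>j=1..n. step_weight \<alpha> j n *\<^sub>R (u (real j * h) - u (real (j - 1) * h)))"
        unfolding e_def sum_subtractf[symmetric] by (rule sum.cong) (simp_all add: algebra_simps)
      also have "(\<Sum>j=1..n. step_weight \<alpha> j n *\<^sub>R (v j - v (j - 1))) = H *\<^sub>R A (v n)"
        using fd_scheme_step[OF \<alpha> h[unfolded h_def] v n(1)] by (simp add: H_def h_def)
      finally have 1: "(\<Sum>j=1..n. step_weight \<alpha> j n *\<^sub>R (e j - e (j - 1))) = H *\<^sub>R A (e n) + \<rho> n"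
        using A_diff[OF vD[OF n(1)] uD[OF grid(2)[OF n(1)]]] by (simp add: e_def \<rho>_def scaleR_diff_right)
      have "K * norm (\<rho> n) \<le> K * (E * (K * norm f) / real n)" using \<rho>_le[OF n(1)] n n0 K by (intro mult_left_mono) auto
      also have "\<dots> = (K * E * K / c) * norm f * (c / real n)" using c by simp
      also have "\<dots> \<le> ?B * norm f * (\<Sum>j=1..n. step_weight \<alpha> j n * (barrier s j - barrier s (j - 1)))"
        using C1 B c bar[OF n(2)] by (intro mult_mono mult_right_mono) (auto intro!: mult_nonneg_nonneg)
      finally show "e n \<in> D \<and> (\<Sum>j=1..n. step_weight \<alpha> j n *\<^sub>R (e j - e (j - 1))) = H *\<^sub>R A (e n) + \<rho> n \<and>
        K * norm (\<rho> n) \<le> ?B * norm f * (\<Sum>j=1..n. step_weight \<alpha> j n * (barrier s j - barrier s (j - 1)))"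
        using 1 D_diff[OF vD[OF n(1)] uD[OF grid(2)[OF n(1)]]] by (simp add: e_def)
    next
      fix n and hs :: "real list" assume n: "n \<in> {1..N}" "n < n0" and zs: "all_pos hs"
      have "norm (e n) \<le> K * norm f + K * norm f"
        unfolding e_def using n K
        by (intro order_trans[OF norm_triangle_ineq4] add_mono fd_scheme_stable[OF \<alpha> T N v _ _ KJ] Ku[OF sol] grid) auto
      then have "norm (Jprod hs (e n)) \<le> K * (K * norm f + K * norm f)"
        using KJ[OF zs, of "e n"] K by (meson mult_left_mono order_trans zero_le_one)
      also have "\<dots> = 2 * K\<^sup>2 * norm f * (real n0 powr s * real n0 powr (-s))"
      proof -
        have "real n0 powr s * real n0 powr (-s) = 1" using n0 by (simp flip: powr_add)
        then show ?thesis by (simp add: power2_eq_square)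
      qed
      also have "\<dots> = (2 * K\<^sup>2 * real n0 powr s) * norm f * real n0 powr (-s)" by simp
      also have "\<dots> \<le> ?B * norm f * real n powr (-s)"
        using C2 B s n by (intro mult_mono mult_right_mono powr_mono2') (auto intro!: mult_nonneg_nonneg)
      finally show "norm (Jprod hs (e n)) \<le> ?B * norm f * barrier s n" using n by (simp add: barrier_simps)
    qed (use KJ B n in auto)
    then show ?thesis using n by (simp add: e_def h_def barrier_simps)
  qed
  then show ?thesis using that[of ?B] B by blast
qed

end

section \<open>Convergence of the scheme\<close>

theorem theorem5p1:
  fixes D :: "'x::complex_banach set"
    and A :: "'x \<Rightarrow> 'x"
    and \<alpha> T \<phi>\<^sub>0 \<epsilon> :: real
  assumes "0 < \<alpha>" and "\<alpha> < 1" and "0 < T"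
    and "linear_operator_on D A"
    and "unbounded_operator_on D A"
    and "closed_operator_on D A"
    and "closure D = UNIV"
    and "0 < \<phi>\<^sub>0" and "\<phi>\<^sub>0 < pi / 2"
    and "sectorial D (\<lambda>x. - A x) \<phi>\<^sub>0"
    and "0 < \<epsilon>" and "\<epsilon> < 1 - \<alpha>"
  shows
    "(\<exists>C. \<forall>f\<in>D. \<forall>N\<ge>1. \<forall>v. fd_scheme D A \<alpha> T N f v \<longrightarrow>
        (\<forall>n\<le>N. norm (v n) \<le> C * norm f)) \<and>
     (\<forall>f\<in>D. \<forall>u v. cauchy_solution D A \<alpha> T f u \<and> (\<forall>N\<ge>1. fd_scheme D A \<alpha> T N f (v N)) \<longrightarrow>
        (\<forall>t\<in>{0..T}. (\<lambda>N. v N (grid_index T N t)) \<longlonglongrightarrow> u t)) \<and>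
     (\<forall>f\<in>D. \<forall>u v. cauchy_solution D A \<alpha> T f u \<and> (\<forall>N\<ge>1. fd_scheme D A \<alpha> T N f (v N)) \<longrightarrow>
        (\<lambda>N. v N N) \<longlonglongrightarrow> u T) \<and>
     (\<exists>C :: real \<Rightarrow> real.
        (\<forall>t\<in>{0..T}. 0 < C t) \<and>
        (\<forall>t\<in>{0..T}. \<forall>f\<in>D. \<forall>u. cauchy_solution D A \<alpha> T f u \<longrightarrow>
          (\<forall>N\<ge>1. \<forall>v. fd_scheme D A \<alpha> T N f v \<longrightarrow>
            norm (v (grid_index T N t) - u (real (grid_index T N t) * step_size T N))
              \<le> C t * norm f * step_size T N powr rate_exponent \<epsilon> \<alpha>)) \<and>
        (\<forall>f\<in>D. \<forall>u. cauchy_solution D A \<alpha> T f u \<longrightarrow>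
          (\<forall>N\<ge>1. \<forall>v. fd_scheme D A \<alpha> T N f v \<longrightarrow>
            norm (v N - u T) \<le> C T * norm f * step_size T N powr rate_exponent \<epsilon> \<alpha>)))"
proof -
  obtain C\<^sub>0 where C\<^sub>0: "\<And>\<zeta>. \<zeta> \<notin> sector \<phi>\<^sub>0 \<Longrightarrow> onorm (resolvent D (\<lambda>x. - A x) \<zeta>) \<le> C\<^sub>0 / (1 + cmod \<zeta>)"
    and spec: "spectrum_of D (\<lambda>x. - A x) \<subseteq> sector \<phi>\<^sub>0"
    using assms(10) by (auto simp: sectorial_def)
  interpret sectorial_resolvent D A \<phi>\<^sub>0 C\<^sub>0
    by standard (use assms spec C\<^sub>0 in auto)
  note \<alpha> = assms(1,2) and T = assms(3)
  define s where "s = rate_exponent \<epsilon> \<alpha>"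
  have s: "0 < s" "s < 1 - \<alpha>"
    using assms by (auto simp: s_def rate_exponent_def)
  obtain M where M: "1 \<le> M" "\<And>hs f. all_pos hs \<Longrightarrow> norm (Jprod hs f) \<le> M * norm f"
    using norm_Jprod by blast
  obtain B where B: "0 < B" and err: "\<And>f u N v n. cauchy_solution D A \<alpha> T f u \<Longrightarrow> fd_scheme D A \<alpha> T N f v \<Longrightarrow> 1 \<le> N \<Longrightarrow> n \<in> {1..N} \<Longrightarrow>
      norm (v n - u (real n * step_size T N)) \<le> B * norm f * real n powr (-s)"
    using fd_scheme_error[OF \<alpha> T s] by blast
  have stable: "\<exists>C. \<forall>f\<in>D. \<forall>N\<ge>1. \<forall>v. fd_scheme D A \<alpha> T N f v \<longrightarrow> (\<forall>n\<le>N. norm (v n) \<le> C * norm f)"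
    using fd_scheme_stable[OF \<alpha> T _ _ _ _ M(2)] M(1) by (intro exI[of _ M]) auto
  define C where "C t = B * (2 / t) powr s + 1" for t :: real
  have C: "0 < C t" for t using B by (simp add: C_def add_nonneg_pos)
  have h_pos: "0 < step_size T N" if "1 \<le> N" for N using T that by (simp add: step_size_def)
  have index: "real (grid_index T N t) * step_size T N \<le> t" "t < (real (grid_index T N t) + 1) * step_size T N"
    "grid_index T N t \<le> N" if t: "t \<in> {0..T}" and N: "1 \<le> N" for t N
  proof -
    let ?h = "step_size T N"
    have q: "0 \<le> t / ?h" using t h_pos[OF N] by simp
    then have n: "real (grid_index T N t) = of_int \<lfloor>t / ?h\<rfloor>" by (simp add: grid_index_def)
    then have lo: "real (grid_index T N t) \<le> t / ?h" and hi: "t / ?h < real (grid_index T N t) + 1" by linarith+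
    show "real (grid_index T N t) * ?h \<le> t" using lo h_pos[OF N] by (simp add: pos_le_divide_eq)
    show "t < (real (grid_index T N t) + 1) * ?h" using hi h_pos[OF N] by (simp add: pos_divide_less_eq)
    have "t / ?h \<le> T / ?h" using t h_pos[OF N] by (intro divide_right_mono) auto
    also have "T / ?h = real N" using T N by (simp add: step_size_def)
    finally show "grid_index T N t \<le> N" using lo by linarith
  qed
  have rate: "norm (v (grid_index T N t) - u (real (grid_index T N t) * step_size T N)) \<le> C t * norm f * step_size T N powr s"
    if t: "t \<in> {0..T}" and sol: "cauchy_solution D A \<alpha> T f u" and N: "1 \<le> N" and v: "fd_scheme D A \<alpha> T N f v" for t f u N v
  proof (cases "grid_index T N t = 0")
    case True
    then have "v (grid_index T N t) = u (real (grid_index T N t) * step_size T N)"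
      using sol v by (simp add: cauchy_solution_def fd_scheme_def)
    then show ?thesis using C[of t] by (simp add: less_imp_le)
  next
    case False
    let ?n = "grid_index T N t" and ?h = "step_size T N"
    have h: "0 < ?h" by (rule h_pos[OF N])
    have n: "?n \<in> {1..N}" using index(3)[OF t N] False by auto
    then have n1: "1 \<le> real ?n" by simp
    have "1 * ?h \<le> real ?n * ?h" using n1 h by (intro mult_right_mono) auto
    then have t0: "0 < t" using index(1)[OF t N] h by linarith
    \<comment> \<open>From step one on the grid point below \<open>t\<close> is at least \<open>t / 2\<close>.\<close>
    have "(real ?n + 1) * ?h \<le> (2 * real ?n) * ?h" using n1 h by (intro mult_right_mono) auto
    then have "t / 2 \<le> real ?n * ?h" using index(2)[OF t N] by linarith
    then have "(real ?n * ?h) powr (-s) \<le> (t / 2) powr (-s)" using t0 s by (intro powr_mono2') auto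
    moreover have "(t / 2) powr (-s) = (2 / t) powr s" using t0 by (simp add: powr_divide powr_minus field_simps)
    moreover have "(real ?n * ?h) powr (-s) * ?h powr s = real ?n powr (-s)"
      using h by (simp add: powr_mult powr_minus)
    ultimately have "real ?n powr (-s) \<le> (2 / t) powr s * ?h powr s"
      by (metis mult_right_mono powr_ge_zero)
    then have "B * norm f * real ?n powr (-s) \<le> B * norm f * ((2 / t) powr s * ?h powr s)"
      using B by (intro mult_left_mono) auto
    also have "\<dots> = (B * (2 / t) powr s) * norm f * ?h powr s" by simp
    also have "\<dots> \<le> C t * norm f * ?h powr s" unfolding C_def by (intro mult_right_mono) auto
    finally show ?thesis using err[OF sol v N n] by linarith
  qed
  have h_lim: "(\<lambda>N. step_size T N) \<longlonglongrightarrow> 0"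
    unfolding step_size_def by (rule lim_const_over_n)
  have conv: "(\<lambda>N. v N (grid_index T N t)) \<longlonglongrightarrow> u t"
    if sol: "cauchy_solution D A \<alpha> T f u" and v: "\<forall>N\<ge>1. fd_scheme D A \<alpha> T N f (v N)" and t: "t \<in> {0..T}" for f u v t
  proof -
    let ?t = "\<lambda>N. real (grid_index T N t) * step_size T N"
    have "(\<lambda>N. C t * norm f * step_size T N powr s) \<longlonglongrightarrow> C t * norm f * 0 powr s"
      using s h_lim T by (intro tendsto_intros tendsto_powr') (auto simp: step_size_def)
    then have "(\<lambda>N. C t * norm f * step_size T N powr s) \<longlonglongrightarrow> 0" by simp
    moreover have "\<forall>\<^sub>F N in sequentially. norm (v N (grid_index T N t) - u (?t N)) \<le> C t * norm f * step_size T N powr s"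
      using eventually_ge_at_top[of 1] by eventually_elim (use rate[OF t sol] v in auto)
    ultimately have e: "(\<lambda>N. v N (grid_index T N t) - u (?t N)) \<longlonglongrightarrow> 0"
      by (rule Lim_null_comparison[rotated])
    have near: "?t N \<in> {0..T}" "\<bar>?t N - t\<bar> \<le> step_size T N" if N: "1 \<le> N" for N
      using index(1,2)[OF t N] h_pos[OF N] t by (auto simp: algebra_simps)
    have "(\<lambda>N. ?t N - t) \<longlonglongrightarrow> 0"
      by (rule Lim_null_comparison[OF _ h_lim]) (auto intro!: eventually_mono[OF eventually_ge_at_top[of 1]] near)
    then have lim: "?t \<longlonglongrightarrow> t" by (simp add: Lim_null[of ?t])
    have "continuous_on {0..T} u" using sol by (simp add: cauchy_solution_def)
    moreover have "\<forall>\<^sub>F N in sequentially. ?t N \<in> {0..T}"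
      by (rule eventually_mono[OF eventually_ge_at_top[of 1] near(1)])
    ultimately have "(\<lambda>N. u (?t N)) \<longlonglongrightarrow> u t"
      using continuous_on_tendsto_compose[OF _ lim t] by blast
    from tendsto_add[OF e this] show ?thesis by simp
  qed
  have T_index: "grid_index T N T = N" if "1 \<le> N" for N
    using T that by (simp add: grid_index_def step_size_def)
  have T_mem: "T \<in> {0..T}" using T by simp
  have conv_T: "(\<lambda>N. v N N) \<longlonglongrightarrow> u T"
    if "cauchy_solution D A \<alpha> T f u" "\<forall>N\<ge>1. fd_scheme D A \<alpha> T N f (v N)" for f u v
  proof (rule Lim_transform_eventually[OF conv[OF that T_mem]])
    show "\<forall>\<^sub>F N in sequentially. v N (grid_index T N T) = v N N"
      using eventually_ge_at_top[of 1] by eventually_elim (simp add: T_index)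
  qed
  have rate_T: "norm (v N - u T) \<le> C T * norm f * step_size T N powr s"
    if "cauchy_solution D A \<alpha> T f u" "1 \<le> N" "fd_scheme D A \<alpha> T N f v" for f u N v
    using rate[OF T_mem that] that T by (simp add: T_index) (simp add: step_size_def)
  show ?thesis
    unfolding s_def[symmetric]
    by (intro conjI exI[of _ C] stable ballI allI impI; (elim conjE)?)
       (rule C conv conv_T rate rate_T; assumption)+
qed

end
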